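(* For every constant $\epsilon\in(0,1)$ (with $\frac{1+\epsilon}{\epsilon}$ an integer), there is an algorithm which, given any instance of the (1,2)-Flowshop-Packing problem with $n$ jobs, runs in time polynomial in $n$ (the exponent depending only on $\epsilon$; overall $\mathrm{poly}(n^{1/\epsilon})$) and outputs a set of jobs $\mathcal{J}^{selected}$ together with a schedule on the single two-stage flowshop of makespan at most $1$, such that $p(\mathcal{J}^{selected})\ge (1-\epsilon)\,\mathrm{OPT}$. That is, the (1,2)-Flowshop-Packing problem admits a polynomial-time approximation scheme (PTAS).
   Context: The (m,2)-Flowshop-Packing problem: given $m$ identical two-stage flowshops $F_1,\dots,F_m$ (each consisting of a first-stage machine followed by a second-stage machine) and $n$ jobs $J_i=(a_i,b_i,p_i)$, $i\in\{1,\dots,n\}$, where $a_i\ge0$ and $b_i\ge 0$ are the processing times of the first and second operation of $J_i$ and $p_i$ is its profit (with $a_i+b_i\le 1$). A job assigned to a flowshop is processed non-preemptively, first its first operation on the first-stage machine, then its second operation on the second-stage machine, the second operation starting only after the first is completed. The makespan is the completion time of the last job. The goal is to select a subset $\mathcal{J}^{selected}$ of jobs and schedule them on the flowshops so that the makespan is at most $1$ and the total profit $p(\mathcal{J}^{selected})=\sum_{J_i\in\mathcal{J}^{selected}}p_i$ is maximized; $\mathrm{OPT}$ denotes the optimal total profit. The (1,2)-Flowshop-Packing problem is the case $m=1$. A PTAS is a family of algorithms $\{\mathcal{A}_\epsilon\}_{\epsilon>0}$ where $\mathcal{A}_\epsilon$ has approximation ratio $1-\epsilon$ and running time $O(n^{f(1/\epsilon)})$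 for some function $f$. *)

theory Defs
  imports Complex_Main "HOL-Library.Landau_Symbols"
begin

section \<open>Two-stage flowshop packing\<close>

record job =
  time1 :: real
  time2 :: real
  profit :: real

text \<open>An instance is a list of jobs; a job is referred to by its position \<open>i < length js\<close>.
  Profits are arbitrary reals.\<close>

definition fs_instance :: "job list \<Rightarrow> bool" where
  "fs_instance js \<longleftrightarrow>
     (\<forall>J \<in> set js. 0 \<le> time1 J \<and> 0 \<le> time2 J \<and> time1 J + time2 J \<le> 1)"

text \<open>Job \<open>i\<close> is assigned to flowshop \<open>F i\<close>, its two operations start at times \<open>x i\<close> and \<open>y i\<close>.
  Each machine processes one operation at a time, without preemption.\<close>

definition fs_schedule ::
  "nat \<Rightarrow> job list \<Rightarrow> nat set \<Rightarrow> (nat \<Rightarrow> nat) \<Rightarrow> (nat \<Rightarrow> real) \<Rightarrow> (nat \<Rightarrow> real) \<Rightarrow> bool" where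
  "fs_schedule m js S F x y \<longleftrightarrow>
     S \<subseteq> {..<length js} \<and>
     (\<forall>i\<in>S. F i < m \<and> 0 \<le> x i \<and> x i + time1 (js ! i) \<le> y i) \<and>
     (\<forall>i\<in>S. \<forall>j\<in>S. i \<noteq> j \<and> F i = F j \<longrightarrow>
        (x i + time1 (js ! i) \<le> x j \<or> x j + time1 (js ! j) \<le> x i) \<and>
        (y i + time2 (js ! i) \<le> y j \<or> y j + time2 (js ! j) \<le> y i))"

text \<open>The element \<open>0\<close> only matters for \<open>S = {}\<close>: completion times are nonnegative.\<close>

definition makespan :: "job list \<Rightarrow> nat set \<Rightarrow> (nat \<Rightarrow> real) \<Rightarrow> real" where
  "makespan js S y = Max (insert 0 ((\<lambda>i. y i + time2 (js ! i)) ` S))"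

definition total_profit :: "job list \<Rightarrow> nat set \<Rightarrow> real" where
  "total_profit js S = (\<Sum>i\<in>S. profit (js ! i))"

definition OPT :: "nat \<Rightarrow> job list \<Rightarrow> real" where
  "OPT m js =
     Max {total_profit js S | S. \<exists>F x y. fs_schedule m js S F x y \<and> makespan js S y \<le> 1}"


section \<open>Real random access machine programs\<close>

text \<open>
  Algorithms are programs of a structured real RAM with unit-cost operations. There are
  separate stores for natural numbers (indices, counters) and for reals; both consist of named
  arrays of unbounded length, and entry \<open>0\<close> of an array serves as a scalar variable.

  Three restrictions keep unit-cost arithmetic honest. Natural numbers have only addition and
  truncated subtraction. There is no conversion from reals to naturals (no floor). The only
  constants are natural numbers, so a program cannot hide information in a real constant.
\<close>

type_synonym vname = string

record state =
  nats :: "vname \<Rightarrow> nat \<Rightarrow> nat"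
  reals :: "vname \<Rightarrow> nat \<Rightarrow> real"

datatype nexp =
    NConst nat
  | NGet vname nexp
  | NAdd nexp nexp
  | NSub nexp nexp

datatype rexp =
    RNat nexp
  | RGet vname nexp
  | RAdd rexp rexp
  | RSub rexp rexp
  | RMul rexp rexp
  | RDiv rexp rexp

datatype bexp =
    NLess nexp nexp
  | RLess rexp rexp
  | BNot bexp
  | BAnd bexp bexp

datatype com =
    Skip
  | NSet vname nexp nexp
  | RSet vname nexp rexp
  | Seq com com
  | Cond bexp com com
  | While bexp com

fun nval :: "nexp \<Rightarrow> state \<Rightarrow> nat" where
  "nval (NConst k) s = k"
| "nval (NGet v i) s = nats s v (nval i s)"
| "nval (NAdd e f) s = nval e s + nval f s"
| "nval (NSub e f) s = nval e s - nval f s"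

fun rval :: "rexp \<Rightarrow> state \<Rightarrow> real" where
  "rval (RNat e) s = real (nval e s)"
| "rval (RGet v i) s = reals s v (nval i s)"
| "rval (RAdd e f) s = rval e s + rval f s"
| "rval (RSub e f) s = rval e s - rval f s"
| "rval (RMul e f) s = rval e s * rval f s"
| "rval (RDiv e f) s = rval e s / rval f s"

fun bval :: "bexp \<Rightarrow> state \<Rightarrow> bool" where
  "bval (NLess e f) s \<longleftrightarrow> nval e s < nval f s"
| "bval (RLess e f) s \<longleftrightarrow> rval e s < rval f s"
| "bval (BNot b) s \<longleftrightarrow> \<not> bval b s"
| "bval (BAnd b c) s \<longleftrightarrow> bval b s \<and> bval c s"

text \<open>The cost of evaluating an expression is its number of nodes.\<close>

fun ncost :: "nexp \<Rightarrow> nat" where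
  "ncost (NConst k) = 1"
| "ncost (NGet v i) = 1 + ncost i"
| "ncost (NAdd e f) = 1 + ncost e + ncost f"
| "ncost (NSub e f) = 1 + ncost e + ncost f"

fun rcost :: "rexp \<Rightarrow> nat" where
  "rcost (RNat e) = 1 + ncost e"
| "rcost (RGet v i) = 1 + ncost i"
| "rcost (RAdd e f) = 1 + rcost e + rcost f"
| "rcost (RSub e f) = 1 + rcost e + rcost f"
| "rcost (RMul e f) = 1 + rcost e + rcost f"
| "rcost (RDiv e f) = 1 + rcost e + rcost f"

fun bcost :: "bexp \<Rightarrow> nat" where
  "bcost (NLess e f) = 1 + ncost e + ncost f"
| "bcost (RLess e f) = 1 + rcost e + rcost f"
| "bcost (BNot b) = 1 + bcost b"
| "bcost (BAnd b c) = 1 + bcost b + bcost c"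

definition nupd :: "vname \<Rightarrow> nat \<Rightarrow> nat \<Rightarrow> state \<Rightarrow> state" where
  "nupd v i k s = s\<lparr>nats := (nats s)(v := (nats s v)(i := k))\<rparr>"

definition rupd :: "vname \<Rightarrow> nat \<Rightarrow> real \<Rightarrow> state \<Rightarrow> state" where
  "rupd v i r s = s\<lparr>reals := (reals s)(v := (reals s v)(i := r))\<rparr>"

text \<open>\<open>exec c s t s'\<close>: started in state \<open>s\<close>, program \<open>c\<close> halts in state \<open>s'\<close> after \<open>t\<close> steps.\<close>

inductive exec :: "com \<Rightarrow> state \<Rightarrow> nat \<Rightarrow> state \<Rightarrow> bool" where
  Skip: "exec Skip s 1 s"
| NSet: "exec (NSet v i e) s (1 + ncost i + ncost e) (nupd v (nval i s) (nval e s) s)"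
| RSet: "exec (RSet v i e) s (1 + ncost i + rcost e) (rupd v (nval i s) (rval e s) s)"
| Seq: "exec c s t s' \<Longrightarrow> exec d s' t' s'' \<Longrightarrow> exec (Seq c d) s (t + t') s''"
| CondTrue: "bval b s \<Longrightarrow> exec c s t s' \<Longrightarrow> exec (Cond b c d) s (1 + bcost b + t) s'"
| CondFalse: "\<not> bval b s \<Longrightarrow> exec d s t s' \<Longrightarrow> exec (Cond b c d) s (1 + bcost b + t) s'"
| WhileFalse: "\<not> bval b s \<Longrightarrow> exec (While b c) s (1 + bcost b) s"
| WhileTrue: "bval b s \<Longrightarrow> exec c s t s' \<Longrightarrow> exec (While b c) s' t' s'' \<Longrightarrow>
    exec (While b c) s (1 + bcost b + t + t') s''"

inductive_cases exec_SkipE: "exec Skip s t s'"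
inductive_cases exec_NSetE: "exec (NSet v i e) s t s'"
inductive_cases exec_RSetE: "exec (RSet v i e) s t s'"
inductive_cases exec_SeqE: "exec (Seq c d) s t s'"
inductive_cases exec_CondE: "exec (Cond b c d) s t s'"
inductive_cases exec_WhileE: "exec (While b c) s t s'"

lemma exec_deterministic:
  "exec c s t s' \<Longrightarrow> exec c s u s'' \<Longrightarrow> u = t \<and> s'' = s'"
proof (induction arbitrary: u s'' rule: exec.induct)
  case (Skip s)
  then show ?case by (auto elim: exec_SkipE)
next
  case (NSet v i e s)
  then show ?case by (auto elim: exec_NSetE)
next
  case (RSet v i e s)
  then show ?case by (auto elim: exec_RSetE)
next
  case (Seq c s t s' d t' s'')
  from Seq.prems show ?case
    by (rule exec_SeqE) (auto dest!: Seq.IH)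
next
  case (CondTrue b s c t s' d)
  from CondTrue.prems show ?case
    by (rule exec_CondE) (use CondTrue.hyps(1) in \<open>auto dest!: CondTrue.IH\<close>)
next
  case (CondFalse b s d t s' c)
  from CondFalse.prems show ?case
    by (rule exec_CondE) (use CondFalse.hyps(1) in \<open>auto dest!: CondFalse.IH\<close>)
next
  case (WhileFalse b s c)
  from WhileFalse.prems show ?case
    by (rule exec_WhileE) (use WhileFalse.hyps in auto)
next
  case (WhileTrue b s c t s' t' s'')
  from WhileTrue.prems show ?case
    by (rule exec_WhileE) (use WhileTrue.hyps(1) in \<open>auto dest!: WhileTrue.IH\<close>)
qed


section \<open>Approximation algorithms for flowshop packing\<close>

text \<open>The input occupies the scalar \<open>n\<close> and the first \<open>n\<close> entries of the real arrays \<open>a\<close>,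
  \<open>b\<close>, \<open>p\<close>; everything else is initially zero.\<close>

definition input :: "job list \<Rightarrow> state" where
  "input js = \<lparr>
     nats = (\<lambda>v i. if v = ''n'' \<and> i = 0 then length js else 0),
     reals = (\<lambda>v i. if i < length js then
                      if v = ''a'' then time1 (js ! i)
                      else if v = ''b'' then time2 (js ! i)
                      else if v = ''p'' then profit (js ! i)
                      else 0
                    else 0)\<rparr>"

text \<open>The output is read off the first \<open>n\<close> entries of the array \<open>sel\<close> (nonzero means selected)
  and, for selected jobs, of the arrays \<open>F\<close>, \<open>x\<close>, \<open>y\<close>.\<close>

definition selected :: "job list \<Rightarrow> state \<Rightarrow> nat set" where
  "selected js s = {i. i < length js \<and> nats s ''sel'' i \<noteq> 0}"

definition approx_algorithm :: "nat \<Rightarrow> real \<Rightarrow> com \<Rightarrow> (nat \<Rightarrow> nat) \<Rightarrow> bool" where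
  "approx_algorithm m r A T \<longleftrightarrow>
     (\<forall>js. fs_instance js \<longrightarrow>
        (\<exists>t s. exec A (input js) t s \<and> t \<le> T (length js) \<and>
           fs_schedule m js (selected js s) (nats s ''F'') (reals s ''x'') (reals s ''y'') \<and>
           makespan js (selected js s) (reals s ''y'') \<le> 1 \<and>
           total_profit js (selected js s) \<ge> r * OPT m js))"

definition admits_PTAS :: "nat \<Rightarrow> bool" where
  "admits_PTAS m \<longleftrightarrow>
     (\<exists>(A :: real \<Rightarrow> com) (f :: real \<Rightarrow> real). \<forall>\<epsilon>>0. \<exists>T.
        (\<lambda>n. real (T n)) \<in> O(\<lambda>n. real n powr f (1 / \<epsilon>)) \<and>
        approx_algorithm m (1 - \<epsilon>) (A \<epsilon>) T)"

end

theory Submission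
  imports Defs
begin

text \<open>
  A set of jobs is schedulable iff in Johnson's order every job \<open>j\<close> satisfies: first operations up
  to and including \<open>j\<close> plus second operations from \<open>j\<close> on take time at most 1 (its \<open>load\<close>). Call a
  job early if \<open>a \<le> b\<close> and late otherwise, and let \<open>u = min a b\<close> and \<open>v = max a b\<close>. In the load of
  \<open>j\<close>, every job of the other group counts with \<open>u\<close>, and so does every job of the same group with
  smaller \<open>u\<close>.

  In an optimal solution and for each group, drop the least profitable one of the \<open>k\<close> jobs with the
  largest \<open>u\<close>. This costs a fraction \<open>1/k\<close> of the profit and frees at least \<open>\<alpha>\<close>, the \<open>k\<close>-th largest
  \<open>u\<close>, in every load. The slack pays for rounding \<open>u\<close> to multiples of \<open>\<alpha>/n\<close> for all remaining jobs
  of the group, and also for their order, since jobs with \<open>u \<le> \<alpha>\<close> only see the total work of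
  one machine up to \<open>\<alpha>\<close>. So the algorithm guesses the kept top jobs, both thresholds \<open>\<alpha>\<close> and the
  largest profit (the unit for rounding profits), and finds by dynamic programming, for each
  combination of rounded sums, a set with minimal sum of \<open>v\<close>. Every candidate is checked exactly.
\<close>

section \<open>Johnson's order\<close>

text \<open>A table of polynomial size cannot record the load at every position of the order. It is
  possible because, once the thresholds are fixed, controlling two sums per group suffices for the
  loads: that of u (\<open>lo\<close>) and that of v (\<open>hi\<close>). The former may be rounded,
  since its summands are at most \<alpha> and a total error of \<alpha> is affordable. The latter
  may not, since its summands have no bound in terms of the slack; hence it is kept as a real number
  and minimised, while the rounded sums index the table. Dropping costs each group 1/k of its own
  profit, thus 1/k of the whole, and rounding profits costs at most 1/k of the largest profit. This
  gives the ratio 1 - 2/k, and k = 2/\<epsilon> if 1/\<epsilon> is an integer. Wrong guesses do no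
  harm, because the test of a candidate does not refer to the guess. The machine has neither floor
  nor multiplication of naturals, so rounding counts multiples, and products of indices are built by
  addition.\<close>

definition bef :: "(nat \<Rightarrow> real) \<Rightarrow> (nat \<Rightarrow> real) \<Rightarrow> nat \<Rightarrow> nat \<Rightarrow> bool" where
  "bef a b i j \<longleftrightarrow>
     (if a i \<le> b i then \<not> a j \<le> b j \<or> a i < a j \<or> (a i = a j \<and> i < j)
      else \<not> a j \<le> b j \<and> (b j < b i \<or> (b j = b i \<and> j < i)))"

text \<open>Indices break ties, so the order is strict and total even among identical jobs; among
  late jobs the index order is reversed, like the order of \<open>b\<close>.\<close>

lemma bef_linear: "i \<noteq> j \<Longrightarrow> bef a b i j \<or> bef a b j i"
  unfolding bef_def by (cases "a i \<le> b i"; cases "a j \<le> b j"; simp; linarith)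

lemma bef_asym: "bef a b i j \<Longrightarrow> \<not> bef a b j i"
  unfolding bef_def by (cases "a i \<le> b i"; cases "a j \<le> b j"; simp; linarith)

lemma bef_trans: "bef a b i j \<Longrightarrow> bef a b j l \<Longrightarrow> bef a b i l"
  unfolding bef_def
  by (cases "a i \<le> b i"; cases "a j \<le> b j"; cases "a l \<le> b l"; simp; linarith)

lemma bef_irrefl: "\<not> bef a b i i"
  unfolding bef_def by auto

lemma bef_early: "bef a b i j \<Longrightarrow> a j \<le> b j \<Longrightarrow> a i \<le> b i \<and> a i \<le> a j"
  unfolding bef_def by (cases "a i \<le> b i"; simp; linarith)

lemma bef_late: "bef a b i j \<Longrightarrow> \<not> a i \<le> b i \<Longrightarrow> \<not> a j \<le> b j \<and> b j \<le> b i"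
  unfolding bef_def by (cases "a j \<le> b j"; simp; linarith)

definition before_sum :: "(nat \<Rightarrow> real) \<Rightarrow> (nat \<Rightarrow> real) \<Rightarrow> nat set \<Rightarrow> nat \<Rightarrow> real" where
  "before_sum a b S j = (\<Sum>i\<in>{i\<in>S. bef a b i j}. a i)"

definition after_sum :: "(nat \<Rightarrow> real) \<Rightarrow> (nat \<Rightarrow> real) \<Rightarrow> nat set \<Rightarrow> nat \<Rightarrow> real" where
  "after_sum a b S j = (\<Sum>i\<in>{i\<in>S. bef a b j i}. b i)"

definition load :: "(nat \<Rightarrow> real) \<Rightarrow> (nat \<Rightarrow> real) \<Rightarrow> nat set \<Rightarrow> nat \<Rightarrow> real" where
  "load a b S j = (\<Sum>i\<in>S. if i = j then a i + b i else if bef a b i j then a i else b i)"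

text \<open>Every job other than \<open>j\<close> comes either before or after it, which yields the
  two sums that define the start times. \<open>load\<close> itself is kept as one sum so that loads
  can be compared summand by summand.\<close>

lemma load_eq:
  assumes "finite S" "j \<in> S"
  shows "load a b S j = before_sum a b S j + a j + b j + after_sum a b S j"
proof -
  have 1: "(\<Sum>i\<in>S-{j}. if i = j then a i + b i else if bef a b i j then a i else b i) =
    (\<Sum>i\<in>(S-{j}) \<inter> {i. bef a b i j}. a i) + (\<Sum>i\<in>(S-{j}) \<inter> -{i. bef a b i j}. b i)"
  proof -
    have "(\<Sum>i\<in>S-{j}. if i = j then a i + b i else if bef a b i j then a i else b i) =
      (\<Sum>i\<in>S-{j}. if bef a b i j then a i else b i)"
      by (rule sum.cong) auto
    also have "\<dots> = (\<Sum>i\<in>(S-{j}) \<inter> {i. bef a b i j}. a i) + (\<Sum>i\<in>(S-{j}) \<inter> -{i. bef a b i j}. b i)"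
      using assms(1) by (subst sum.If_cases) auto
    finally show ?thesis .
  qed
  have 2: "(S-{j}) \<inter> {i. bef a b i j} = {i\<in>S. bef a b i j}" using bef_irrefl by auto
  have 3: "(S-{j}) \<inter> -{i. bef a b i j} = {i\<in>S. bef a b j i}"
    using bef_irrefl[of a b j] bef_linear[of _ j a b] bef_asym[of a b _ j] by blast
  have "load a b S j = a j + b j + (\<Sum>i\<in>S-{j}. if i = j then a i + b i else if bef a b i j then a i else b i)"
    unfolding load_def by (subst sum.remove[OF assms]) simp
  then show ?thesis unfolding 1 2 3 before_sum_def after_sum_def by simp
qed

text \<open>Machine one runs without idle time from 0, machine two without idle time up to 1.\<close>

lemma schedule_of_load:
  assumes inst: "\<And>i. i < length js \<Longrightarrow> time1 (js ! i) = a i \<and> time2 (js ! i) = b i"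
    and S: "S \<subseteq> {..<length js}" and nonneg: "\<And>i. 0 \<le> a i" "\<And>i. 0 \<le> b i"
    and load: "\<And>j. j \<in> S \<Longrightarrow> load a b S j \<le> 1"
    and F: "\<And>j. j \<in> S \<Longrightarrow> F j = 0"
    and x: "\<And>j. j \<in> S \<Longrightarrow> x j = before_sum a b S j"
    and y: "\<And>j. j \<in> S \<Longrightarrow> y j = 1 - b j - after_sum a b S j"
  shows "fs_schedule 1 js S F x y" "makespan js S y \<le> 1"
proof -
  have fin: "finite S" by (rule finite_subset[OF S]) simp
  have x1: "x i + a i \<le> x j" if "i \<in> S" "j \<in> S" "bef a b i j" for i j
  proof -
    have "(\<Sum>l\<in>insert i {l\<in>S. bef a b l i}. a l) \<le> (\<Sum>l\<in>{l\<in>S. bef a b l j}. a l)"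
    proof (rule sum_mono2)
      show "insert i {l\<in>S. bef a b l i} \<subseteq> {l\<in>S. bef a b l j}"
        using that bef_trans[of a b _ i j] by blast
    qed (use fin nonneg(1) in simp_all)
    then show ?thesis using that(1,2) fin bef_irrefl[of a b i]
      by (simp add: x before_sum_def)
  qed
  have y1: "y i + b i \<le> y j" if "i \<in> S" "j \<in> S" "bef a b i j" for i j
  proof -
    have "(\<Sum>l\<in>insert j {l\<in>S. bef a b j l}. b l) \<le> (\<Sum>l\<in>{l\<in>S. bef a b i l}. b l)"
    proof (rule sum_mono2)
      show "insert j {l\<in>S. bef a b j l} \<subseteq> {l\<in>S. bef a b i l}"
        using that bef_trans[of a b i j] by blast
    qed (use fin nonneg(2) in simp_all)
    then show ?thesis using that(1,2) fin bef_irrefl[of a b j]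
      by (simp add: y after_sum_def)
  qed
  \<comment> \<open>With machine one filled from 0 and machine two filled up to 1, the two
    operations of \<open>j\<close> are in the right order iff its load is at most 1.\<close>
  have xy: "x j + a j \<le> y j" if "j \<in> S" for j
    using load[OF that] x[OF that] y[OF that] load_eq[OF fin that, of a b] by simp
  have x0: "0 \<le> x j" if "j \<in> S" for j
    using x[OF that] nonneg by (simp add: before_sum_def sum_nonneg)
  have lt: "i < length js" if "i \<in> S" for i using S that by auto
  show "fs_schedule 1 js S F x y"
    unfolding fs_schedule_def
  proof (intro conjI ballI impI)
    show "S \<subseteq> {..<length js}" by (rule S)
  next
    fix i j assume h: "i \<in> S" "j \<in> S" "i \<noteq> j \<and> F i = F j"
    then show "x i + time1 (js ! i) \<le> x j \<or> x j + time1 (js ! j) \<le> x i"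
      using x1[of i j] x1[of j i] bef_linear[of i j a b] bef_asym[of a b i j] inst[OF lt, of i] inst[OF lt, of j] by auto
    show "y i + time2 (js ! i) \<le> y j \<or> y j + time2 (js ! j) \<le> y i"
      using h y1[of i j] y1[of j i] bef_linear[of i j a b] bef_asym[of a b i j] inst[OF lt, of i] inst[OF lt, of j] by auto
  next
    fix i assume h: "i \<in> S"
    show "F i < 1" "0 \<le> x i" "x i + time1 (js ! i) \<le> y i"
      using F[OF h] x0[OF h] xy[OF h] inst[OF lt[OF h]] by simp_all
  qed
  have "y i + time2 (js ! i) \<le> 1" if "i \<in> S" for i
  proof -
    have "0 \<le> after_sum a b S i" unfolding after_sum_def by (rule sum_nonneg) (rule nonneg)
    then show ?thesis using y[OF that] inst[OF lt[OF that]] by simp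
  qed
  then show "makespan js S y \<le> 1"
    unfolding makespan_def using fin by simp
qed

section \<open>The lower bound: every feasible schedule respects the loads\<close>

lemma finite_ex_max:
  fixes f :: "'i \<Rightarrow> real"
  assumes "finite S" "S \<noteq> {}"
  obtains m where "m \<in> S" "\<And>i. i \<in> S \<Longrightarrow> f i \<le> f m"
proof -
  have "Max (f ` S) \<in> f ` S" using assms by simp
  then obtain m where "m \<in> S" "f m = Max (f ` S)" by auto
  with assms that[of m] show thesis by simp
qed

lemma finite_ex_min:
  fixes f :: "'i \<Rightarrow> real"
  assumes "finite S" "S \<noteq> {}"
  obtains m where "m \<in> S" "\<And>i. i \<in> S \<Longrightarrow> f m \<le> f i"
proof -
  obtain m where "m \<in> S" "\<And>i. i \<in> S \<Longrightarrow> - f i \<le> - f m"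
    using finite_ex_max[OF assms, of "\<lambda>i. - f i"] by blast
  with that[of m] show thesis by simp
qed

text \<open>The induction removes an interval that ends last; all others then fit before its
  start.\<close>

lemma disjoint_intervals_sum:
  fixes x d :: "'i \<Rightarrow> real"
  assumes "finite I" "\<And>i. i \<in> I \<Longrightarrow> s \<le> x i \<and> x i + d i \<le> t \<and> 0 \<le> d i"
    and "\<And>i j. i \<in> I \<Longrightarrow> j \<in> I \<Longrightarrow> i \<noteq> j \<Longrightarrow> x i + d i \<le> x j \<or> x j + d j \<le> x i"
    and "s \<le> t"
  shows "sum d I \<le> t - s"
  using assms
proof (induction "card I" arbitrary: I t)
  case 0
  then show ?case by simp
next
  case (Suc n)
  then have ne: "I \<noteq> {}" by auto
  obtain c where c: "c \<in> I" "\<And>i. i \<in> I \<Longrightarrow> x i \<le> x c"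
    using finite_ex_max[OF \<open>finite I\<close> ne, of x] by blast
  \<comment> \<open>Intervals of length 0 may share the latest start with a proper one, so a longest
    one among the latest starts is taken.\<close>
  define H where "H = {i\<in>I. x i = x c}"
  have H: "finite H" "H \<noteq> {}" using c Suc.prems(1) by (auto simp: H_def)
  obtain m where m: "m \<in> H" "\<And>i. i \<in> H \<Longrightarrow> d i \<le> d m"
    using finite_ex_max[OF H, of d] by blast
  have mI: "m \<in> I" "x m = x c" using m by (auto simp: H_def)
  have end': "x i + d i \<le> x m" if "i \<in> I" "i \<noteq> m" for i
  proof (cases "x i + d i \<le> x m")
    case False
    then have "x m + d m \<le> x i" using Suc.prems(3)[OF that(1) mI(1) that(2)] by simp
    moreover have "x i \<le> x m" "0 \<le> d m" using c(2)[OF that(1)] mI Suc.prems(2) by auto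
    ultimately have "x i = x m" "d m = 0" by auto
    moreover from this have "i \<in> H" using that mI by (auto simp: H_def)
    ultimately show ?thesis using m(2)[of i] by simp
  qed
  have "sum d (I - {m}) \<le> x m - s"
  proof (rule Suc.hyps(1))
    show "n = card (I - {m})" using Suc.hyps(2) mI(1) by simp
    show "s \<le> x m" using Suc.prems(2)[OF mI(1)] by simp
  qed (use Suc.prems end' in auto)
  moreover have "sum d I = d m + sum d (I - {m})"
    using Suc.prems(1) mI(1) by (simp add: sum.remove)
  ultimately show ?case using Suc.prems(2)[OF mI(1)] by simp
qed

text \<open>Johnson's lower bound. All jobs with \<open>x i + a i \<le> x c\<close> finish machine one before
  \<open>x c + a c\<close>, and all others start machine two after it. Comparing the load of \<open>j\<close> with this
  bound for the first (if \<open>j\<close> is early) or last (if \<open>j\<close> is late) job \<open>c\<close> among \<open>j\<close> and the jobs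
  with at least as large a minimum, in the order of machine one, only the summand of \<open>j\<close> can
  decrease, and the summand of \<open>c\<close> compensates for it.\<close>

lemma load_le_of_schedule:
  fixes a b x y :: "nat \<Rightarrow> real"
  assumes fin: "finite S" and nonneg: "\<And>i. 0 \<le> a i" "\<And>i. 0 \<le> b i"
    and x0: "\<And>i. i \<in> S \<Longrightarrow> 0 \<le> x i"
    and xy: "\<And>i. i \<in> S \<Longrightarrow> x i + a i \<le> y i"
    and y1: "\<And>i. i \<in> S \<Longrightarrow> y i + b i \<le> 1"
    and dx: "\<And>i j. i \<in> S \<Longrightarrow> j \<in> S \<Longrightarrow> i \<noteq> j \<Longrightarrow> x i + a i \<le> x j \<or> x j + a j \<le> x i"
    and dy: "\<And>i j. i \<in> S \<Longrightarrow> j \<in> S \<Longrightarrow> i \<noteq> j \<Longrightarrow> y i + b i \<le> y j \<or> y j + b j \<le> y i"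
  shows "sum a S \<le> 1" "sum b S \<le> 1" "j \<in> S \<Longrightarrow> load a b S j \<le> 1"
proof -
  have bnd: "0 \<le> x i \<and> x i + a i \<le> 1" "0 \<le> y i \<and> y i + b i \<le> 1" if "i \<in> S" for i
    using x0[OF that] xy[OF that] y1[OF that] nonneg[of i] by auto
  show "sum a S \<le> 1"
    using disjoint_intervals_sum[of S 0 x a 1] fin bnd nonneg dx by auto
  show "sum b S \<le> 1"
    using disjoint_intervals_sum[of S 0 y b 1] fin bnd nonneg dy by auto
  \<comment> \<open>A path through both machines that switches at the end of the first operation of
    \<open>c\<close>: the jobs of \<open>P\<close> and \<open>c\<close> fit on machine one before
    this moment, \<open>c\<close> and all others on machine two after it.\<close>
  have split: "(\<Sum>i\<in>S. if i = c then a i + b i else if i \<in> P then a i else b i) \<le> 1"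
    if c: "c \<in> S" and PQ: "\<And>i. i \<in> S \<Longrightarrow> i \<noteq> c \<Longrightarrow> i \<in> P \<Longrightarrow> x i + a i \<le> x c"
      "\<And>i. i \<in> S \<Longrightarrow> i \<noteq> c \<Longrightarrow> i \<notin> P \<Longrightarrow> x c + a c \<le> x i" for c P
  proof -
    let ?p = "insert c (S \<inter> P)" and ?q = "insert c (S - P)"
    have px: "x i + a i \<le> x c + a c" if "i \<in> ?p" for i
      using that PQ(1)[of i] nonneg(1)[of c] by (cases "i = c") auto
    have qy: "x c + a c \<le> y i" if "i \<in> ?q" for i
      using that PQ(2)[of i] nonneg(1)[of i] xy[of i] c by (cases "i = c") auto
    have "sum a ?p \<le> (x c + a c) - 0"
    proof (rule disjoint_intervals_sum)
      show "finite ?p" using fin by simp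
      show "0 \<le> x i \<and> x i + a i \<le> x c + a c \<and> 0 \<le> a i" if "i \<in> ?p" for i
        using px[OF that] x0[of i] nonneg(1) that c by blast
      show "x i + a i \<le> x k \<or> x k + a k \<le> x i" if "i \<in> ?p" "k \<in> ?p" "i \<noteq> k" for i k
        using that c dx[of i k] by blast
      show "0 \<le> x c + a c" using x0[OF c] nonneg(1)[of c] by simp
    qed
    moreover have "sum b ?q \<le> 1 - (x c + a c)"
    proof (rule disjoint_intervals_sum)
      show "finite ?q" using fin by simp
      show "x c + a c \<le> y i \<and> y i + b i \<le> 1 \<and> 0 \<le> b i" if "i \<in> ?q" for i
        using qy[OF that] y1[of i] nonneg(2) that c by blast
      show "y i + b i \<le> y k \<or> y k + b k \<le> y i" if "i \<in> ?q" "k \<in> ?q" "i \<noteq> k" for i k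
        using that c dy[of i k] by blast
      show "x c + a c \<le> 1" using bnd(1)[OF c] by simp
    qed
    moreover have "(\<Sum>i\<in>S. if i = c then a i + b i else if i \<in> P then a i else b i) =
      sum a ?p + sum b ?q"
    proof -
      have "sum a ?p = (\<Sum>i\<in>S. if i \<in> ?p then a i else 0)"
        using fin c by (subst sum.inter_restrict[symmetric]) (auto intro!: sum.cong)
      moreover have "sum b ?q = (\<Sum>i\<in>S. if i \<in> ?q then b i else 0)"
        using fin c by (subst sum.inter_restrict[symmetric]) (auto intro!: sum.cong)
      ultimately show ?thesis by (auto simp: sum.distrib[symmetric] intro!: sum.cong)
    qed
    ultimately show ?thesis by simp
  qed
  assume j: "j \<in> S"
  show "load a b S j \<le> 1"
  proof (cases "a j \<le> b j")
    case True
    define H where "H = {i\<in>S. i = j \<or> (a i \<le> b i \<and> bef a b j i)}"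
    have H: "finite H" "H \<noteq> {}" using fin j by (auto simp: H_def)
    obtain m where m: "m \<in> H" "\<And>i. i \<in> H \<Longrightarrow> x m \<le> x i"
      using finite_ex_min[OF H, of x] by blast
    define H' where "H' = {i\<in>H. x i = x m}"
    have H': "finite H'" "H' \<noteq> {}" using H m by (auto simp: H'_def)
    obtain c where c: "c \<in> H'" "\<And>i. i \<in> H' \<Longrightarrow> a c \<le> a i"
      using finite_ex_min[OF H', of a] by blast
    have cS: "c \<in> S" "c \<in> H" "x c = x m" using c by (auto simp: H'_def H_def)
    \<comment> \<open>If \<open>c\<close> and another job both have length 0 on machine one and
      start together, both alternatives of \<open>dx\<close> hold; the second conjunct then puts
      that job after \<open>c\<close>. Choosing \<open>c\<close> with least \<open>a\<close> among
      the earliest starts keeps all of \<open>H\<close> out of \<open>P\<close>.\<close>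
    define P where "P = {i. x i + a i \<le> x c \<and> \<not> x c + a c \<le> x i}"
    have PH: "i \<notin> P" if "i \<in> H" for i
    proof
      assume p: "i \<in> P"
      have "x i = x m" "a i = 0" using p m(2)[OF that] cS nonneg(1)[of i] unfolding P_def by auto
      then have "a c \<le> 0" using c(2)[of i] that by (auto simp: H'_def)
      then show False using p \<open>x i = x m\<close> cS nonneg(1)[of c] by (auto simp: P_def)
    qed
    have "load a b S j \<le> (\<Sum>i\<in>S. if i = c then a i + b i else if i \<in> P then a i else b i)
        + (if c = j then 0 else a j - a c)"
    proof -
      \<comment> \<open>Two summands need a correction if \<open>c\<close> differs from
        \<open>j\<close>: that of \<open>j\<close> may be too small by \<open>a j\<close> in the
        bound, and that of \<open>c\<close> is too large by \<open>a c\<close>. Since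
        \<open>c\<close> follows \<open>j\<close> among the early jobs,
        \<open>a j \<le> a c\<close>.\<close>
      have "load a b S j \<le> (\<Sum>i\<in>S. (if i = c then a i + b i else if i \<in> P then a i else b i)
        + (if i = j then (if c = j then 0 else a j) else 0)
        + (if i = c then (if c = j then 0 else - a c) else 0))"
        unfolding load_def
      proof (rule sum_mono)
        fix i assume i: "i \<in> S"
        show "(if i = j then a i + b i else if bef a b i j then a i else b i) \<le>
          (if i = c then a i + b i else if i \<in> P then a i else b i)
          + (if i = j then (if c = j then 0 else a j) else 0)
          + (if i = c then (if c = j then 0 else - a c) else 0)"
        proof (cases "i \<in> H")
          case Hi: True
          have np: "i \<notin> P" by (rule PH[OF Hi])
          show ?thesis
          proof (cases "i = j")
            case False
            then have "\<not> bef a b i j" using Hi bef_asym[of a b j i] unfolding H_def by blast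
            then show ?thesis using np False by auto
          qed (use np in auto)
        next
          case False
          then have n: "i \<noteq> j" "i \<noteq> c" using cS i j by (auto simp: H_def)
          \<comment> \<open>Outside \<open>H\<close> every job counts in the load with its smaller
            time, hence with no more than in the bound, whatever \<open>P\<close> is.\<close>
          have "if bef a b i j then a i \<le> b i else b i \<le> a i"
          proof (cases "bef a b i j")
            case True
            then show ?thesis using bef_early \<open>a j \<le> b j\<close> by simp
          next
            case nb: False
            then have "\<not> a i \<le> b i"
              using False i n bef_linear[of i j a b] unfolding H_def by blast
            with nb show ?thesis by simp
          qed
          then show ?thesis using n by auto
        qed
      qed
      also have "\<dots> = (\<Sum>i\<in>S. if i = c then a i + b i else if i \<in> P then a i else b i)
        + (if c = j then 0 else a j - a c)"
        using fin j cS by (simp add: sum.distrib)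
      finally show ?thesis .
    qed
    moreover have "c \<noteq> j \<Longrightarrow> a j \<le> a c"
      using cS(2) bef_early[of a b j c] unfolding H_def by simp
    moreover have "(\<Sum>i\<in>S. if i = c then a i + b i else if i \<in> P then a i else b i) \<le> 1"
      using cS(1) dx[OF _ cS(1)] by (intro split) (auto simp: P_def)
    ultimately show ?thesis by (auto split: if_splits)
  next
    case False
    define H where "H = {i\<in>S. i = j \<or> (\<not> a i \<le> b i \<and> bef a b i j)}"
    have H: "finite H" "H \<noteq> {}" using fin j by (auto simp: H_def)
    obtain m where m: "m \<in> H" "\<And>i. i \<in> H \<Longrightarrow> x i \<le> x m"
      using finite_ex_max[OF H, of x] by blast
    define H' where "H' = {i\<in>H. x i = x m}"
    have H': "finite H'" "H' \<noteq> {}" using H m by (auto simp: H'_def)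
    obtain c where c: "c \<in> H'" "\<And>i. i \<in> H' \<Longrightarrow> a i \<le> a c"
      using finite_ex_max[OF H', of a] by blast
    have cS: "c \<in> S" "c \<in> H" "x c = x m" using c by (auto simp: H'_def H_def)
    \<comment> \<open>In the mirrored case a job that meets both alternatives of \<open>dx\<close>
      goes before \<open>c\<close>, which now is a latest start of greatest
      \<open>a\<close>.\<close>
    define P where "P = {i. x i + a i \<le> x c}"
    have PH: "i \<in> P" if "i \<in> H" "i \<noteq> c" for i
    proof (rule ccontr)
      assume p: "i \<notin> P"
      have iS: "i \<in> S" using that by (simp add: H_def)
      have "x c + a c \<le> x i" using dx[OF iS cS(1) that(2)] p by (simp add: P_def)
      then have "x i = x m" "a c = 0" using m(2)[OF that(1)] cS nonneg(1)[of c] by auto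
      then have "a i \<le> 0" using c(2)[of i] that by (auto simp: H'_def)
      then show False using p \<open>x i = x m\<close> cS by (auto simp: P_def)
    qed
    have "load a b S j \<le> (\<Sum>i\<in>S. if i = c then a i + b i else if i \<in> P then a i else b i)
        + (if c = j then 0 else b j - b c)"
    proof -
      have "load a b S j \<le> (\<Sum>i\<in>S. (if i = c then a i + b i else if i \<in> P then a i else b i)
        + (if i = j then (if c = j then 0 else b j) else 0)
        + (if i = c then (if c = j then 0 else - b c) else 0))"
        unfolding load_def
      proof (rule sum_mono)
        fix i assume i: "i \<in> S"
        show "(if i = j then a i + b i else if bef a b i j then a i else b i) \<le>
          (if i = c then a i + b i else if i \<in> P then a i else b i)
          + (if i = j then (if c = j then 0 else b j) else 0)
          + (if i = c then (if c = j then 0 else - b c) else 0)"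
        proof (cases "i \<in> H")
          case Hi: True
          have np: "i \<noteq> c \<Longrightarrow> i \<in> P" by (rule PH[OF Hi])
          show ?thesis
          proof (cases "i = j")
            case False
            then have "bef a b i j" using Hi by (auto simp: H_def)
            then show ?thesis using np False by auto
          qed (use np in auto)
        next
          case nH: False
          then have n: "i \<noteq> j" "i \<noteq> c" using cS i j by (auto simp: H_def)
          have "if bef a b i j then a i \<le> b i else b i \<le> a i"
          proof (cases "bef a b i j")
            case True
            then show ?thesis using nH i unfolding H_def by simp
          next
            case nb: False
            then have "bef a b j i" using n bef_linear[of i j a b] by blast
            with nb show ?thesis using bef_late[of a b j i] False by simp
          qed
          then show ?thesis using n by auto
        qed
      qed
      also have "\<dots> = (\<Sum>i\<in>S. if i = c then a i + b i else if i \<in> P then a i else b i)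
        + (if c = j then 0 else b j - b c)"
        using fin j cS by (simp add: sum.distrib)
      finally show ?thesis .
    qed
    moreover have "c \<noteq> j \<Longrightarrow> b j \<le> b c"
      using cS(2) bef_late[of a b c j] unfolding H_def by simp
    moreover have "(\<Sum>i\<in>S. if i = c then a i + b i else if i \<in> P then a i else b i) \<le> 1"
      using cS(1) dx[OF _ cS(1)] by (intro split) (auto simp: P_def)
    ultimately show ?thesis by (auto split: if_splits)
  qed
qed

section \<open>Exchanging small jobs, rounding and dynamic programming\<close>

definition lo :: "(nat \<Rightarrow> real) \<Rightarrow> (nat \<Rightarrow> real) \<Rightarrow> nat \<Rightarrow> real" where
  "lo a b i = min (a i) (b i)"

definition hi :: "(nat \<Rightarrow> real) \<Rightarrow> (nat \<Rightarrow> real) \<Rightarrow> nat \<Rightarrow> real" where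
  "hi a b i = max (a i) (b i)"

definition part :: "(nat \<Rightarrow> real) \<Rightarrow> (nat \<Rightarrow> real) \<Rightarrow> bool \<Rightarrow> nat set \<Rightarrow> nat set" where
  "part a b g X = {i\<in>X. (a i \<le> b i) = g}"

lemma part_subset: "part a b g X \<subseteq> X"
  unfolding part_def by blast

lemma finite_part: "finite X \<Longrightarrow> finite (part a b g X)"
  using finite_subset[OF part_subset] .

lemma sum_part:
  assumes "finite X"
  shows "sum f X = sum f (part a b g X) + sum f (part a b (\<not> g) X)"
proof -
  have "X = part a b g X \<union> part a b (\<not> g) X" "part a b g X \<inter> part a b (\<not> g) X = {}"
    unfolding part_def by auto
  then show ?thesis using sum.union_disjoint[OF finite_part finite_part] assms by metis
qed

definition contrib :: "(nat \<Rightarrow> real) \<Rightarrow> (nat \<Rightarrow> real) \<Rightarrow> nat \<Rightarrow> nat \<Rightarrow> real" where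
  "contrib a b j i = (if i = j then a i + b i else if bef a b i j then a i else b i)"

lemma load_contrib: "load a b S j = sum (contrib a b j) S"
  unfolding load_def contrib_def ..

lemma contrib_ge_lo: "0 \<le> a i \<Longrightarrow> 0 \<le> b i \<Longrightarrow> lo a b i \<le> contrib a b j i"
  unfolding contrib_def lo_def by auto

text \<open>Jobs before an early \<open>j\<close> are early, so their \<open>a\<close> is at most
  their \<open>b\<close>, and jobs after it count with \<open>b\<close> anyway. Thus the load of
  \<open>j\<close> exceeds the total work of machine two by at most \<open>lo a b j\<close>; for
  late \<open>j\<close> the same holds with machine one.\<close>

lemma contrib_le:
  assumes "0 \<le> lo a b j"
  shows "contrib a b j i \<le> (if i = j then lo a b j else 0) + (if a j \<le> b j then b i else a i)"
proof (cases "i = j")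
  case True
  then show ?thesis unfolding contrib_def lo_def by auto
next
  case False
  then show ?thesis using bef_early[of a b i j] bef_late[of a b j i] bef_linear[of i j a b]
    unfolding contrib_def by auto
qed

text \<open>The strict inequality decides the order within a group without recourse to the
  tie-breaking by index.\<close>

lemma contrib_eq_lo:
  assumes "i \<noteq> j" "(a i \<le> b i) = (a j \<le> b j) \<Longrightarrow> lo a b i < lo a b j"
  shows "contrib a b j i = lo a b i"
proof (cases "bef a b i j")
  case True
  have "a i \<le> b i"
  proof (rule ccontr)
    assume l: "\<not> a i \<le> b i"
    with bef_late[OF True] assms(2) show False unfolding lo_def by auto
  qed
  then show ?thesis using True assms(1) unfolding contrib_def lo_def by simp
next
  case False
  then have ji: "bef a b j i" using bef_linear assms(1) by blast
  have "\<not> a i \<le> b i"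
  proof
    assume e: "a i \<le> b i"
    with bef_early[OF ji] assms(2) show False unfolding lo_def by auto
  qed
  then show ?thesis using False assms(1) unfolding contrib_def lo_def by simp
qed

text \<open>Removing \<open>D\<close> pays for replacing \<open>R\<close> by \<open>R'\<close>: a job \<open>j\<close> with minimum at most \<open>\<alpha>\<close> has load at
  most \<open>\<alpha>\<close> above the total work of one machine, and for larger \<open>j\<close> all jobs of \<open>R'\<close> count with
  their minima.\<close>

lemma load_exchange:
  fixes a b :: "nat \<Rightarrow> real" and \<alpha> :: "bool \<Rightarrow> real"
  assumes nonneg: "\<And>i. 0 \<le> a i" "\<And>i. 0 \<le> b i"
    and fin: "finite T" "finite D" "finite R" "finite R'"
    and disj: "T \<inter> D = {}" "(T \<union> D) \<inter> R = {}" "T \<inter> R' = {}"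
    and sums: "sum a (T \<union> D \<union> R) \<le> 1" "sum b (T \<union> D \<union> R) \<le> 1"
    and load: "\<And>j. j \<in> T \<union> D \<union> R \<Longrightarrow> load a b (T \<union> D \<union> R) j \<le> 1"
    and alpha: "\<And>g. \<alpha> g \<le> sum (lo a b) (part a b g D)"
    and R'\<alpha>: "\<And>i. i \<in> R' \<Longrightarrow> lo a b i \<le> \<alpha> (a i \<le> b i)"
    and R'lo: "\<And>g. sum (lo a b) (part a b g R') \<le> sum (lo a b) (part a b g R) + \<alpha> g"
    and R'hi: "\<And>g. sum (hi a b) (part a b g R') \<le> sum (hi a b) (part a b g R)"
    and j: "j \<in> T \<union> R'"
  shows "load a b (T \<union> R') j \<le> 1"
proof -
  let ?g = "a j \<le> b j"
  have lo0: "0 \<le> lo a b i" for i using nonneg by (simp add: lo_def)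
  have un3: "sum f (T \<union> D \<union> R) = sum f T + sum f D + sum f R" for f :: "nat \<Rightarrow> real"
    using fin disj by (simp add: sum.union_disjoint)
  \<comment> \<open>\<open>R'\<close> is disjoint from \<open>T\<close> but may meet
    \<open>D\<close>: a dropped job whose minimum equals the threshold can be selected
    again.\<close>
  have un2: "sum f (T \<union> R') = sum f T + sum f R'" for f :: "nat \<Rightarrow> real"
    using fin disj by (simp add: sum.union_disjoint)
  show ?thesis
  proof (cases "lo a b j \<le> \<alpha> ?g")
    case True
    define c where "c i = (if ?g then b i else a i)" for i
    have c_part: "sum c X = sum (hi a b) (part a b ?g X) + sum (lo a b) (part a b (\<not> ?g) X)"
      if "finite X" for X
    proof -
      have "sum c (part a b ?g X) = sum (hi a b) (part a b ?g X)"
        by (rule sum.cong) (auto simp: c_def part_def hi_def)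
      moreover have "sum c (part a b (\<not> ?g) X) = sum (lo a b) (part a b (\<not> ?g) X)"
        by (rule sum.cong) (auto simp: c_def part_def lo_def)
      ultimately show ?thesis using sum_part[OF that, of c a b ?g] by simp
    qed
    have "load a b (T \<union> R') j \<le> (\<Sum>i\<in>T \<union> R'. (if i = j then lo a b j else 0) + c i)"
      unfolding load_contrib c_def using contrib_le[OF lo0] by (intro sum_mono)
    also have "\<dots> = lo a b j + sum c (T \<union> R')"
      using fin j by (simp add: sum.distrib)
    also have "\<dots> \<le> \<alpha> ?g + sum c T + sum c R'"
      using True un2[of c] by simp
    \<comment> \<open>In \<open>c\<close>, jobs of the group of \<open>j\<close> count with
      \<open>hi\<close>, whose sum did not grow, and jobs of the other group with \<open>lo\<close>,
      whose sum grew by at most one threshold. The removed jobs pay for this threshold and for that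
      of \<open>j\<close>.\<close>
    also have "\<dots> \<le> \<alpha> ?g + sum c T + (sum c R + \<alpha> (\<not> ?g))"
      using c_part[OF fin(4)] c_part[OF fin(3)] R'hi[of ?g] R'lo[of "\<not> ?g"] by linarith
    also have "\<dots> \<le> sum c T + sum c D + sum c R"
    proof -
      have "sum (lo a b) (part a b ?g D) \<le> sum (hi a b) (part a b ?g D)"
        by (rule sum_mono) (simp add: lo_def hi_def)
      then show ?thesis using c_part[OF fin(2)] alpha[of ?g] alpha[of "\<not> ?g"] by linarith
    qed
    also have "\<dots> \<le> 1"
      using sums unfolding un3[symmetric] c_def by (cases ?g) simp_all
    finally show ?thesis .
  next
    case False
    \<comment> \<open>Above the threshold \<open>j\<close> is a kept job, so it has a load in the
      old set as well, and all of \<open>R'\<close> counts with \<open>lo\<close>, the least any job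
      can contribute.\<close>
    then have jT: "j \<in> T" and jR': "j \<notin> R'" using R'\<alpha>[of j] j by auto
    have "sum (contrib a b j) R' = sum (lo a b) R'"
    proof (rule sum.cong[OF refl], rule contrib_eq_lo)
      fix i assume i: "i \<in> R'"
      show "i \<noteq> j" using i jR' by blast
      show "lo a b i < lo a b j" if "(a i \<le> b i) = (a j \<le> b j)"
        using R'\<alpha>[OF i] False that by simp
    qed
    also have "\<dots> \<le> sum (lo a b) R + sum (lo a b) D"
      using sum_part[OF fin(4), of "lo a b" a b True] sum_part[OF fin(3), of "lo a b" a b True]
        sum_part[OF fin(2), of "lo a b" a b True] R'lo[of True] R'lo[of False]
        alpha[of True] alpha[of False] by simp
    also have "\<dots> \<le> sum (contrib a b j) R + sum (contrib a b j) D"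
      using contrib_ge_lo[OF nonneg] by (intro add_mono sum_mono)
    finally have "load a b (T \<union> R') j \<le> load a b (T \<union> D \<union> R) j"
      unfolding load_contrib un2 un3 by simp
    also have "\<dots> \<le> 1" using load jT by blast
    finally show ?thesis .
  qed
qed

text \<open>\<open>rnd N d x\<close> rounds \<open>x / d\<close> up and subtracts one; it also makes sense for \<open>d = 0\<close>.\<close>

fun rnd :: "nat \<Rightarrow> real \<Rightarrow> real \<Rightarrow> nat" where
  "rnd 0 d x = 0"
| "rnd (Suc N) d x = rnd N d x + (if real (Suc N) * d < x then 1 else 0)"

lemma rnd_le: "rnd N d x \<le> N"
  by (induction N) auto

lemma rnd_lower:
  assumes "0 \<le> x" "0 \<le> d"
  shows "real (rnd N d x) * d \<le> x"
proof (induction N)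
  case 0
  then show ?case using assms by simp
next
  case (Suc N)
  have "real (rnd N d x + 1) * d \<le> real (Suc N) * d"
    using rnd_le[of N d x] assms(2) by (intro mult_right_mono) auto
  then show ?case using Suc by (auto simp: add.commute)
qed

text \<open>The count can be too small only by running into the cap \<open>N\<close>, and the bound
  on \<open>x\<close> covers that case.\<close>

lemma rnd_upper:
  assumes "0 \<le> d" "x \<le> real N * d"
  shows "x \<le> (real (rnd N d x) + 1) * d"
proof -
  have "rnd N d x = N \<or> x \<le> (real (rnd N d x) + 1) * d"
  proof (induction N)
    case (Suc N)
    show ?case
    proof (cases "real (Suc N) * d < x")
      case True
      have "rnd N d x = N"
      proof (rule ccontr)
        assume n: "rnd N d x \<noteq> N"
        then have "(real (rnd N d x) + 1) * d \<le> real (Suc N) * d"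
          using rnd_le[of N d x] assms(1) by (intro mult_right_mono) auto
        then show False using n Suc True by simp
      qed
      then show ?thesis using True by simp
    next
      case False
      then show ?thesis using Suc by (auto simp: algebra_simps)
    qed
  qed simp
  then show ?thesis using assms by (auto simp: algebra_simps)
qed

text \<open>Entry \<open>(i, c)\<close> is a set of eligible items below \<open>i\<close> with
  \<open>w\<close>-sum exactly \<open>c\<close> and least \<open>v\<close>-sum, together with that
  sum. The decision is a function of its own because the program stores only this bit and the sum;
  the set lives in the specification and is rebuilt from the bits.\<close>

fun dp :: "(nat \<Rightarrow> bool) \<Rightarrow> (nat \<Rightarrow> nat) \<Rightarrow> (nat \<Rightarrow> real) \<Rightarrow> nat \<Rightarrow> nat \<Rightarrow> (real \<times> nat set) option"
  and taken :: "(nat \<Rightarrow> bool) \<Rightarrow> (nat \<Rightarrow> nat) \<Rightarrow> (nat \<Rightarrow> real) \<Rightarrow> nat \<Rightarrow> nat \<Rightarrow> bool" where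
  "dp el w v 0 c = (if c = 0 then Some (0, {}) else None)"
| "dp el w v (Suc i) c = (if taken el w v i c
     then map_option (\<lambda>(x, S). (x + v i, insert i S)) (dp el w v i (c - w i))
     else dp el w v i c)"
| "taken el w v i c \<longleftrightarrow> el i \<and> w i \<le> c \<and> dp el w v i (c - w i) \<noteq> None \<and>
     (dp el w v i c = None \<or>
      fst (the (dp el w v i (c - w i))) + v i < fst (the (dp el w v i c)))"

declare taken.simps [simp del]

lemma dp_sound:
  "dp el w v i c = Some (x, S) \<Longrightarrow> S \<subseteq> {l. l < i \<and> el l} \<and> sum w S = c \<and> x = sum v S"
proof (induction i arbitrary: c x S)
  case 0
  then show ?case by (auto split: if_splits)
next
  case (Suc i)
  show ?case
  proof (cases "taken el w v i c")
    case False
    then have "dp el w v i c = Some (x, S)" using Suc.prems by simp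
    from Suc.IH[OF this] show ?thesis by auto
  next
    case True
    then obtain x' S' where d: "dp el w v i (c - w i) = Some (x', S')"
      "x = x' + v i" "S = insert i S'" using Suc.prems by auto
    have ih: "S' \<subseteq> {l. l < i \<and> el l}" "sum w S' = c - w i" "x' = sum v S'"
      using Suc.IH[OF d(1)] by auto
    have "finite S'" "i \<notin> S'" using ih(1) finite_subset[of S' "{..<i}"] by auto
    moreover have "w i \<le> c" "el i" using True by (auto simp: taken.simps)
    ultimately show ?thesis using d ih by auto
  qed
qed

text \<open>Any set with key sum \<open>c\<close> proves that the entry exists and competes with it;
  both facts are needed when the small jobs of an optimal solution are compared with the chosen
  ones.\<close>

lemma dp_optimal:
  assumes "S \<subseteq> {l. l < i \<and> el l}" "sum w S = c"
  shows "\<exists>x S'. dp el w v i c = Some (x, S') \<and> x \<le> sum v S"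
  using assms
proof (induction i arbitrary: c S)
  case 0
  then show ?case by simp
next
  case (Suc i)
  have fin: "finite S" using Suc.prems(1) finite_subset[of S "{..<Suc i}"] by auto
  show ?case
  proof (cases "i \<in> S")
    case False
    then have S: "S \<subseteq> {l. l < i \<and> el l}" using Suc.prems(1) by (auto simp: less_Suc_eq)
    obtain x S' where d: "dp el w v i c = Some (x, S')" "x \<le> sum v S"
      using Suc.IH[OF S Suc.prems(2)] by blast
    show ?thesis
    proof (cases "taken el w v i c")
      case True
      then show ?thesis using d by (auto simp: taken.simps)
    qed (use d in simp)
  next
    case True
    let ?S = "S - {i}"
    have S: "?S \<subseteq> {l. l < i \<and> el l}" and i: "el i"
      using Suc.prems(1) True by (auto simp: less_Suc_eq)
    have w: "sum w S = w i + sum w ?S" and v: "sum v S = v i + sum v ?S"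
      using fin True by (auto simp: sum.remove)
    have c: "sum w ?S = c - w i" "w i \<le> c" using w Suc.prems(2) by auto
    obtain x S' where d: "dp el w v i (c - w i) = Some (x, S')" "x \<le> sum v ?S"
      using Suc.IH[OF S c(1)] by blast
    show ?thesis
    proof (cases "taken el w v i c")
      case True
      then show ?thesis using d v by simp
    next
      case False
      then have "dp el w v i c \<noteq> None" "\<not> x + v i < fst (the (dp el w v i c))"
        using d i c by (auto simp: taken.simps)
      then show ?thesis using False d v by (cases "dp el w v i c") auto
    qed
  qed
qed

section \<open>Guesses, rounded keys and the approximation guarantee\<close>

lemma ex_top_subset:
  fixes f :: "'i \<Rightarrow> real"
  assumes "finite X" "k \<le> card X"
  shows "\<exists>T\<subseteq>X. card T = k \<and> (\<forall>i\<in>T. \<forall>j\<in>X - T. f j \<le> f i)"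
  using assms(2)
proof (induction k)
  case 0
  then show ?case by (intro exI[of _ "{}"]) simp
next
  case (Suc k)
  then obtain T where T: "T \<subseteq> X" "card T = k" "\<forall>i\<in>T. \<forall>j\<in>X - T. f j \<le> f i"
    by auto
  have "finite T" using T(1) assms(1) finite_subset by blast
  have "X - T \<noteq> {}" using T Suc.prems by auto
  then obtain m where m: "m \<in> X - T" "\<And>i. i \<in> X - T \<Longrightarrow> f i \<le> f m"
    using finite_ex_max[of "X - T" f] assms(1) by blast
  show ?case
    using T m \<open>finite T\<close> by (intro exI[of _ "insert m T"]) auto
qed

text \<open>The least profitable of the \<open>k\<close> jobs with the largest \<open>f\<close> is dropped.\<close>

lemma drop_one_of_top:
  fixes f p :: "nat \<Rightarrow> real"
  assumes fin: "finite X" and k: "1 \<le> k" and p: "\<And>i. i \<in> X \<Longrightarrow> 0 \<le> p i" and fn: "f n = 0"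
  obtains T D R m where "X = T \<union> D \<union> R" "T \<inter> D = {}" "(T \<union> D) \<inter> R = {}" "card T \<le> k"
    "m \<in> insert n X" "f m \<le> sum f D" "\<And>i. i \<in> R \<Longrightarrow> f i \<le> f m" "real k * sum p D \<le> sum p X"
proof (cases "k \<le> card X")
  case False
  have "0 \<le> sum p X" using p by (rule sum_nonneg)
  \<comment> \<open>With fewer than \<open>k\<close> jobs everything is kept, nothing is dropped and
    no small job remains; the index \<open>n\<close> supplies the threshold 0.\<close>
  then show ?thesis using False fn by (intro that[of X "{}" "{}" n]) auto
next
  case True
  obtain T where T: "T \<subseteq> X" "card T = k" "\<forall>i\<in>T. \<forall>j\<in>X - T. f j \<le> f i"
    using ex_top_subset[OF fin True] by blast
  have finT: "finite T" "T \<noteq> {}" using T fin k finite_subset by auto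
  obtain d where d: "d \<in> T" "\<And>i. i \<in> T \<Longrightarrow> p d \<le> p i"
    using finite_ex_min[OF finT, of p] by blast
  obtain m where m: "m \<in> T" "\<And>i. i \<in> T \<Longrightarrow> f m \<le> f i"
    using finite_ex_min[OF finT, of f] by blast
  have "real k * p d \<le> sum p T"
    using sum_bounded_below[of T "p d" p] d(2) T(2) by simp
  also have "\<dots> \<le> sum p X" using T(1) fin p by (intro sum_mono2) auto
  finally have loss: "real k * p d \<le> sum p X" .
  show ?thesis
    \<comment> \<open>The least profitable job \<open>d\<close> and the smallest job
      \<open>m\<close> with respect to \<open>f\<close> both belong to the top \<open>k\<close>, so
      \<open>d\<close> frees at least \<open>f m\<close>, and \<open>f m\<close> bounds
      \<open>f\<close> on all jobs outside.\<close>
    using T m d loss finT by (intro that[of "T - {d}" "{d}" "X - T" m]) (auto simp: card_Diff_singleton)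
qed

text \<open>The value \<open>n\<close> pads the entries of a guess for which no kept job is
  left.\<close>

lemma ex_enumeration:
  fixes T :: "nat set"
  assumes "finite T" "card T \<le> N"
  shows "\<exists>e::nat \<Rightarrow> nat. (\<forall>l. e l \<in> insert n T) \<and> T \<subseteq> e ` {..<N}"
proof -
  obtain xs where xs: "set xs = T" "distinct xs" using finite_distinct_list[OF assms(1)] by blast
  then have len: "length xs \<le> N" using assms(2) distinct_card by fastforce
  let ?e = "\<lambda>l. if l < length xs then xs ! l else n"
  have "x \<in> ?e ` {..<N}" if "x \<in> T" for x
  proof -
    from that xs obtain l where "l < length xs" "xs ! l = x" by (metis in_set_conv_nth)
    then show ?thesis using len by (intro image_eqI[of _ _ l]) auto
  qed
  then show ?thesis using xs by (intro exI[of _ ?e]) auto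
qed

text \<open>Sums of digits range over at most \<open>n\<close> jobs with digits at most
  \<open>n * k\<close>, so they stay below this base and no carry occurs.\<close>

definition base :: "nat \<Rightarrow> nat \<Rightarrow> nat" where
  "base k n = 1 + k * n * n"

text \<open>In a guess \<open>h\<close>, entries below \<open>2 * k\<close> are the kept top jobs, entry \<open>2 * k\<close> is a most profitable
  job, and the next two entries are jobs attaining the early and the late threshold. The index \<open>n\<close>,
  where all data are 0, stands for no job.\<close>

definition kept :: "nat \<Rightarrow> nat \<Rightarrow> (nat \<Rightarrow> nat) \<Rightarrow> nat set" where
  "kept k n h = {i. i < n \<and> (\<exists>l<2 * k. h l = i)}"

definition threshold :: "(nat \<Rightarrow> real) \<Rightarrow> (nat \<Rightarrow> real) \<Rightarrow> nat \<Rightarrow> (nat \<Rightarrow> nat) \<Rightarrow> bool \<Rightarrow> real" where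
  "threshold a b k h g = (if g then a (h (2 * k + 1)) else b (h (2 * k + 2)))"

definition eligible ::
  "(nat \<Rightarrow> real) \<Rightarrow> (nat \<Rightarrow> real) \<Rightarrow> (nat \<Rightarrow> real) \<Rightarrow> nat \<Rightarrow> nat \<Rightarrow> (nat \<Rightarrow> nat) \<Rightarrow> nat \<Rightarrow> bool" where
  "eligible a b p k n h i \<longleftrightarrow> i \<notin> kept k n h \<and> 0 \<le> p i \<and> p i \<le> p (h (2 * k)) \<and>
     lo a b i \<le> threshold a b k h (a i \<le> b i)"

text \<open>The unit is an \<open>n\<close>-th of the threshold, so \<open>n\<close> jobs err by at
  most one threshold. Scaling by \<open>n\<close> avoids a division.\<close>

definition udigit ::
  "(nat \<Rightarrow> real) \<Rightarrow> (nat \<Rightarrow> real) \<Rightarrow> nat \<Rightarrow> nat \<Rightarrow> (nat \<Rightarrow> nat) \<Rightarrow> nat \<Rightarrow> nat" where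
  "udigit a b k n h i = rnd n (threshold a b k h (a i \<le> b i)) (lo a b i * real n)"

text \<open>The unit is the guessed largest profit divided by \<open>n * k\<close>, so
  \<open>n\<close> jobs lose at most a \<open>k\<close>-th of that profit.\<close>

definition pdigit :: "(nat \<Rightarrow> real) \<Rightarrow> nat \<Rightarrow> nat \<Rightarrow> (nat \<Rightarrow> nat) \<Rightarrow> nat \<Rightarrow> nat" where
  "pdigit p k n h i = rnd (n * k) (p (h (2 * k))) (p i * real (n * k))"

text \<open>Both rounded quantities of both groups are packed into one number in base \<open>base k n\<close>, so that
  fixing the sum of the keys of a set fixes all four rounded sums.\<close>

definition key ::
  "(nat \<Rightarrow> real) \<Rightarrow> (nat \<Rightarrow> real) \<Rightarrow> (nat \<Rightarrow> real) \<Rightarrow> nat \<Rightarrow> nat \<Rightarrow> (nat \<Rightarrow> nat) \<Rightarrow> nat \<Rightarrow> nat" where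
  "key a b p k n h i =
     udigit a b k n h i * (if a i \<le> b i then 1 else base k n * base k n) +
     pdigit p k n h i * (if a i \<le> b i then base k n else base k n * base k n * base k n)"

lemma digits_unique:
  fixes M :: nat
  assumes "x0 < M" "y0 < M" "x1 < M" "y1 < M" "x2 < M" "y2 < M"
    and eq: "x0 + x1 * M + x2 * (M * M) + x3 * (M * M * M) =
      y0 + y1 * M + y2 * (M * M) + y3 * (M * M * M)"
  shows "x0 = y0 \<and> x1 = y1 \<and> x2 = y2 \<and> x3 = y3"
proof -
  have step: "u = u' \<and> w = w'" if "u + w * M = u' + w' * M" "u < M" "u' < M" for u u' w w' :: nat
  proof -
    have "(u + w * M) mod M = u" "(u' + w' * M) mod M = u'" using that(2,3) by auto
    then have "u = u'" using that(1) by metis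
    then show ?thesis using that by auto
  qed
  have "x0 + (x1 + (x2 + x3 * M) * M) * M = y0 + (y1 + (y2 + y3 * M) * M) * M"
    using eq by (simp add: algebra_simps)
  then show ?thesis using step assms(1-6) by blast
qed

lemma digits_bound:
  fixes M :: nat
  assumes "x0 < M" "x1 < M" "x2 < M" "x3 < M"
  shows "x0 + x1 * M + x2 * (M * M) + x3 * (M * M * M) < M * M * M * M"
proof -
  have step: "u + w * M < N * M" if "u < M" "w < N" for u w N :: nat
  proof -
    have "u + w * M < (w + 1) * M" using that(1) by simp
    also have "\<dots> \<le> N * M" using that(2) by (intro mult_le_mono1) simp
    finally show ?thesis .
  qed
  have "x0 + (x1 + (x2 + x3 * M) * M) * M < M * M * M * M"
    using assms by (intro step)
  then show ?thesis by (simp add: algebra_simps)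
qed

lemma sum_key:
  assumes "finite X"
  shows "sum (key a b p k n h) X =
    sum (udigit a b k n h) (part a b True X) +
    sum (pdigit p k n h) (part a b True X) * base k n +
    sum (udigit a b k n h) (part a b False X) * (base k n * base k n) +
    sum (pdigit p k n h) (part a b False X) * (base k n * base k n * base k n)"
proof -
  have "sum (key a b p k n h) (part a b True X) =
    (\<Sum>i\<in>part a b True X. udigit a b k n h i + pdigit p k n h i * base k n)"
    by (rule sum.cong) (auto simp: part_def key_def)
  moreover have "sum (key a b p k n h) (part a b False X) =
    (\<Sum>i\<in>part a b False X. udigit a b k n h i * (base k n * base k n) +
      pdigit p k n h i * (base k n * base k n * base k n))"
    by (rule sum.cong) (auto simp: part_def key_def)
  ultimately show ?thesis
    using sum_part[OF assms, of "key a b p k n h" a b True]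
    by (simp add: sum.distrib sum_distrib_right)
qed

lemma digit_sums_bound:
  assumes "X \<subseteq> {..<n}" "1 \<le> k"
  shows "sum (udigit a b k n h) X < base k n" "sum (pdigit p k n h) X < base k n"
proof -
  have c: "card X \<le> n" using card_mono[OF _ assms(1)] by simp
  have "sum (udigit a b k n h) X \<le> card X * n"
    using sum_bounded_above[of X "udigit a b k n h" n] rnd_le unfolding udigit_def by simp
  also have "\<dots> \<le> k * n * n" using c assms(2) by (intro mult_le_mono1) (metis mult_le_mono nat_mult_1)
  finally show "sum (udigit a b k n h) X < base k n" unfolding base_def by simp
  have "sum (pdigit p k n h) X \<le> card X * (n * k)"
    using sum_bounded_above[of X "pdigit p k n h" "n * k"] rnd_le unfolding pdigit_def by simp
  also have "\<dots> \<le> n * (n * k)" using c by (rule mult_le_mono1)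
  finally show "sum (pdigit p k n h) X < base k n" unfolding base_def by (simp add: algebra_simps)
qed

text \<open>Without carries, the key sum determines each of the four digit sums.\<close>

lemma key_eq_digits:
  assumes k: "1 \<le> k" and X: "X \<subseteq> {..<n}" and Y: "Y \<subseteq> {..<n}"
    and eq: "sum (key a b p k n h) X = sum (key a b p k n h) Y"
  shows "sum (udigit a b k n h) (part a b g X) = sum (udigit a b k n h) (part a b g Y)"
    and "sum (pdigit p k n h) (part a b g X) = sum (pdigit p k n h) (part a b g Y)"
proof -
  have fin: "finite X" "finite Y" using X Y by (auto intro: finite_subset)
  have sub: "part a b g Z \<subseteq> {..<n}" if "Z \<subseteq> {..<n}" for g Z
    using that part_subset by blast
  note bound = digit_sums_bound[OF sub k]
  note eqs = digits_unique[OF bound(1)[OF X] bound(1)[OF Y] bound(2)[OF X] bound(2)[OF Y]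
      bound(1)[OF X] bound(1)[OF Y] eq[unfolded sum_key[OF fin(1)] sum_key[OF fin(2)]]]
  show "sum (udigit a b k n h) (part a b g X) = sum (udigit a b k n h) (part a b g Y)"
    using eqs by (cases g) auto
  show "sum (pdigit p k n h) (part a b g X) = sum (pdigit p k n h) (part a b g Y)"
    using eqs by (cases g) auto
qed

text \<open>The table minimises \<open>hi\<close> over both groups together, while the exchange
  argument compares each group separately. Replacing one group of \<open>X\<close> by that of
  \<open>Y\<close> keeps all digit sums, so the mixture competes in the same column and differs from
  \<open>X\<close> in one group only.\<close>

lemma minimal_in_part:
  assumes k: "1 \<le> k" and X: "X \<subseteq> {..<n}" "\<And>i. i \<in> X \<Longrightarrow> el i"
    and Y: "Y \<subseteq> {..<n}" "\<And>i. i \<in> Y \<Longrightarrow> el i"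
    and eq: "sum (key a b p k n h) X = sum (key a b p k n h) Y"
    and min: "\<And>Z. Z \<subseteq> {..<n} \<Longrightarrow> (\<And>i. i \<in> Z \<Longrightarrow> el i) \<Longrightarrow>
      sum (key a b p k n h) Z = sum (key a b p k n h) X \<Longrightarrow> sum (hi a b) X \<le> sum (hi a b) Z"
  shows "sum (hi a b) (part a b g X) \<le> sum (hi a b) (part a b g Y)"
proof -
  have fin: "finite X" "finite Y" using X(1) Y(1) by (auto intro: finite_subset)
  define Z where "Z = part a b g Y \<union> part a b (\<not> g) X"
  have pZ: "part a b g Z = part a b g Y" "part a b (\<not> g) Z = part a b (\<not> g) X"
    by (auto simp: Z_def part_def)
  have Zsub: "Z \<subseteq> {..<n}" "\<And>i. i \<in> Z \<Longrightarrow> el i"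
    using X Y by (auto simp: Z_def part_def)
  have finZ: "finite Z" using Zsub(1) by (auto intro: finite_subset)
  have dig: "sum (udigit a b k n h) (part a b g' Z) = sum (udigit a b k n h) (part a b g' X)"
    "sum (pdigit p k n h) (part a b g' Z) = sum (pdigit p k n h) (part a b g' X)" for g'
  proof -
    have "part a b g' Z = part a b g' Y \<or> part a b g' Z = part a b g' X"
      using pZ by (cases "g' = g") auto
    then show "sum (udigit a b k n h) (part a b g' Z) = sum (udigit a b k n h) (part a b g' X)"
      "sum (pdigit p k n h) (part a b g' Z) = sum (pdigit p k n h) (part a b g' X)"
      using key_eq_digits[OF k X(1) Y(1) eq, of g'] by metis+
  qed
  have "sum (key a b p k n h) Z = sum (key a b p k n h) X"
    unfolding sum_key[OF fin(1)] sum_key[OF finZ] dig ..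
  from min[OF Zsub this] show ?thesis
    using sum_part[OF fin(1), of "hi a b" a b g] sum_part[OF finZ, of "hi a b" a b g] pZ by simp
qed

text \<open>Digits underestimate a member of \<open>X\<close> by at most one unit and never
  overestimate a member of \<open>Y\<close>; equal digit sums link the two.\<close>

lemma rounded_sum_le:
  assumes fin: "finite X" and d: "0 \<le> d"
    and X: "\<And>i. i \<in> X \<Longrightarrow> f i \<le> d" and Y: "\<And>i. i \<in> Y \<Longrightarrow> 0 \<le> f i"
    and eq: "(\<Sum>i\<in>X. rnd N d (f i * real N)) = (\<Sum>i\<in>Y. rnd N d (f i * real N))"
  shows "real N * sum f X \<le> real N * sum f Y + real (card X) * d"
proof -
  have "real N * sum f X = (\<Sum>i\<in>X. f i * real N)"
    by (simp add: sum_distrib_left mult.commute)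
  also have "\<dots> \<le> (\<Sum>i\<in>X. (real (rnd N d (f i * real N)) + 1) * d)"
  proof (rule sum_mono)
    fix i assume "i \<in> X"
    then have "f i * real N \<le> real N * d"
      using mult_right_mono[OF X, of i "real N"] by (simp add: mult.commute)
    then show "f i * real N \<le> (real (rnd N d (f i * real N)) + 1) * d"
      by (rule rnd_upper[OF d])
  qed
  also have "\<dots> = real (\<Sum>i\<in>X. rnd N d (f i * real N)) * d + real (card X) * d"
    by (simp add: sum.distrib sum_distrib_right distrib_right)
  also have "real (\<Sum>i\<in>X. rnd N d (f i * real N)) * d = (\<Sum>i\<in>Y. real (rnd N d (f i * real N)) * d)"
    unfolding eq by (simp add: sum_distrib_right)
  also have "\<dots> \<le> (\<Sum>i\<in>Y. f i * real N)"
    using Y d by (intro sum_mono rnd_lower) auto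
  also have "\<dots> = real N * sum f Y"
    by (simp add: sum_distrib_left mult.commute)
  finally show ?thesis by simp
qed

text \<open>Here a solution of the instance is tied to what the program can find: some guess and
  some column lead to a candidate that passes the exact test. Guesses are whole functions; they
  vanish from \<open>2 * k + 3\<close> on because the array of loop counters does.\<close>

lemma ex_good_guess:
  fixes a b p :: "nat \<Rightarrow> real"
  assumes nonneg: "\<And>i. 0 \<le> a i" "\<And>i. 0 \<le> b i" and zero: "a n = 0" "b n = 0" "p n = 0"
    and k: "1 \<le> k" and S: "S \<subseteq> {..<n}" and p: "\<And>i. i \<in> S \<Longrightarrow> 0 \<le> p i"
    and sums: "sum a S \<le> 1" "sum b S \<le> 1" and load: "\<And>j. j \<in> S \<Longrightarrow> load a b S j \<le> 1"
  obtains h c x R' where "\<And>l. l < 2 * k + 3 \<Longrightarrow> h l \<le> n" "\<And>l. 2 * k + 3 \<le> l \<Longrightarrow> h l = 0"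
    "c < base k n * base k n * base k n * base k n"
    "dp (eligible a b p k n h) (key a b p k n h) (hi a b) n c = Some (x, R')"
    "\<And>j. j \<in> kept k n h \<union> R' \<Longrightarrow> load a b (kept k n h \<union> R') j \<le> 1"
    "(1 - 2 / real k) * sum p S \<le> sum p (kept k n h \<union> R')"
proof -
  have finS: "finite S" using S by (rule finite_subset) simp
  define X where "X g = part a b g S" for g
  have XS: "X g \<subseteq> S" for g using part_subset by (simp add: X_def)
  have finX: "finite (X g)" for g using finite_subset[OF XS finS] .
  have "\<exists>T D R m. X g = T \<union> D \<union> R \<and> T \<inter> D = {} \<and> (T \<union> D) \<inter> R = {} \<and> card T \<le> k \<and>
      m \<in> insert n (X g) \<and> lo a b m \<le> sum (lo a b) D \<and> (\<forall>i\<in>R. lo a b i \<le> lo a b m) \<and>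
      real k * sum p D \<le> sum p (X g)" for g
  proof -
    have "0 \<le> p i" if "i \<in> X g" for i using p XS that by blast
    moreover have "lo a b n = 0" using zero by (simp add: lo_def)
    ultimately show ?thesis
      using drop_one_of_top[OF finX k, of g p "lo a b" n] by (metis (no_types, lifting))
  qed
  then obtain T D R m where split: "\<And>g. X g = T g \<union> D g \<union> R g"
      "\<And>g. T g \<inter> D g = {}" "\<And>g. (T g \<union> D g) \<inter> R g = {}"
    and cT: "\<And>g. card (T g) \<le> k" and m: "\<And>g. m g \<in> insert n (X g)"
    and mD: "\<And>g. lo a b (m g) \<le> sum (lo a b) (D g)"
    and mR: "\<And>g i. i \<in> R g \<Longrightarrow> lo a b i \<le> lo a b (m g)"
    and loss: "\<And>g. real k * sum p (D g) \<le> sum p (X g)"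
    by metis
  have sub: "T g \<subseteq> X g" "D g \<subseteq> X g" "R g \<subseteq> X g" for g using split(1) by auto
  define T0 where "T0 = T True \<union> T False"
  define D0 where "D0 = D True \<union> D False"
  define R0 where "R0 = R True \<union> R False"
  have pX: "i \<in> X g \<Longrightarrow> (a i \<le> b i) = g" for i g by (simp add: X_def part_def)
  have Xdisj: "X True \<inter> X False = {}" using pX by blast
  have Xun: "X True \<union> X False = S" by (auto simp: X_def part_def)
  have S_eq: "S = T0 \<union> D0 \<union> R0"
    using Xun split(1)[of True] split(1)[of False] by (auto simp: T0_def D0_def R0_def)
  have disj: "T0 \<inter> D0 = {}" "(T0 \<union> D0) \<inter> R0 = {}"
    using split(2,3)[of True] split(2,3)[of False] sub[of True] sub[of False] Xdisj
    by (auto simp: T0_def D0_def R0_def)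
  have parts: "part a b g T0 = T g" "part a b g D0 = D g" "part a b g R0 = R g" for g
    using sub[of True] sub[of False] pX[of _ True] pX[of _ False]
    by (cases g; auto simp: T0_def D0_def R0_def part_def)+
  have fin: "finite T0" "finite D0" "finite R0" using finS S_eq by auto
  have finTD: "finite (T g)" "finite (D g)" "finite (R g)" for g
    using finite_subset[OF sub(1) finX] finite_subset[OF sub(2) finX]
      finite_subset[OF sub(3) finX] by blast+
  have "card T0 \<le> 2 * k"
    using card_Un_le[of "T True" "T False"] cT[of True] cT[of False] by (simp add: T0_def)
  then obtain e where e: "\<And>l. e l \<in> insert n T0" "T0 \<subseteq> e ` {..<2 * k}"
    using ex_enumeration[OF fin(1)] by metis
  obtain q where q: "q \<in> insert n S" "\<And>i. i \<in> S \<Longrightarrow> p i \<le> p q" "p q \<le> sum p S" "0 \<le> p q"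
  proof (cases "S = {}")
    case True
    then show ?thesis using that[of n] zero by simp
  next
    case False
    then obtain q where q: "q \<in> S" "\<And>i. i \<in> S \<Longrightarrow> p i \<le> p q"
      using finite_ex_max[OF finS, of p] by blast
    moreover have "p q \<le> sum p S" using member_le_sum[OF q(1)] p finS by blast
    ultimately show ?thesis using that[of q] p by blast
  qed
  define h where "h l = (if l < 2 * k then e l else if l = 2 * k then q
    else if l = 2 * k + 1 then m True else if l = 2 * k + 2 then m False else 0)" for l
  have hn: "h l \<le> n" for l
  proof -
    have le: "i \<le> n" if "i \<in> insert n S" for i using that S by auto
    have "e l \<in> insert n S" "m g \<in> insert n S" for g
      using e(1)[of l] m[of g] XS[of g] S_eq by blast+
    then show ?thesis using le q(1) unfolding h_def by simp
  qed
  have h0: "h l = 0" if "2 * k + 3 \<le> l" for l using that by (simp add: h_def)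
  have T0S: "T0 \<subseteq> S" using S_eq by blast
  have kept: "kept k n h = T0"
  proof
    show "kept k n h \<subseteq> T0"
    proof
      fix i assume "i \<in> kept k n h"
      then obtain l where "i < n" "e l = i" by (auto simp: kept_def h_def)
      then show "i \<in> T0" using e(1)[of l] by simp
    qed
    show "T0 \<subseteq> kept k n h"
    proof
      fix i assume i: "i \<in> T0"
      then obtain l where "l < 2 * k" "e l = i" using e(2) by blast
      then show "i \<in> kept k n h" using i T0S S by (auto simp: kept_def h_def)
    qed
  qed
  have thr: "threshold a b k h g = lo a b (m g)" for g
  proof -
    have "lo a b (m g) = (if g then a (m g) else b (m g))"
      using m[of g] pX[of "m g" g] zero by (cases g) (auto simp: lo_def)
    then show ?thesis by (simp add: threshold_def h_def)
  qed
  have lo0: "0 \<le> lo a b i" for i using nonneg by (simp add: lo_def)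
  have hq: "h (2 * k) = q" by (simp add: h_def)
  let ?el = "eligible a b p k n h" and ?key = "key a b p k n h"
  have Rel: "?el i" if i: "i \<in> R0" for i
  proof -
    have iS: "i \<in> S" using i S_eq by blast
    have "i \<in> R (a i \<le> b i)" using i parts(3)[of "a i \<le> b i"] by (auto simp: part_def)
    then show ?thesis using iS i p q(2) mR disj(2)
      unfolding eligible_def kept thr hq by blast
  qed
  have Rn: "R0 \<subseteq> {..<n}" using S S_eq by blast
  \<comment> \<open>The column in which the small jobs \<open>R0\<close> of the given solution
    compete; hence the entry exists, and its set has the same rounded sums.\<close>
  define c where "c = sum ?key R0"
  have cb: "c < base k n * base k n * base k n * base k n"
  proof -
    have s: "part a b g R0 \<subseteq> {..<n}" for g using Rn part_subset by blast
    note bound = digit_sums_bound[OF s k]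
    show ?thesis unfolding c_def sum_key[OF fin(3)] by (rule digits_bound) (rule bound)+
  qed
  have R0el: "R0 \<subseteq> {l. l < n \<and> ?el l}" using Rn Rel by blast
  obtain x R' where d: "dp ?el ?key (hi a b) n c = Some (x, R')"
    using dp_optimal[OF R0el refl, of ?key "hi a b"] unfolding c_def by blast
  have R': "R' \<subseteq> {l. l < n \<and> ?el l}" "sum ?key R' = c" "x = sum (hi a b) R'"
    using dp_sound[OF d] by auto
  have R'n: "R' \<subseteq> {..<n}" and R'el: "\<And>i. i \<in> R' \<Longrightarrow> ?el i" using R'(1) by auto
  have finR': "finite R'" using R'n by (rule finite_subset) simp
  have min: "sum (hi a b) R' \<le> sum (hi a b) Z"
    if "Z \<subseteq> {..<n}" "\<And>i. i \<in> Z \<Longrightarrow> ?el i" "sum ?key Z = sum ?key R'" for Z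
  proof -
    have "Z \<subseteq> {l. l < n \<and> ?el l}" using that by auto
    from dp_optimal[OF this that(3)[unfolded R'(2)], of "hi a b"] show ?thesis
      using d R'(3) by auto
  qed
  have eq: "sum ?key R' = sum ?key R0" using R'(2) c_def by simp
  have hiR: "sum (hi a b) (part a b g R') \<le> sum (hi a b) (part a b g R0)" for g
    by (rule minimal_in_part[OF k R'n R'el Rn Rel eq min])
  note dig = key_eq_digits[OF k R'n Rn eq]
  \<comment> \<open>At most \<open>n\<close> jobs are off by at most one unit each, which is an
    \<open>n\<close>-th of \<open>lo a b (m g)\<close>.\<close>
  have loR: "sum (lo a b) (part a b g R') \<le> sum (lo a b) (part a b g R0) + lo a b (m g)" for g
  proof (cases "n = 0")
    case True
    then have "R' = {}" "R0 = {}" using R'n Rn by auto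
    then show ?thesis using lo0 by (simp add: part_def)
  next
    case False
    have u: "sum (udigit a b k n h) (part a b g Z) =
      (\<Sum>i\<in>part a b g Z. rnd n (lo a b (m g)) (lo a b i * real n))" for Z
      by (rule sum.cong) (auto simp: part_def udigit_def thr)
    have "real n * sum (lo a b) (part a b g R') \<le>
        real n * sum (lo a b) (part a b g R0) + real (card (part a b g R')) * lo a b (m g)"
    proof (rule rounded_sum_le)
      show "lo a b i \<le> lo a b (m g)" if "i \<in> part a b g R'" for i
        using that R'el[of i] unfolding part_def eligible_def thr by auto
    qed (use finite_part[OF finR'] lo0 dig(1)[of g] in \<open>auto simp: u\<close>)
    also have "real (card (part a b g R')) * lo a b (m g) \<le> real n * lo a b (m g)"
    proof -
      have "card (part a b g R') \<le> card {..<n}"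
        using part_subset R'n by (intro card_mono) blast+
      then show ?thesis using lo0 by (intro mult_right_mono) auto
    qed
    finally have "real n * sum (lo a b) (part a b g R') \<le>
      real n * (sum (lo a b) (part a b g R0) + lo a b (m g))" by (simp add: distrib_left)
    then show ?thesis using False by (simp add: mult_le_cancel_left)
  qed
  have T0R': "T0 \<inter> R' = {}" using R'el by (auto simp: eligible_def kept)
  have loads: "load a b (T0 \<union> R') j \<le> 1" if "j \<in> T0 \<union> R'" for j
  proof (rule load_exchange[OF nonneg fin finR' disj T0R' _ _ _ _ _ loR hiR that])
    show "sum a (T0 \<union> D0 \<union> R0) \<le> 1" "sum b (T0 \<union> D0 \<union> R0) \<le> 1"
      using sums unfolding S_eq by auto
    show "load a b (T0 \<union> D0 \<union> R0) j \<le> 1" if "j \<in> T0 \<union> D0 \<union> R0" for j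
      using load that unfolding S_eq by auto
    show "lo a b (m g) \<le> sum (lo a b) (part a b g D0)" for g
      unfolding parts by (rule mD)
    show "lo a b i \<le> lo a b (m (a i \<le> b i))" if "i \<in> R'" for i
      using R'el[OF that] unfolding eligible_def thr by blast
  qed
  have profit: "(1 - 2 / real k) * sum p S \<le> sum p (T0 \<union> R')"
  proof -
    have pd: "sum (pdigit p k n h) Z = (\<Sum>i\<in>Z. rnd (n * k) (p q) (p i * real (n * k)))" for Z
      by (simp add: pdigit_def hq)
    have "real k * sum p R0 \<le> real k * sum p R' + p q"
    proof (cases "n = 0")
      case True
      then have "R' = {}" "R0 = {}" using R'n Rn by auto
      then show ?thesis using q(4) by simp
    next
      case False
      \<comment> \<open>The roles are reversed against the comparison of \<open>lo\<close>: there
        the chosen set \<open>R'\<close> must not exceed \<open>R0\<close> by much, here it must not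
        fall behind.\<close>
      have "real (n * k) * sum p R0 \<le> real (n * k) * sum p R' + real (card R0) * p q"
      proof (rule rounded_sum_le)
        show "p i \<le> p q" if "i \<in> R0" for i using that S_eq q(2) by blast
        show "0 \<le> p i" if "i \<in> R'" for i using R'el[OF that] by (simp add: eligible_def)
        show "(\<Sum>i\<in>R0. rnd (n * k) (p q) (p i * real (n * k))) =
          (\<Sum>i\<in>R'. rnd (n * k) (p q) (p i * real (n * k)))"
          unfolding pd[symmetric] using dig(2)[of True] dig(2)[of False]
            sum_part[OF fin(3), of "pdigit p k n h" a b True]
            sum_part[OF finR', of "pdigit p k n h" a b True] by simp
      qed (use fin q in auto)
      also have "real (card R0) * p q \<le> real n * p q"
        using card_mono[OF _ Rn] q(4) by (intro mult_right_mono) auto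
      finally have "real n * (real k * sum p R0) \<le> real n * (real k * sum p R' + p q)"
        by (simp add: algebra_simps)
      then show ?thesis using False by (simp add: mult_le_cancel_left)
    qed
    moreover have "real k * sum p D0 \<le> sum p S"
    proof -
      have "D True \<inter> D False = {}" using sub Xdisj by blast
      then have "sum p D0 = sum p (D True) + sum p (D False)"
        unfolding D0_def using finTD by (simp add: sum.union_disjoint)
      moreover have "sum p S = sum p (X True) + sum p (X False)"
        using sum_part[OF finS, of p a b True] by (simp add: X_def)
      ultimately show ?thesis using loss[of True] loss[of False] by (simp add: distrib_left)
    qed
    moreover have "sum p S = sum p T0 + sum p D0 + sum p R0"
      unfolding S_eq using fin disj by (simp add: sum.union_disjoint)
    moreover have "sum p (T0 \<union> R') = sum p T0 + sum p R'"
      using fin finR' T0R' by (simp add: sum.union_disjoint)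
    ultimately have le: "(real k - 2) * sum p S \<le> real k * sum p (T0 \<union> R')"
      using q(3) by (simp add: algebra_simps)
    have "real k * ((1 - 2 / real k) * sum p S) = (real k - 2) * sum p S"
      using k by (simp add: field_simps)
    then have "real k * ((1 - 2 / real k) * sum p S) \<le> real k * sum p (T0 \<union> R')"
      using le by (rule ord_eq_le_trans)
    then show ?thesis using k by (simp add: mult_le_cancel_left)
  qed
  show thesis
    by (rule that[of h c x R']) (use hn h0 cb d loads profit in \<open>auto simp: kept\<close>)
qed

section \<open>Running time and correctness of programs\<close>

text \<open>A total-correctness triple for one start state with a time budget. The budget is an
  upper bound because the exact time varies with the branches taken.\<close>

definition runs :: "com \<Rightarrow> state \<Rightarrow> nat \<Rightarrow> (state \<Rightarrow> bool) \<Rightarrow> bool" where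
  "runs c s T Q \<longleftrightarrow> (\<exists>t s'. exec c s t s' \<and> t \<le> T \<and> Q s')"

lemma runs_weaken:
  assumes "runs c s T Q" "\<And>s'. Q s' \<Longrightarrow> Q' s'" "T \<le> T'"
  shows "runs c s T' Q'"
  using assms unfolding runs_def by (meson order_trans)

lemma exec_NSet_iff:
  "exec (NSet v i e) s t s' \<longleftrightarrow> t = 1 + ncost i + ncost e \<and> s' = nupd v (nval i s) (nval e s) s"
  by (metis exec.NSet exec_NSetE)

lemma exec_RSet_iff:
  "exec (RSet v i e) s t s' \<longleftrightarrow> t = 1 + ncost i + rcost e \<and> s' = rupd v (nval i s) (rval e s) s"
  by (metis exec.RSet exec_RSetE)

lemma exec_Skip_iff: "exec Skip s t s' \<longleftrightarrow> t = 1 \<and> s' = s"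
  by (metis exec.Skip exec_SkipE)

lemma exec_Seq_iff:
  "exec (Seq c d) s t s' \<longleftrightarrow> (\<exists>t1 s1 t2. t = t1 + t2 \<and> exec c s t1 s1 \<and> exec d s1 t2 s')"
  by (blast elim: exec_SeqE intro: exec.Seq)

lemma exec_Cond_iff:
  "exec (Cond b c d) s t s' \<longleftrightarrow>
     (\<exists>t1. t = 1 + bcost b + t1 \<and> (if bval b s then exec c s t1 s' else exec d s t1 s'))"
proof
  assume "exec (Cond b c d) s t s'"
  then show "\<exists>t1. t = 1 + bcost b + t1 \<and> (if bval b s then exec c s t1 s' else exec d s t1 s')"
    by (rule exec_CondE) simp_all
next
  assume "\<exists>t1. t = 1 + bcost b + t1 \<and> (if bval b s then exec c s t1 s' else exec d s t1 s')"
  then obtain t1 where t: "t = 1 + bcost b + t1"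
    and e: "if bval b s then exec c s t1 s' else exec d s t1 s'" by blast
  show "exec (Cond b c d) s t s'"
    unfolding t using e exec.CondTrue[of b s c t1 s' d] exec.CondFalse[of b s d t1 s' c]
    by (cases "bval b s") simp_all
qed

lemma runs_NSet:
  "runs (NSet v i e) s T Q \<longleftrightarrow>
     1 + ncost i + ncost e \<le> T \<and> Q (nupd v (nval i s) (nval e s) s)"
  unfolding runs_def exec_NSet_iff by blast

lemma runs_RSet:
  "runs (RSet v i e) s T Q \<longleftrightarrow>
     1 + ncost i + rcost e \<le> T \<and> Q (rupd v (nval i s) (rval e s) s)"
  unfolding runs_def exec_RSet_iff by blast

lemma runs_Skip: "runs Skip s T Q \<longleftrightarrow> 1 \<le> T \<and> Q s"
  unfolding runs_def exec_Skip_iff by blast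

lemma add_le_split: "(k + t \<le> T) \<longleftrightarrow> k \<le> T \<and> t \<le> T - k" for k t T :: nat
  by auto

lemma runs_Cond:
  "runs (Cond b c d) s T Q \<longleftrightarrow> 1 + bcost b \<le> T \<and>
     (if bval b s then runs c s (T - (1 + bcost b)) Q else runs d s (T - (1 + bcost b)) Q)"
  unfolding runs_def exec_Cond_iff using add_le_split[of "1 + bcost b" _ T] by (cases "bval b s") auto

lemma runs_Seq_iff:
  "runs (Seq c d) s T Q \<longleftrightarrow> (\<exists>t s'. exec c s t s' \<and> t \<le> T \<and> runs d s' (T - t) Q)"
  unfolding runs_def exec_Seq_iff by (auto simp: le_diff_conv2 add.commute) (use add_le_split in blast)+

lemma runs_Seq:
  assumes "runs c s T1 (\<lambda>s'. runs d s' T2 Q)" "T1 + T2 \<le> T"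
  shows "runs (Seq c d) s T Q"
proof -
  from assms(1) obtain t s' where 1: "exec c s t s'" "t \<le> T1" "runs d s' T2 Q"
    unfolding runs_def by blast
  have "runs d s' (T - t) Q"
    by (rule runs_weaken[OF 1(3)]) (use 1(2) assms(2) in auto)
  with 1 assms(2) show ?thesis unfolding runs_Seq_iff by (metis add_leD1 order_trans)
qed

lemma runs_Seq_NSet:
  "runs (Seq (NSet v i e) d) s T Q \<longleftrightarrow> 1 + ncost i + ncost e \<le> T \<and>
     runs d (nupd v (nval i s) (nval e s) s) (T - (1 + ncost i + ncost e)) Q"
  unfolding runs_Seq_iff exec_NSet_iff by blast

lemma runs_Seq_RSet:
  "runs (Seq (RSet v i e) d) s T Q \<longleftrightarrow> 1 + ncost i + rcost e \<le> T \<and>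
     runs d (rupd v (nval i s) (rval e s) s) (T - (1 + ncost i + rcost e)) Q"
  unfolding runs_Seq_iff exec_RSet_iff by blast

text \<open>Moving the continuation into both branches lets symbolic execution proceed past a
  conditional.\<close>

lemma runs_Seq_Cond:
  "runs (Seq (Cond b c d) e) s T Q \<longleftrightarrow> 1 + bcost b \<le> T \<and>
     (if bval b s then runs (Seq c e) s (T - (1 + bcost b)) Q
      else runs (Seq d e) s (T - (1 + bcost b)) Q)"
proof -
  have "(\<exists>t s'. exec (Cond b c d) s t s' \<and> t \<le> T \<and> runs e s' (T - t) Q) \<longleftrightarrow>
    (\<exists>t1 s'. exec (if bval b s then c else d) s t1 s' \<and> 1 + bcost b \<le> T \<and>
       t1 \<le> T - (1 + bcost b) \<and> runs e s' (T - (1 + bcost b) - t1) Q)"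
    unfolding exec_Cond_iff using add_le_split[of "1 + bcost b" _ T] by (cases "bval b s") auto
  then show ?thesis unfolding runs_Seq_iff by (cases "bval b s") auto
qed

lemma runs_Seq_Skip: "runs (Seq Skip d) s T Q \<longleftrightarrow> 1 \<le> T \<and> runs d s (T - 1) Q"
  unfolding runs_Seq_iff exec_Skip_iff by blast

lemma runs_Seq_assoc: "runs (Seq (Seq c d) e) s T Q \<longleftrightarrow> runs (Seq c (Seq d e)) s T Q"
proof -
  have "exec (Seq (Seq c d) e) s t s' \<longleftrightarrow> exec (Seq c (Seq d e)) s t s'" for t s'
    unfolding exec_Seq_iff by (auto simp: add.assoc) (blast, metis add.assoc)
  then show ?thesis unfolding runs_def by simp
qed

text \<open>As rewrite rules these execute loop-free code symbolically and subtract each cost from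
  the budget; reassociation exposes the next command.\<close>

lemmas runs_simps = runs_NSet runs_RSet runs_Skip runs_Cond runs_Seq_NSet runs_Seq_RSet
  runs_Seq_Cond runs_Seq_Skip runs_Seq_assoc

lemma nats_nupd [simp]:
  "nats (nupd v i k s) w j = (if w = v \<and> j = i then k else nats s w j)"
  by (simp add: nupd_def)

lemma nats_nupd_other [simp]: "w \<noteq> v \<Longrightarrow> nats (nupd v i k s) w = nats s w"
  by (simp add: nupd_def)

lemma reals_nupd [simp]: "reals (nupd v i k s) = reals s"
  by (simp add: nupd_def)

lemma reals_rupd [simp]:
  "reals (rupd v i k s) w j = (if w = v \<and> j = i then k else reals s w j)"
  by (simp add: rupd_def)

lemma reals_rupd_other [simp]: "w \<noteq> v \<Longrightarrow> reals (rupd v i k s) w = reals s w"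
  by (simp add: rupd_def)

lemma nats_rupd [simp]: "nats (rupd v i k s) = nats s"
  by (simp add: rupd_def)

text \<open>The invariant carries the number of finished iterations. Since a true guard forces
  \<open>i < N\<close>, termination and the time bound follow by induction on
  \<open>N - i\<close>.\<close>

lemma runs_While:
  assumes inv: "I 0 s"
    and step: "\<And>i s. I i s \<Longrightarrow> bval b s \<Longrightarrow> i < N \<and> runs c s T (I (Suc i))"
    and exit: "\<And>i s. I i s \<Longrightarrow> \<not> bval b s \<Longrightarrow> Q s"
  shows "runs (While b c) s (1 + bcost b + N * (1 + bcost b + T)) Q"
proof -
  have "runs (While b c) s (1 + bcost b + (N - i) * (1 + bcost b + T)) Q" if "I i s" for i s
    using that
  proof (induction "N - i" arbitrary: i s)
    case 0
    then have "\<not> bval b s" using step by fastforce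
    then show ?case unfolding runs_def
      using exec.WhileFalse[of b s c] exit[OF 0(2)] by fastforce
  next
    case (Suc m)
    show ?case
    proof (cases "bval b s")
      case False
      then show ?thesis unfolding runs_def
        using exec.WhileFalse[of b s c] exit[OF Suc(3)] by fastforce
    next
      case True
      from step[OF Suc(3) True] obtain t s' where
        1: "i < N" "exec c s t s'" "t \<le> T" "I (Suc i) s'" unfolding runs_def by auto
      from Suc(1)[OF _ 1(4)] Suc(2) obtain t' s'' where
        2: "exec (While b c) s' t' s''" "t' \<le> 1 + bcost b + m * (1 + bcost b + T)" "Q s''"
        unfolding runs_def by (metis Suc_diff_Suc 1(1) old.nat.inject)
      have "1 + bcost b + t + t' \<le> 1 + bcost b + (N - i) * (1 + bcost b + T)"
        using 1(3) 2(2) Suc(2)[symmetric] by simp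
      then show ?thesis unfolding runs_def
        using exec.WhileTrue[OF True 1(2) 2(1)] 2(3) by blast
    qed
  qed
  from this[OF inv] show ?thesis by simp
qed

section \<open>Frame conditions and counting loops\<close>

fun nmod :: "com \<Rightarrow> vname set" where
  "nmod Skip = {}"
| "nmod (NSet v i e) = {v}"
| "nmod (RSet v i e) = {}"
| "nmod (Seq c d) = nmod c \<union> nmod d"
| "nmod (Cond b c d) = nmod c \<union> nmod d"
| "nmod (While b c) = nmod c"

fun rmod :: "com \<Rightarrow> vname set" where
  "rmod Skip = {}"
| "rmod (NSet v i e) = {}"
| "rmod (RSet v i e) = {v}"
| "rmod (Seq c d) = rmod c \<union> rmod d"
| "rmod (Cond b c d) = rmod c \<union> rmod d"
| "rmod (While b c) = rmod c"

text \<open>Whole arrays are equated as functions, so a frame rewrites every read from them; changes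
  within an array have to be described by the individual lemmas.\<close>

definition same :: "vname set \<Rightarrow> vname set \<Rightarrow> state \<Rightarrow> state \<Rightarrow> bool" where
  "same X Y s s' \<longleftrightarrow> (\<forall>v. v \<notin> X \<longrightarrow> nats s' v = nats s v) \<and> (\<forall>v. v \<notin> Y \<longrightarrow> reals s' v = reals s v)"

lemma same_nats: "same X Y s s' \<Longrightarrow> v \<notin> X \<Longrightarrow> nats s' v = nats s v"
  by (simp add: same_def)

lemma same_refl [simp]: "same X Y s s"
  by (simp add: same_def)

lemma same_trans: "same X Y s s' \<Longrightarrow> same X' Y' s' s'' \<Longrightarrow> same (X \<union> X') (Y \<union> Y') s s''"
  by (simp add: same_def)

lemma same_mono: "same X Y s s' \<Longrightarrow> X \<subseteq> X' \<Longrightarrow> Y \<subseteq> Y' \<Longrightarrow> same X' Y' s s'"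
  unfolding same_def by blast

lemma same_nupd [simp]: "v \<in> X \<Longrightarrow> same X Y s (nupd v i k s') \<longleftrightarrow> same X Y s s'"
  unfolding same_def nupd_def by auto

lemma same_rupd [simp]: "v \<in> Y \<Longrightarrow> same X Y s (rupd v i k s') \<longleftrightarrow> same X Y s s'"
  unfolding same_def rupd_def by auto

lemma exec_same: "exec c s t s' \<Longrightarrow> same (nmod c) (rmod c) s s'"
  by (induction rule: exec.induct) (auto simp: same_def nupd_def rupd_def)

text \<open>The assigned arrays are found syntactically, so frames come for free; in particular a
  loop counter survives a body that does not assign it.\<close>

lemma runs_same:
  "runs c s T Q \<Longrightarrow> runs c s T (\<lambda>s'. Q s' \<and> same (nmod c) (rmod c) s s')"
  unfolding runs_def using exec_same by blast

abbreviation V :: "vname \<Rightarrow> nexp" where "V v \<equiv> NGet v (NConst 0)"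
abbreviation R :: "vname \<Rightarrow> rexp" where "R v \<equiv> RGet v (NConst 0)"

definition For :: "vname \<Rightarrow> nexp \<Rightarrow> com \<Rightarrow> com" where
  "For v e c = Seq (NSet v (NConst 0) (NConst 0))
     (While (NLess (V v) e) (Seq c (NSet v (NConst 0) (NAdd (V v) (NConst 1)))))"

lemma nmod_For [simp]: "nmod (For v e c) = insert v (nmod c)"
  by (auto simp: For_def)

lemma rmod_For [simp]: "rmod (For v e c) = rmod c"
  by (simp add: For_def)

text \<open>The constants allow for a loop bound whose evaluation costs up to five steps.\<close>

definition for_time :: "nat \<Rightarrow> nat \<Rightarrow> nat" where
  "for_time N T = 12 + N * (T + 15)"

text \<open>The loop evaluates its bound anew in every round, so the invariant has to fix the value
  \<open>N\<close>. It is re-established only after the counter has been advanced.\<close>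

lemma runs_For:
  assumes init: "I 0 (nupd v 0 0 s)"
    and step: "\<And>i s. i < N \<Longrightarrow> I i s \<Longrightarrow> nats s v 0 = i \<Longrightarrow>
      runs c s T (\<lambda>s'. I (Suc i) (nupd v 0 (Suc i) s'))"
    and bound: "\<And>i s. I i s \<Longrightarrow> nval e s = N"
    and post: "\<And>s'. I N s' \<Longrightarrow> nats s' v 0 = N \<Longrightarrow> Q s'"
    and v: "v \<notin> nmod c" and e: "ncost e \<le> 5"
  shows "runs (For v e c) s (for_time N T) Q"
proof -
  let ?b = "NLess (V v) e" and ?inc = "NSet v (NConst 0) (NAdd (V v) (NConst 1))"
  let ?I = "\<lambda>i s. I i s \<and> nats s v 0 = i \<and> i \<le> N"
  have "runs (While ?b (Seq c ?inc)) (nupd v 0 0 s)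
      (1 + bcost ?b + N * (1 + bcost ?b + (T + 6))) Q"
  proof (rule runs_While[where I = ?I])
    show "?I 0 (nupd v 0 0 s)" using init by simp
  next
    fix i s assume I: "?I i s" and b: "bval ?b s"
    from I b bound have iN: "i < N" by fastforce
    have "runs c s T (\<lambda>s'. I (Suc i) (nupd v 0 (Suc i) s') \<and> same (nmod c) (rmod c) s s')"
      using runs_same[OF step[OF iN]] I by blast
    then have "runs c s T (\<lambda>s'. runs ?inc s' 6 (?I (Suc i)))"
      by (rule runs_weaken) (use I iN in \<open>auto simp: runs_NSet same_nats[OF _ v]\<close>)
    then show "i < N \<and> runs (Seq c ?inc) s (T + 6) (?I (Suc i))"
      using iN runs_Seq by blast
  next
    fix i s assume I: "?I i s" and b: "\<not> bval ?b s"
    then have "i = N" using bound by fastforce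
    with I show "Q s" using post by auto
  qed
  then have "runs (For v e c) s (3 + (1 + bcost ?b + N * (1 + bcost ?b + (T + 6)))) Q"
    unfolding For_def runs_Seq_NSet by (simp add: eval_nat_numeral)
  moreover have "3 + (1 + bcost ?b + N * (1 + bcost ?b + (T + 6))) \<le> for_time N T"
  proof -
    have "N * (1 + bcost ?b + (T + 6)) \<le> N * (T + 15)"
      using e by (intro mult_le_mono2) simp
    moreover have "bcost ?b \<le> 8" using e by simp
    ultimately show ?thesis unfolding for_time_def by linarith
  qed
  ultimately show ?thesis using runs_weaken by blast
qed

text \<open>\<open>l\<close> nested loops whose counters are the entries of the array
  \<open>g\<close> itself, so the body sees the current guess as a function. The highest entry
  belongs to the outermost loop, and each entry runs up to \<open>n\<close>, the index for no
  job.\<close>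

fun nest :: "nat \<Rightarrow> com \<Rightarrow> com" where
  "nest 0 c = c"
| "nest (Suc l) c = Seq (NSet ''g'' (NConst l) (NConst 0))
     (While (NLess (NGet ''g'' (NConst l)) (NAdd (V ''n'') (NConst 1)))
       (Seq (nest l c)
         (NSet ''g'' (NConst l) (NAdd (NGet ''g'' (NConst l)) (NConst 1)))))"

fun nest_time :: "nat \<Rightarrow> nat \<Rightarrow> nat \<Rightarrow> nat" where
  "nest_time 0 n T = T"
| "nest_time (Suc l) n T = 12 + (n + 1) * (nest_time l n T + 15)"

text \<open>\<open>B\<close> is a goal that is never lost again and \<open>G\<close> says that a
  guess achieves it. The loops visit every guess that agrees with the store from \<open>L\<close>
  on, so one good guess among them suffices.\<close>

lemma runs_nest:
  assumes body: "\<And>s. J s \<Longrightarrow> runs c s T (\<lambda>s'. J s' \<and> nats s' ''g'' = nats s ''g'' \<and>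
      (B s \<longrightarrow> B s') \<and> (G (nats s ''g'') \<longrightarrow> B s'))"
    and Jn: "\<And>s. J s \<Longrightarrow> nats s ''n'' 0 = n"
    and Jg: "\<And>s l k. J s \<Longrightarrow> J (nupd ''g'' l k s)"
    and Bg: "\<And>s l k. B (nupd ''g'' l k s) = B s"
    and s: "J s"
  shows "runs (nest L c) s (nest_time L n T) (\<lambda>s'. J s' \<and>
      (\<forall>l\<ge>L. nats s' ''g'' l = nats s ''g'' l) \<and> (B s \<longrightarrow> B s') \<and>
      (\<forall>h. (\<forall>l<L. h l \<le> n) \<and> (\<forall>l\<ge>L. h l = nats s ''g'' l) \<and> G h \<longrightarrow> B s'))"
  using s
proof (induction L arbitrary: s)
  case 0
  have "runs c s T (\<lambda>s'. J s' \<and> (\<forall>l\<ge>0. nats s' ''g'' l = nats s ''g'' l) \<and> (B s \<longrightarrow> B s') \<and>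
      (\<forall>h. (\<forall>l<0. h l \<le> n) \<and> (\<forall>l\<ge>0. h l = nats s ''g'' l) \<and> G h \<longrightarrow> B s'))"
  proof (rule runs_weaken[OF body[OF 0] _ order_refl], intro conjI)
    fix s' assume h: "J s' \<and> nats s' ''g'' = nats s ''g'' \<and> (B s \<longrightarrow> B s') \<and>
      (G (nats s ''g'') \<longrightarrow> B s')"
    show "\<forall>f. (\<forall>l<0. f l \<le> n) \<and> (\<forall>l\<ge>0. f l = nats s ''g'' l) \<and> G f \<longrightarrow> B s'"
      using h by (metis ext zero_le)
  qed auto
  then show ?case by simp
next
  case (Suc L)
  let ?b = "NLess (NGet ''g'' (NConst L)) (NAdd (V ''n'') (NConst 1))"
  let ?inc = "NSet ''g'' (NConst L) (NAdd (NGet ''g'' (NConst L)) (NConst 1))"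
  let ?I = "\<lambda>i s'. J s' \<and> i \<le> Suc n \<and> nats s' ''g'' L = i \<and>
      (\<forall>l>L. nats s' ''g'' l = nats s ''g'' l) \<and> (B s \<longrightarrow> B s') \<and>
      (\<forall>h. (\<forall>l<Suc L. h l \<le> n) \<and> h L < i \<and> (\<forall>l>L. h l = nats s ''g'' l) \<and> G h \<longrightarrow> B s')"
  let ?Q = "\<lambda>s'. J s' \<and>
      (\<forall>l\<ge>Suc L. nats s' ''g'' l = nats s ''g'' l) \<and> (B s \<longrightarrow> B s') \<and>
      (\<forall>h. (\<forall>l<Suc L. h l \<le> n) \<and> (\<forall>l\<ge>Suc L. h l = nats s ''g'' l) \<and> G h \<longrightarrow> B s')"
  have "runs (While ?b (Seq (nest L c) ?inc)) (nupd ''g'' L 0 s)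
      (1 + bcost ?b + (n + 1) * (1 + bcost ?b + (nest_time L n T + 6))) ?Q"
  proof (rule runs_While[where I = ?I])
    show "?I 0 (nupd ''g'' L 0 s)" using Suc.prems by (auto simp: Jg Bg)
  next
    fix i s1 assume I: "?I i s1" and b: "bval ?b s1"
    from I b Jn have iN: "i < n + 1" by auto
    have J1: "J s1" using I by blast
    have "runs (nest L c) s1 (nest_time L n T) (\<lambda>s'. runs ?inc s' 6 (?I (Suc i)))"
    proof (rule runs_weaken[OF Suc.IH[OF J1] _ order_refl])
      fix s' assume h: "J s' \<and> (\<forall>l\<ge>L. nats s' ''g'' l = nats s1 ''g'' l) \<and> (B s1 \<longrightarrow> B s') \<and>
        (\<forall>h. (\<forall>l<L. h l \<le> n) \<and> (\<forall>l\<ge>L. h l = nats s1 ''g'' l) \<and> G h \<longrightarrow> B s')"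
      \<comment> \<open>A guess with a smaller entry \<open>L\<close> was visited in an earlier
        round, and \<open>B\<close> has persisted; one with entry \<open>i\<close> agrees with the
        current store from \<open>L\<close> on and is visited by the inner loops.\<close>
      have c: "B s'" if f: "\<forall>l<Suc L. f l \<le> n" "f L < Suc i" "\<forall>l>L. f l = nats s ''g'' l" "G f" for f
      proof (cases "f L < i")
        case True
        then show ?thesis using f I h by blast
      next
        case False
        then have "f L = i" using f(2) by simp
        then have "\<forall>l\<ge>L. f l = nats s1 ''g'' l" using f(3) I
          by (metis le_neq_implies_less)
        moreover have "\<forall>l<L. f l \<le> n" using f(1) by simp
        ultimately show ?thesis using f(4) h by blast
      qed
      show "runs ?inc s' 6 (?I (Suc i))"
        using h I iN c by (auto simp: runs_NSet Jg Bg)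
    qed
    then show "i < n + 1 \<and> runs (Seq (nest L c) ?inc) s1 (nest_time L n T + 6) (?I (Suc i))"
      using iN runs_Seq by blast
  next
    fix i s' assume I: "?I i s'" and b: "\<not> bval ?b s'"
    then have "i = Suc n" using Jn by auto
    with I show "?Q s'" by (auto simp: less_Suc_eq_le Suc_le_eq)
  qed
  then have "runs (nest (Suc L) c) s
      (3 + (1 + bcost ?b + (n + 1) * (1 + bcost ?b + (nest_time L n T + 6)))) ?Q"
    unfolding nest.simps runs_Seq_NSet by simp
  then show ?case by (rule runs_weaken) (auto simp: algebra_simps)
qed

section \<open>The algorithm\<close>

definition inp :: "nat \<Rightarrow> (nat \<Rightarrow> real) \<Rightarrow> (nat \<Rightarrow> real) \<Rightarrow> (nat \<Rightarrow> real) \<Rightarrow> state \<Rightarrow> bool" where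
  "inp n a b p s \<longleftrightarrow>
     nats s ''n'' 0 = n \<and> reals s ''a'' = a \<and> reals s ''b'' = b \<and> reals s ''p'' = p"

text \<open>Multiplication of naturals by repeated addition, in time linear in the second
  factor.\<close>

definition mul_com :: "vname \<Rightarrow> vname \<Rightarrow> vname \<Rightarrow> com" where
  "mul_com r x y = Seq (NSet r (NConst 0) (NConst 0))
     (For ''i'' (V y) (NSet r (NConst 0) (NAdd (V r) (V x))))"

lemma runs_mul:
  assumes "r \<noteq> x" "r \<noteq> y" "r \<noteq> ''i''" "x \<noteq> ''i''" "y \<noteq> ''i''"
  shows "runs (mul_com r x y) s (3 + for_time (nats s y 0) 7)
    (\<lambda>s'. nats s' r 0 = nats s x 0 * nats s y 0 \<and> same {r, ''i''} {} s s')"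
proof -
  have "runs (For ''i'' (V y) (NSet r (NConst 0) (NAdd (V r) (V x)))) (nupd r 0 0 s)
    (for_time (nats s y 0) 7)
    (\<lambda>s'. nats s' r 0 = nats s x 0 * nats s y 0 \<and> same {r, ''i''} {} s s')"
  proof (rule runs_For[where I = "\<lambda>i s'. nats s' r 0 = nats s x 0 * i \<and> same {r, ''i''} {} s s'"])
    fix i s' assume "nats s' r 0 = nats s x 0 * i \<and> same {r, ''i''} {} s s'"
    moreover from this have "nats s' x = nats s x" using assms by (simp add: same_def)
    ultimately show "runs (NSet r (NConst 0) (NAdd (V r) (V x))) s' 7
      (\<lambda>s'. nats (nupd ''i'' 0 (Suc i) s') r 0 = nats s x 0 * Suc i \<and>
        same {r, ''i''} {} s (nupd ''i'' 0 (Suc i) s'))"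
      using assms by (simp add: runs_NSet)
  qed (use assms in \<open>auto simp: same_def\<close>)
  then show ?thesis unfolding mul_com_def runs_Seq_NSet by simp
qed

definition setup_com :: "nat \<Rightarrow> com" where
  "setup_com k = Seq (NSet ''kk'' (NConst 0) (NConst k)) (Seq (mul_com ''nk'' ''n'' ''kk'')
     (Seq (mul_com ''M'' ''nk'' ''n'') (Seq (NSet ''M'' (NConst 0) (NAdd (V ''M'') (NConst 1)))
     (Seq (mul_com ''M2'' ''M'' ''M'') (Seq (mul_com ''M3'' ''M2'' ''M'')
     (mul_com ''W'' ''M3'' ''M''))))))"

definition consts_set :: "nat \<Rightarrow> nat \<Rightarrow> state \<Rightarrow> bool" where
  "consts_set k n s \<longleftrightarrow> nats s ''nk'' 0 = n * k \<and> nats s ''M'' 0 = base k n \<and>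
     nats s ''M2'' 0 = base k n * base k n \<and>
     nats s ''M3'' 0 = base k n * base k n * base k n \<and>
     nats s ''W'' 0 = base k n * base k n * base k n * base k n"

definition setup_time :: "nat \<Rightarrow> nat \<Rightarrow> nat" where
  "setup_time k n = 3 + ((3 + for_time k 7) + ((3 + for_time n 7) + (6 +
     ((3 + for_time (base k n) 7) + ((3 + for_time (base k n) 7) + (3 + for_time (base k n) 7))))))"

lemma runs_setup:
  assumes "nats s ''n'' 0 = n"
  shows "runs (setup_com k) s (setup_time k n) (\<lambda>s'. consts_set k n s' \<and>
    same {''kk'', ''nk'', ''M'', ''M2'', ''M3'', ''W'', ''i''} {} s s')"
proof -
  let ?X = "{''kk'', ''nk'', ''M'', ''M2'', ''M3'', ''W'', ''i''}"
  let ?P = "\<lambda>xs s'. same ?X {} s s' \<and> (\<forall>(v, c)\<in>set xs. nats s' v 0 = c)"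
  let ?B = "base k n"
  \<comment> \<open>The list \<open>xs\<close> collects the scalars known so far, so that each
    product only adds its own entry.\<close>
  have mul: "runs (mul_com r x y) s' (3 + for_time d 7) (?P ((r, c * d) # xs))"
    if "?P xs s'" "nats s' x 0 = c" "nats s' y 0 = d"
      "r \<noteq> x" "r \<noteq> y" "r \<noteq> ''i''" "x \<noteq> ''i''" "y \<noteq> ''i''" "r \<in> ?X"
      "r \<notin> fst ` set xs" "''i'' \<notin> fst ` set xs"
    for r x y s' c d xs
    using runs_mul[OF that(4-8), of s'] unfolding that(2,3)
  proof (rule runs_weaken[OF _ _ order_refl], intro conjI)
    fix s'' assume h: "nats s'' r 0 = c * d \<and> same {r, ''i''} {} s' s''"
    show "same ?X {} s s''"
      by (rule same_mono[OF same_trans[of ?X "{}" s s' "{r, ''i''}" "{}"]]) (use h that in auto)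
    have "nats s'' v 0 = z" if "(v, z) \<in> set xs" for v z
    proof -
      have "v \<notin> {r, ''i''}" using that \<open>r \<notin> _\<close> \<open>''i'' \<notin> _\<close> by force
      then have "nats s'' v = nats s' v" using h by (simp add: same_def)
      then show ?thesis using that \<open>?P xs s'\<close> by auto
    qed
    then show "\<forall>(v, c)\<in>set ((r, c * d) # xs). nats s'' v 0 = c" using h by auto
  qed
  show ?thesis
    unfolding setup_com_def setup_time_def
  proof (rule runs_Seq[OF _ order_refl])
    show "runs (NSet ''kk'' (NConst 0) (NConst k)) s 3 (\<lambda>s1. runs (Seq (mul_com ''nk'' ''n'' ''kk'')
     (Seq (mul_com ''M'' ''nk'' ''n'') (Seq (NSet ''M'' (NConst 0) (NAdd (V ''M'') (NConst 1)))
     (Seq (mul_com ''M2'' ''M'' ''M'') (Seq (mul_com ''M3'' ''M2'' ''M'')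
     (mul_com ''W'' ''M3'' ''M'')))))) s1 ((3 + for_time k 7) + ((3 + for_time n 7) + (6 +
     ((3 + for_time (base k n) 7) + ((3 + for_time (base k n) 7) + (3 + for_time (base k n) 7)))))) (\<lambda>s'. consts_set k n s' \<and>
    same {''kk'', ''nk'', ''M'', ''M2'', ''M3'', ''W'', ''i''} {} s s'))"
    proof (rule runs_weaken[where Q = "?P [(''n'', n), (''kk'', k)]" and T = 3])
      show "runs (NSet ''kk'' (NConst 0) (NConst k)) s 3 (?P [(''n'', n), (''kk'', k)])"
        using assms by (simp add: runs_NSet)
    next
      fix s1 assume "?P [(''n'', n), (''kk'', k)] s1"
      then have r1: "runs (mul_com ''nk'' ''n'' ''kk'') s1 (3 + for_time k 7)
          (?P [(''nk'', n * k), (''n'', n), (''kk'', k)])"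
        by (intro mul) auto
      have r2: "runs (mul_com ''M'' ''nk'' ''n'') s2 (3 + for_time n 7)
          (?P [(''M'', n * k * n), (''nk'', n * k), (''n'', n), (''kk'', k)])"
        if "?P [(''nk'', n * k), (''n'', n), (''kk'', k)] s2" for s2
        using that by (intro mul) auto
      have r3: "runs (NSet ''M'' (NConst 0) (NAdd (V ''M'') (NConst 1))) s3 6
          (?P [(''M'', ?B), (''nk'', n * k)])"
        if "?P [(''M'', n * k * n), (''nk'', n * k), (''n'', n), (''kk'', k)] s3" for s3
        using that by (simp add: runs_NSet base_def)
      have r4: "runs (mul_com ''M2'' ''M'' ''M'') s4 (3 + for_time ?B 7)
          (?P [(''M2'', ?B * ?B), (''M'', ?B), (''nk'', n * k)])"
        if "?P [(''M'', ?B), (''nk'', n * k)] s4" for s4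
        using that by (intro mul) auto
      have r5: "runs (mul_com ''M3'' ''M2'' ''M'') s5 (3 + for_time ?B 7)
          (?P [(''M3'', ?B * ?B * ?B), (''M2'', ?B * ?B), (''M'', ?B), (''nk'', n * k)])"
        if "?P [(''M2'', ?B * ?B), (''M'', ?B), (''nk'', n * k)] s5" for s5
        using that by (intro mul) auto
      have r6: "runs (mul_com ''W'' ''M3'' ''M'') s6 (3 + for_time ?B 7)
          (?P [(''W'', ?B * ?B * ?B * ?B), (''M3'', ?B * ?B * ?B), (''M2'', ?B * ?B), (''M'', ?B), (''nk'', n * k)])"
        if "?P [(''M3'', ?B * ?B * ?B), (''M2'', ?B * ?B), (''M'', ?B), (''nk'', n * k)] s6" for s6
        using that by (intro mul) auto
      note w = runs_weaken[OF _ _ order_refl]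
      show "runs (Seq (mul_com ''nk'' ''n'' ''kk'')
     (Seq (mul_com ''M'' ''nk'' ''n'') (Seq (NSet ''M'' (NConst 0) (NAdd (V ''M'') (NConst 1)))
     (Seq (mul_com ''M2'' ''M'' ''M'') (Seq (mul_com ''M3'' ''M2'' ''M'')
     (mul_com ''W'' ''M3'' ''M'')))))) s1 ((3 + for_time k 7) + ((3 + for_time n 7) + (6 +
     ((3 + for_time (base k n) 7) + ((3 + for_time (base k n) 7) + (3 + for_time (base k n) 7)))))) (\<lambda>s'. consts_set k n s' \<and>
    same {''kk'', ''nk'', ''M'', ''M2'', ''M3'', ''W'', ''i''} {} s s')"
        apply (rule runs_Seq[OF w[OF r1] order_refl])
        apply (rule runs_Seq[OF w[OF r2] order_refl], assumption)
        apply (rule runs_Seq[OF w[OF r3] order_refl], assumption)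
        apply (rule runs_Seq[OF w[OF r4] order_refl], assumption)
        apply (rule runs_Seq[OF w[OF r5] order_refl], assumption)
        apply (rule w[OF r6], assumption)
        apply (simp add: consts_set_def)
        done
    qed simp
  qed
qed

section \<open>Computing eligibility and the key of every job\<close>

definition mark_com :: "nat \<Rightarrow> com" where
  "mark_com k = Seq (For ''i'' (V ''n'') (NSet ''tt'' (V ''i'') (NConst 0)))
     (For ''l'' (NConst (2 * k)) (NSet ''tt'' (NGet ''g'' (V ''l'')) (NConst 1)))"

text \<open>An entry \<open>n\<close> of the guess marks position \<open>n\<close>, which lies
  outside the range of jobs.\<close>

lemma runs_mark:
  assumes "nats s ''n'' 0 = n"
  shows "runs (mark_com k) s (for_time n 4 + for_time (2 * k) 5)
    (\<lambda>s'. (\<forall>i<n. nats s' ''tt'' i \<noteq> 0 \<longleftrightarrow> i \<in> kept k n (nats s ''g'')) \<and>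
      same {''tt'', ''i'', ''l''} {} s s')"
  unfolding mark_com_def
proof (rule runs_Seq[OF _ order_refl])
  let ?X = "{''tt'', ''i'', ''l''}"
  show "runs (For ''i'' (V ''n'') (NSet ''tt'' (V ''i'') (NConst 0))) s (for_time n 4)
    (\<lambda>s'. runs (For ''l'' (NConst (2 * k)) (NSet ''tt'' (NGet ''g'' (V ''l'')) (NConst 1)))
        s' (for_time (2 * k) 5)
      (\<lambda>s'. (\<forall>i<n. nats s' ''tt'' i \<noteq> 0 \<longleftrightarrow> i \<in> kept k n (nats s ''g'')) \<and> same ?X {} s s'))"
  proof (rule runs_For[where I = "\<lambda>i s'. (\<forall>j<i. nats s' ''tt'' j = 0) \<and> same ?X {} s s'"])
    fix s1 assume I: "(\<forall>j<n. nats s1 ''tt'' j = 0) \<and> same ?X {} s s1"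
    show "runs (For ''l'' (NConst (2 * k)) (NSet ''tt'' (NGet ''g'' (V ''l'')) (NConst 1)))
        s1 (for_time (2 * k) 5)
      (\<lambda>s'. (\<forall>i<n. nats s' ''tt'' i \<noteq> 0 \<longleftrightarrow> i \<in> kept k n (nats s ''g'')) \<and> same ?X {} s s')"
    proof (rule runs_For[where I = "\<lambda>l s'. (\<forall>i<n. nats s' ''tt'' i \<noteq> 0 \<longleftrightarrow>
          (\<exists>l'<l. nats s ''g'' l' = i)) \<and> same ?X {} s s'"])
      fix l s2 assume l: "(\<forall>i<n. nats s2 ''tt'' i \<noteq> 0 \<longleftrightarrow> (\<exists>l'<l. nats s ''g'' l' = i)) \<and>
        same ?X {} s s2" "nats s2 ''l'' 0 = l"
      then have "nats s2 ''g'' = nats s ''g''" by (simp add: same_def)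
      then show "runs (NSet ''tt'' (NGet ''g'' (V ''l'')) (NConst 1)) s2 5
        (\<lambda>s'. (\<forall>i<n. nats (nupd ''l'' 0 (Suc l) s') ''tt'' i \<noteq> 0 \<longleftrightarrow>
          (\<exists>l'<Suc l. nats s ''g'' l' = i)) \<and> same ?X {} s (nupd ''l'' 0 (Suc l) s'))"
        using l by (auto simp: runs_NSet less_Suc_eq)
    qed (use I in \<open>auto simp: kept_def\<close>)
  qed (use assms in \<open>auto simp: runs_NSet less_Suc_eq same_def\<close>)
qed

text \<open>The accumulator grows by the place value \<open>st\<close> for every multiple counted by
  \<open>rnd\<close>, so the digit arrives already multiplied by its place value.\<close>

definition round_com :: "vname \<Rightarrow> rexp \<Rightarrow> rexp \<Rightarrow> vname \<Rightarrow> com" where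
  "round_com N D X st = For ''c'' (V N)
     (Cond (RLess (RMul (RNat (NAdd (V ''c'') (NConst 1))) D) (RMul X (RNat (V N))))
       (NSet ''wt'' (NConst 0) (NAdd (V ''wt'') (V st))) Skip)"

lemma runs_round:
  assumes N: "nats s N 0 = n" "N \<noteq> ''c''" "N \<noteq> ''wt''" and st: "st \<noteq> ''c''" "st \<noteq> ''wt''"
    and D: "\<And>s'. same {''c'', ''wt''} {} s s' \<Longrightarrow> rval D s' = d" "rcost D \<le> 10"
    and X: "\<And>s'. same {''c'', ''wt''} {} s s' \<Longrightarrow> rval X s' = x" "rcost X \<le> 10"
  shows "runs (round_com N D X st) s (for_time n 50)
    (\<lambda>s'. nats s' ''wt'' 0 = nats s ''wt'' 0 + rnd n d (x * real n) * nats s st 0 \<and>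
      same {''c'', ''wt''} {} s s')"
proof -
  let ?b = "RLess (RMul (RNat (NAdd (V ''c'') (NConst 1))) D) (RMul X (RNat (V N)))"
  have "runs (round_com N D X st) s (for_time n 50)
    (\<lambda>s'. nats s' ''wt'' 0 = nats s ''wt'' 0 + (\<Sum>l<n. if real (Suc l) * d < x * real n then 1 else 0) * nats s st 0 \<and>
      same {''c'', ''wt''} {} s s')"
    unfolding round_com_def
  proof (rule runs_For[where I = "\<lambda>i s'. nats s' ''wt'' 0 = nats s ''wt'' 0 +
      (\<Sum>l<i. if real (Suc l) * d < x * real n then 1 else 0) * nats s st 0 \<and> same {''c'', ''wt''} {} s s'"])
    fix i s' assume I: "nats s' ''wt'' 0 = nats s ''wt'' 0 +
      (\<Sum>l<i. if real (Suc l) * d < x * real n then 1 else 0) * nats s st 0 \<and> same {''c'', ''wt''} {} s s'"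
      and i: "nats s' ''c'' 0 = i"
    have v: "nats s' N = nats s N" "nats s' st = nats s st" "rval D s' = d" "rval X s' = x"
      using I N st D X by (auto simp: same_def)
    have bv: "bval ?b s' \<longleftrightarrow> real (Suc i) * d < x * real n" using v i N by (simp add: add.commute)
    show "runs (Cond ?b (NSet ''wt'' (NConst 0) (NAdd (V ''wt'') (V st))) Skip) s' 50
      (\<lambda>s'. nats (nupd ''c'' 0 (Suc i) s') ''wt'' 0 = nats s ''wt'' 0 +
        (\<Sum>l<Suc i. if real (Suc l) * d < x * real n then 1 else 0) * nats s st 0 \<and>
        same {''c'', ''wt''} {} s (nupd ''c'' 0 (Suc i) s'))"
      unfolding runs_Cond bv using I v D(2) X(2)
      by (simp add: runs_NSet runs_Skip algebra_simps) linarith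
  qed (use N in \<open>auto simp: same_def\<close>)
  moreover have "(\<Sum>l<m. if real (Suc l) * d < y then 1 else 0) = rnd m d y" for m y
    by (induction m) auto
  ultimately show ?thesis by simp
qed

definition early :: "vname \<Rightarrow> bexp" where
  "early x = BNot (RLess (RGet ''b'' (V x)) (RGet ''a'' (V x)))"

definition pmax :: "nat \<Rightarrow> rexp" where
  "pmax k = RGet ''p'' (NGet ''g'' (NConst (2 * k)))"

text \<open>Besides the quantity to be rounded and its threshold this loads the place values of the
  two digits. They depend on the group alone, so early and late jobs never share a digit of the
  key.\<close>

definition group_com :: "nat \<Rightarrow> com" where
  "group_com k = Cond (early ''i'')
     (Seq (RSet ''u'' (NConst 0) (RGet ''a'' (V ''i'')))
     (Seq (RSet ''al'' (NConst 0) (RGet ''a'' (NGet ''g'' (NConst (2 * k + 1)))))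
     (Seq (NSet ''s1'' (NConst 0) (NConst 1)) (NSet ''s2'' (NConst 0) (V ''M'')))))
     (Seq (RSet ''u'' (NConst 0) (RGet ''b'' (V ''i'')))
     (Seq (RSet ''al'' (NConst 0) (RGet ''b'' (NGet ''g'' (NConst (2 * k + 2)))))
     (Seq (NSet ''s1'' (NConst 0) (V ''M2'')) (NSet ''s2'' (NConst 0) (V ''M3'')))))"

definition eligible_com :: "nat \<Rightarrow> com" where
  "eligible_com k = Cond
     (BAnd (NLess (NGet ''tt'' (V ''i'')) (NConst 1))
     (BAnd (BNot (RLess (RGet ''p'' (V ''i'')) (RNat (NConst 0))))
     (BAnd (BNot (RLess (pmax k) (RGet ''p'' (V ''i''))))
       (BNot (RLess (R ''al'') (R ''u''))))))
     (NSet ''el'' (V ''i'') (NConst 1)) (NSet ''el'' (V ''i'') (NConst 0))"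

definition weight_com :: "nat \<Rightarrow> com" where
  "weight_com k = Seq (group_com k) (Seq (eligible_com k) (Seq (NSet ''wt'' (NConst 0) (NConst 0))
     (Seq (round_com ''n'' (R ''al'') (R ''u'') ''s1'')
     (Seq (round_com ''nk'' (pmax k) (RGet ''p'' (V ''i'')) ''s2'')
       (NSet ''w'' (V ''i'') (V ''wt''))))))"

definition weight_time :: "nat \<Rightarrow> nat \<Rightarrow> nat" where
  "weight_time k n = 50 + (50 + (3 + (for_time n 50 + (for_time (n * k) 50 + 5))))"

lemma runs_weight:
  assumes inp: "inp n a b p s" and cst: "consts_set k n s"
    and tt: "nats s ''tt'' i \<noteq> 0 \<longleftrightarrow> i \<in> kept k n (nats s ''g'')" and i: "nats s ''i'' 0 = i"
  shows "runs (weight_com k) s (weight_time k n)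
    (\<lambda>s'. (nats s' ''el'' i \<noteq> 0 \<longleftrightarrow> eligible a b p k n (nats s ''g'') i) \<and>
      nats s' ''w'' i = key a b p k n (nats s ''g'') i \<and>
      (\<forall>j. j \<noteq> i \<longrightarrow> nats s' ''el'' j = nats s ''el'' j \<and> nats s' ''w'' j = nats s ''w'' j) \<and>
      same {''el'', ''w'', ''wt'', ''s1'', ''s2'', ''c''} {''u'', ''al''} s s')"
proof -
  let ?h = "nats s ''g''" and ?X = "{''el'', ''w'', ''wt'', ''s1'', ''s2'', ''c''}"
  let ?Y = "{''u'', ''al''}"
  let ?al = "threshold a b k ?h (a i \<le> b i)"
  let ?s1 = "if a i \<le> b i then 1 else base k n * base k n"
  let ?s2 = "if a i \<le> b i then base k n else base k n * base k n * base k n"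
  let ?pm = "p (?h (2 * k))"
  note d = inp[unfolded inp_def] cst[unfolded consts_set_def]
  have st: "nats s' v = nats s v" if "same ?X ?Y s s'" "v \<notin> ?X" for s' v
    using that by (simp add: same_def)
  have rt: "reals s' v = reals s v" if "same ?X ?Y s s'" "v \<notin> ?Y" for s' v
    using that by (simp add: same_def)
  let ?A = "\<lambda>s'. same ?X ?Y s s' \<and> nats s' ''el'' = nats s ''el'' \<and> nats s' ''w'' = nats s ''w'' \<and>
    reals s' ''u'' 0 = lo a b i \<and> reals s' ''al'' 0 = ?al \<and> nats s' ''s1'' 0 = ?s1 \<and>
    nats s' ''s2'' 0 = ?s2"
  have r1: "runs (group_com k) s 50 ?A"
    using d i by (auto simp: group_com_def early_def runs_simps lo_def threshold_def)
  let ?E = "\<lambda>s'. same ?X ?Y s s' \<and> (nats s' ''el'' i \<noteq> 0 \<longleftrightarrow> eligible a b p k n ?h i) \<and>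
    (\<forall>j. j \<noteq> i \<longrightarrow> nats s' ''el'' j = nats s ''el'' j) \<and>
    nats s' ''w'' = nats s ''w'' \<and> reals s' ''u'' 0 = lo a b i \<and> reals s' ''al'' 0 = ?al \<and>
    nats s' ''s1'' 0 = ?s1 \<and> nats s' ''s2'' 0 = ?s2"
  have r2: "runs (eligible_com k) s1 50 ?E" if A: "?A s1" for s1
  proof -
    have f: "same ?X ?Y s s1" using A by blast
    have g: "nats s1 ''g'' = ?h" "nats s1 ''i'' 0 = i" "nats s1 ''tt'' = nats s ''tt''" "reals s1 ''p'' = p"
      using st[OF f, of "''g''"] st[OF f, of "''i''"] st[OF f, of "''tt''"] rt[OF f, of "''p''"] i d
      by auto
    show ?thesis
      using A g tt by (auto simp: eligible_com_def pmax_def runs_simps eligible_def not_less)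
  qed
  let ?W = "\<lambda>c s'. ?E s' \<and> nats s' ''wt'' 0 = c"
  have r3: "runs (NSet ''wt'' (NConst 0) (NConst 0)) s2 3 (?W 0)" if "?E s2" for s2
    using that by (simp add: runs_NSet)
  have keep: "?W c s''" if "?W c' s'" "nats s'' ''wt'' 0 = c \<and> same {''c'', ''wt''} {} s' s''" for c c' s' s''
  proof -
    have "same ?X ?Y s s''"
      by (rule same_mono[OF same_trans[of ?X ?Y s s' "{''c'', ''wt''}" "{}"]]) (use that in auto)
    then show ?thesis using that by (simp add: same_def)
  qed
  have r4: "runs (round_com ''n'' (R ''al'') (R ''u'') ''s1'') s3 (for_time n 50)
      (?W (udigit a b k n ?h i * ?s1))" if W: "?W 0 s3" for s3
  proof -
    have f: "same ?X ?Y s s3" using W by blast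
    have "runs (round_com ''n'' (R ''al'') (R ''u'') ''s1'') s3 (for_time n 50)
      (\<lambda>s'. nats s' ''wt'' 0 = nats s3 ''wt'' 0 + rnd n ?al (lo a b i * real n) * nats s3 ''s1'' 0 \<and>
        same {''c'', ''wt''} {} s3 s')"
      using W st[OF f, of "''n''"] d by (intro runs_round) (auto simp: same_def)
    then show ?thesis
      by (rule runs_weaken[OF _ _ order_refl]) (rule keep[OF W], use W in \<open>simp add: udigit_def\<close>)
  qed
  have r5: "runs (round_com ''nk'' (pmax k) (RGet ''p'' (V ''i'')) ''s2'') s4 (for_time (n * k) 50)
      (?W (key a b p k n ?h i))" if W: "?W (udigit a b k n ?h i * ?s1) s4" for s4
  proof -
    have f: "same ?X ?Y s s4" using W by blast
    have "runs (round_com ''nk'' (pmax k) (RGet ''p'' (V ''i'')) ''s2'') s4 (for_time (n * k) 50)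
      (\<lambda>s'. nats s' ''wt'' 0 = nats s4 ''wt'' 0 + rnd (n * k) ?pm (p i * real (n * k)) * nats s4 ''s2'' 0 \<and>
        same {''c'', ''wt''} {} s4 s')"
      using W st[OF f, of "''nk''"] st[OF f, of "''g''"] st[OF f, of "''i''"] rt[OF f, of "''p''"] d i
      by (intro runs_round) (auto simp: same_def pmax_def)
    then show ?thesis
      by (rule runs_weaken[OF _ _ order_refl])
        (rule keep[OF W], use W in \<open>simp add: key_def pdigit_def\<close>)
  qed
  have r6: "runs (NSet ''w'' (V ''i'') (V ''wt'')) s5 5
    (\<lambda>s'. (nats s' ''el'' i \<noteq> 0 \<longleftrightarrow> eligible a b p k n ?h i) \<and>
      nats s' ''w'' i = key a b p k n ?h i \<and>
      (\<forall>j. j \<noteq> i \<longrightarrow> nats s' ''el'' j = nats s ''el'' j \<and> nats s' ''w'' j = nats s ''w'' j) \<and>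
      same ?X ?Y s s')" if W: "?W (key a b p k n ?h i) s5" for s5
  proof -
    have f: "same ?X ?Y s s5" using W by blast
    show ?thesis using W st[OF f, of "''i''"] i by (auto simp: runs_NSet)
  qed
  note w = runs_weaken[OF _ _ order_refl]
  show ?thesis
    unfolding weight_com_def weight_time_def
    apply (rule runs_Seq[OF w[OF r1] order_refl])
    apply (rule runs_Seq[OF w[OF r2] order_refl], assumption)
    apply (rule runs_Seq[OF w[OF r3] order_refl], assumption)
    apply (rule runs_Seq[OF w[OF r4] order_refl], assumption)
    apply (rule runs_Seq[OF w[OF r5] order_refl], assumption)
    apply (rule r6, assumption)
    done
qed

definition weights_com :: "nat \<Rightarrow> com" where
  "weights_com k = For ''i'' (V ''n'') (weight_com k)"

lemma nmod_round [simp]: "nmod (round_com N D X st) = {''c'', ''wt''}"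
  by (auto simp: round_com_def)

lemma rmod_round [simp]: "rmod (round_com N D X st) = {}"
  by (auto simp: round_com_def)

lemma runs_weights:
  assumes inp: "inp n a b p s" and cst: "consts_set k n s"
    and tt: "\<And>i. i < n \<Longrightarrow> nats s ''tt'' i \<noteq> 0 \<longleftrightarrow> i \<in> kept k n (nats s ''g'')"
  shows "runs (weights_com k) s (for_time n (weight_time k n))
    (\<lambda>s'. (\<forall>i<n. (nats s' ''el'' i \<noteq> 0 \<longleftrightarrow> eligible a b p k n (nats s ''g'') i) \<and>
      nats s' ''w'' i = key a b p k n (nats s ''g'') i) \<and>
      same {''i'', ''el'', ''w'', ''wt'', ''s1'', ''s2'', ''c''} {''u'', ''al''} s s')"
proof -
  let ?X = "{''i'', ''el'', ''w'', ''wt'', ''s1'', ''s2'', ''c''}" and ?Y = "{''u'', ''al''}"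
  let ?I = "\<lambda>i s'. (\<forall>j<i. (nats s' ''el'' j \<noteq> 0 \<longleftrightarrow> eligible a b p k n (nats s ''g'') j) \<and>
      nats s' ''w'' j = key a b p k n (nats s ''g'') j) \<and> same ?X ?Y s s'"
  show ?thesis
    unfolding weights_com_def
  proof (rule runs_For[where I = ?I])
    fix i s1 assume iN: "i < n" and I: "?I i s1" and i: "nats s1 ''i'' 0 = i"
    have g: "nats s1 ''g'' = nats s ''g''" using I by (simp add: same_def)
    have 1: "inp n a b p s1" "consts_set k n s1" "nats s1 ''tt'' = nats s ''tt''"
      using I inp cst by (simp_all add: same_def inp_def consts_set_def)
    show "runs (weight_com k) s1 (weight_time k n) (\<lambda>s'. ?I (Suc i) (nupd ''i'' 0 (Suc i) s'))"
    proof (rule runs_weaken[OF runs_weight[OF 1(1,2) _ i] _ order_refl])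
      show "nats s1 ''tt'' i \<noteq> 0 \<longleftrightarrow> i \<in> kept k n (nats s1 ''g'')" using tt[OF iN] 1 g by simp
      fix s2 assume h: "(nats s2 ''el'' i \<noteq> 0 \<longleftrightarrow> eligible a b p k n (nats s1 ''g'') i) \<and>
        nats s2 ''w'' i = key a b p k n (nats s1 ''g'') i \<and>
        (\<forall>j. j \<noteq> i \<longrightarrow> nats s2 ''el'' j = nats s1 ''el'' j \<and> nats s2 ''w'' j = nats s1 ''w'' j) \<and>
        same {''el'', ''w'', ''wt'', ''s1'', ''s2'', ''c''} {''u'', ''al''} s1 s2"
      have "same ?X ?Y s s2"
        by (rule same_mono[OF same_trans[of ?X ?Y s s1 "{''el'', ''w'', ''wt'', ''s1'', ''s2'', ''c''}" ?Y]])
          (use h I in auto)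
      then show "?I (Suc i) (nupd ''i'' 0 (Suc i) s2)"
        using h I g by (auto simp: less_Suc_eq)
    qed
  qed (use inp in \<open>auto simp: same_def inp_def weight_com_def group_com_def eligible_com_def\<close>)
qed

section \<open>The dynamic program as a table in memory\<close>

definition cell ::
  "(nat \<Rightarrow> bool) \<Rightarrow> (nat \<Rightarrow> nat) \<Rightarrow> (nat \<Rightarrow> real) \<Rightarrow> nat \<Rightarrow> state \<Rightarrow> nat \<Rightarrow> nat \<Rightarrow> bool" where
  "cell e w v W s i c \<longleftrightarrow> (nats s ''ok'' (i * W + c) \<noteq> 0 \<longleftrightarrow> dp e w v i c \<noteq> None) \<and>
     (dp e w v i c \<noteq> None \<longrightarrow> reals s ''val'' (i * W + c) = fst (the (dp e w v i c)))"

text \<open>The decision on job \<open>i\<close> is stored in row \<open>Suc i\<close>, the row it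
  produces, and so shares its address with the new entry.\<close>

definition flag ::
  "(nat \<Rightarrow> bool) \<Rightarrow> (nat \<Rightarrow> nat) \<Rightarrow> (nat \<Rightarrow> real) \<Rightarrow> nat \<Rightarrow> state \<Rightarrow> nat \<Rightarrow> nat \<Rightarrow> bool" where
  "flag e w v W s i c \<longleftrightarrow> (nats s ''tk'' (Suc i * W + c) \<noteq> 0 \<longleftrightarrow> taken e w v i c)"

text \<open>The variable \<open>off\<close> holds the start \<open>i * W\<close> of the current row,
  which saves a multiplication of indices.\<close>

definition src :: nexp where "src = NAdd (V ''off'') (V ''j'')"
definition dst :: nexp where "dst = NAdd (NAdd (V ''off'') (V ''W'')) (V ''j'')"
text \<open>If the weight exceeds the column, this address no longer lies in the current row as
  intended; \<open>take_cond\<close> is then false by its second conjunct, whatever is read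
  there.\<close>

definition pre :: nexp where "pre = NSub src (NGet ''w'' (V ''i''))"

definition take_cond :: bexp where
  "take_cond = BAnd (NLess (NConst 0) (NGet ''el'' (V ''i'')))
     (BAnd (BNot (NLess (V ''j'') (NGet ''w'' (V ''i''))))
     (BAnd (NLess (NConst 0) (NGet ''ok'' pre))
       (BNot (BAnd (NLess (NConst 0) (NGet ''ok'' src))
         (BNot (RLess (RAdd (RGet ''val'' pre) (R ''mx'')) (RGet ''val'' src)))))))"

definition cell_com :: com where
  "cell_com = Cond take_cond
     (Seq (NSet ''ok'' dst (NConst 1)) (Seq (RSet ''val'' dst (RAdd (RGet ''val'' pre) (R ''mx'')))
       (NSet ''tk'' dst (NConst 1))))
     (Seq (NSet ''ok'' dst (NGet ''ok'' src)) (Seq (RSet ''val'' dst (RGet ''val'' src))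
       (NSet ''tk'' dst (NConst 0))))"

lemma runs_cell:
  assumes "nats s ''off'' 0 = i * W" "nats s ''W'' 0 = W" "nats s ''j'' 0 = j" "nats s ''i'' 0 = i"
    and j: "j < W" and cells: "\<And>c. c < W \<Longrightarrow> cell e w v W s i c"
    and el: "nats s ''el'' i \<noteq> 0 \<longleftrightarrow> e i" and w: "nats s ''w'' i = w i" and mx: "reals s ''mx'' 0 = v i"
  shows "runs cell_com s 130 (\<lambda>s'. cell e w v W s' (Suc i) j \<and> flag e w v W s' i j \<and>
    (\<forall>l. l \<noteq> Suc i * W + j \<longrightarrow> nats s' ''ok'' l = nats s ''ok'' l \<and> nats s' ''tk'' l = nats s ''tk'' l \<and>
      reals s' ''val'' l = reals s ''val'' l) \<and> same {''ok'', ''tk''} {''val''} s s')"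
proof -
  have dstv: "nval dst s = Suc i * W + j" using assms by (simp add: dst_def)
  have srcv: "nval src s = i * W + j" using assms by (simp add: src_def)
  have prev: "nval pre s = i * W + (j - w i)" if "w i \<le> j"
    using assms that by (simp add: pre_def src_def)
  have b: "bval take_cond s \<longleftrightarrow> taken e w v i j"
  proof (cases "w i \<le> j")
    case False
    then show ?thesis using assms by (simp add: take_cond_def taken.simps)
  next
    case True
    have c1: "cell e w v W s i (j - w i)" "cell e w v W s i j" using cells j by auto
    show ?thesis
      using True c1 assms(1-4) el w mx srcv prev[OF True]
      by (auto simp: take_cond_def taken.simps cell_def not_less)
  qed
  have cost: "ncost dst = 8" "ncost src = 5" "ncost pre = 9" "bcost take_cond \<le> 80"
    by (simp_all add: dst_def src_def pre_def take_cond_def)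
  show ?thesis
  proof (cases "taken e w v i j")
    case True
    then have wj: "w i \<le> j" and dn: "dp e w v i (j - w i) \<noteq> None" by (auto simp: taken.simps)
    have c1: "cell e w v W s i (j - w i)" using cells j by auto
    let ?s1 = "nupd ''ok'' (Suc i * W + j) 1 s"
    let ?s2 = "rupd ''val'' (Suc i * W + j) (reals s ''val'' (i * W + (j - w i)) + v i) ?s1"
    have v1: "nval dst ?s1 = Suc i * W + j" "nval pre ?s1 = i * W + (j - w i)" "nval dst ?s2 = Suc i * W + j"
      using assms wj by (simp_all add: dst_def pre_def src_def)
    have "runs cell_com s 130 (\<lambda>s'. s' = nupd ''tk'' (Suc i * W + j) 1 ?s2)"
      using b True cost dstv v1 mx unfolding cell_com_def by (auto simp: runs_simps)
    then show ?thesis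
      by (rule runs_weaken) (use True c1 dn in \<open>auto simp: cell_def flag_def\<close>)
  next
    case False
    have c1: "cell e w v W s i j" using cells j by auto
    let ?s1 = "nupd ''ok'' (Suc i * W + j) (nats s ''ok'' (i * W + j)) s"
    let ?s2 = "rupd ''val'' (Suc i * W + j) (reals s ''val'' (i * W + j)) ?s1"
    have v1: "nval dst ?s1 = Suc i * W + j" "nval src ?s1 = i * W + j" "nval dst ?s2 = Suc i * W + j"
      using assms by (simp_all add: dst_def src_def)
    have "runs cell_com s 130 (\<lambda>s'. s' = nupd ''tk'' (Suc i * W + j) 0 ?s2)"
      using b False cost dstv srcv v1 unfolding cell_com_def by (auto simp: runs_simps)
    then show ?thesis
      by (rule runs_weaken) (use False c1 in \<open>auto simp: cell_def flag_def\<close>)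
  qed
qed

definition row_com :: com where
  "row_com = Seq (Cond (RLess (RGet ''b'' (V ''i'')) (RGet ''a'' (V ''i'')))
       (RSet ''mx'' (NConst 0) (RGet ''a'' (V ''i'')))
       (RSet ''mx'' (NConst 0) (RGet ''b'' (V ''i''))))
     (Seq (For ''j'' (V ''W'') cell_com) (NSet ''off'' (NConst 0) (NAdd (V ''off'') (V ''W''))))"

lemma nmod_cell [simp]: "nmod cell_com = {''ok'', ''tk''}"
  by (auto simp: cell_com_def)

lemma rmod_cell [simp]: "rmod cell_com = {''val''}"
  by (auto simp: cell_com_def)

text \<open>One pass writes to the three tables only from address \<open>Suc i * W\<close> on, so
  the row being read stays intact, as do the decisions of all earlier rows.\<close>

lemma runs_row:
  assumes ab: "reals s ''a'' = a" "reals s ''b'' = b"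
    and idx: "nats s ''off'' 0 = i * W" "nats s ''W'' 0 = W" "nats s ''i'' 0 = i"
    and cells: "\<And>c. c < W \<Longrightarrow> cell e w (hi a b) W s i c"
    and el: "nats s ''el'' i \<noteq> 0 \<longleftrightarrow> e i" and w: "nats s ''w'' i = w i"
  shows "runs row_com s (20 + (for_time W 130 + 7)) (\<lambda>s'. nats s' ''off'' 0 = Suc i * W \<and>
    (\<forall>c<W. cell e w (hi a b) W s' (Suc i) c \<and> flag e w (hi a b) W s' i c) \<and>
    (\<forall>l<Suc i * W. nats s' ''tk'' l = nats s ''tk'' l) \<and>
    same {''ok'', ''tk'', ''j'', ''off''} {''val'', ''mx''} s s')"
proof -
  let ?v = "hi a b"
  let ?X = "{''ok'', ''tk'', ''j''}" and ?Y = "{''val'', ''mx''}"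
  let ?I = "\<lambda>j s'. (\<forall>c<j. cell e w ?v W s' (Suc i) c \<and> flag e w ?v W s' i c) \<and>
    (\<forall>l<Suc i * W. nats s' ''ok'' l = nats s ''ok'' l \<and> nats s' ''tk'' l = nats s ''tk'' l \<and>
      reals s' ''val'' l = reals s ''val'' l) \<and> reals s' ''mx'' 0 = ?v i \<and> same ?X ?Y s s'"
  let ?M = "\<lambda>s'. reals s' ''mx'' 0 = ?v i \<and> nats s' = nats s \<and> reals s' ''val'' = reals s ''val'' \<and>
    same {} ?Y s s'"
  have r1: "runs (Cond (RLess (RGet ''b'' (V ''i'')) (RGet ''a'' (V ''i'')))
       (RSet ''mx'' (NConst 0) (RGet ''a'' (V ''i'')))
       (RSet ''mx'' (NConst 0) (RGet ''b'' (V ''i'')))) s 20 ?M"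
    using ab idx by (auto simp: runs_simps hi_def)
  have r2: "runs (For ''j'' (V ''W'') cell_com) s1 (for_time W 130) (?I W)" if M: "?M s1" for s1
  proof (rule runs_For[where I = ?I])
    show "?I 0 (nupd ''j'' 0 0 s1)" using M by (auto simp: same_def)
  next
    fix j s2 assume jW: "j < W" and I: "?I j s2" and j: "nats s2 ''j'' 0 = j"
    have st: "nats s2 x = nats s x" if "x \<notin> ?X" for x using I that by (simp add: same_def)
    have lt: "i * W + c < Suc i * W" if "c < W" for c using that by simp
    have cells2: "cell e w ?v W s2 i c" if "c < W" for c
      using cells[OF that] I lt[OF that] unfolding cell_def by simp
    have "runs cell_com s2 130 (\<lambda>s'. cell e w ?v W s' (Suc i) j \<and> flag e w ?v W s' i j \<and>
      (\<forall>l. l \<noteq> Suc i * W + j \<longrightarrow> nats s' ''ok'' l = nats s2 ''ok'' l \<and> nats s' ''tk'' l = nats s2 ''tk'' l \<and>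
        reals s' ''val'' l = reals s2 ''val'' l) \<and> same {''ok'', ''tk''} {''val''} s2 s')"
      by (rule runs_cell[OF _ _ j _ jW cells2]) (use idx el w I st in auto)
    then show "runs cell_com s2 130 (\<lambda>s'. ?I (Suc j) (nupd ''j'' 0 (Suc j) s'))"
    proof (rule runs_weaken[OF _ _ order_refl])
      fix s3 assume h: "cell e w ?v W s3 (Suc i) j \<and> flag e w ?v W s3 i j \<and>
        (\<forall>l. l \<noteq> Suc i * W + j \<longrightarrow> nats s3 ''ok'' l = nats s2 ''ok'' l \<and> nats s3 ''tk'' l = nats s2 ''tk'' l \<and>
          reals s3 ''val'' l = reals s2 ''val'' l) \<and> same {''ok'', ''tk''} {''val''} s2 s3"
      have "same ?X ?Y s s3"
        by (rule same_mono[OF same_trans[of ?X ?Y s s2 "{''ok'', ''tk''}" "{''val''}"]]) (use h I in auto)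
      moreover have "reals s3 ''mx'' 0 = ?v i" using h I by (simp add: same_def)
      moreover have "cell e w ?v W s3 (Suc i) c \<and> flag e w ?v W s3 i c" if "c < Suc j" for c
      proof (cases "c = j")
        case False
        then have "Suc i * W + c \<noteq> Suc i * W + j" "c < j" using that by auto
        then show ?thesis using h I unfolding cell_def flag_def by metis
      qed (use h in simp)
      moreover have "nats s3 ''ok'' l = nats s ''ok'' l \<and> nats s3 ''tk'' l = nats s ''tk'' l \<and>
          reals s3 ''val'' l = reals s ''val'' l" if "l < Suc i * W" for l
        using h I that by auto
      ultimately show "?I (Suc j) (nupd ''j'' 0 (Suc j) s3)"
        unfolding cell_def flag_def by simp
    qed
  next
    fix j s2 assume I: "?I j s2"
    then have "nats s2 ''W'' = nats s ''W''" by (simp add: same_def)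
    then show "nval (V ''W'') s2 = W" using idx by simp
  qed simp_all
  have r3: "runs (NSet ''off'' (NConst 0) (NAdd (V ''off'') (V ''W''))) s2 7
    (\<lambda>s'. nats s' ''off'' 0 = Suc i * W \<and>
    (\<forall>c<W. cell e w ?v W s' (Suc i) c \<and> flag e w ?v W s' i c) \<and>
    (\<forall>l<Suc i * W. nats s' ''tk'' l = nats s ''tk'' l) \<and>
    same {''ok'', ''tk'', ''j'', ''off''} {''val'', ''mx''} s s')" if I: "?I W s2" for s2
  proof -
    have "nats s2 ''W'' = nats s ''W''" "nats s2 ''off'' = nats s ''off''"
      using I by (simp_all add: same_def)
    moreover have "same {''ok'', ''tk'', ''j'', ''off''} {''val'', ''mx''} s s2"
      using I by (auto intro: same_mono)
    ultimately show ?thesis using I idx by (simp add: runs_NSet cell_def flag_def)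
  qed
  note w = runs_weaken[OF _ _ order_refl]
  show ?thesis
    unfolding row_com_def
    apply (rule runs_Seq[OF w[OF r1] order_refl])
    apply (rule runs_Seq[OF w[OF r2] order_refl], assumption)
    apply (rule r3, assumption)
    done
qed

text \<open>The arrays still hold the rows of the previous guess. Clearing row 0 is enough, since
  every later row is overwritten in full.\<close>

definition table_com :: com where
  "table_com = Seq (For ''j'' (V ''W'') (NSet ''ok'' (V ''j'') (NConst 0)))
     (Seq (Seq (NSet ''ok'' (NConst 0) (NConst 1)) (Seq (RSet ''val'' (NConst 0) (RNat (NConst 0)))
       (NSet ''off'' (NConst 0) (NConst 0))))
     (For ''i'' (V ''n'') row_com))"

definition table_time :: "nat \<Rightarrow> nat \<Rightarrow> nat" where
  "table_time n W = for_time W 4 + (20 + for_time n (20 + (for_time W 130 + 7)))"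

text \<open>The last row of values names the candidates; the decisions of all rows are needed to
  rebuild their sets.\<close>

definition table :: "(nat \<Rightarrow> bool) \<Rightarrow> (nat \<Rightarrow> nat) \<Rightarrow> (nat \<Rightarrow> real) \<Rightarrow> nat \<Rightarrow> nat \<Rightarrow> state \<Rightarrow> bool" where
  "table e w v n W s \<longleftrightarrow> nats s ''off'' 0 = n * W \<and> (\<forall>c<W. cell e w v W s n c) \<and>
     (\<forall>i<n. \<forall>c<W. flag e w v W s i c)"

lemma nmod_row [simp]: "nmod row_com = {''ok'', ''tk'', ''j'', ''off''}"
  by (auto simp: row_com_def)

lemma rmod_row [simp]: "rmod row_com = {''val'', ''mx''}"
  by (auto simp: row_com_def)

lemma runs_table:
  assumes ab: "reals s ''a'' = a" "reals s ''b'' = b"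
    and nW: "nats s ''n'' 0 = n" "nats s ''W'' 0 = W" "0 < W"
    and el: "\<And>i. i < n \<Longrightarrow> nats s ''el'' i \<noteq> 0 \<longleftrightarrow> e i"
    and w: "\<And>i. i < n \<Longrightarrow> nats s ''w'' i = w i"
  shows "runs table_com s (table_time n W) (\<lambda>s'. table e w (hi a b) n W s' \<and>
    same {''ok'', ''tk'', ''j'', ''off'', ''i''} {''val'', ''mx''} s s')"
proof -
  let ?v = "hi a b"
  let ?X = "{''ok'', ''tk'', ''j'', ''off'', ''i''}" and ?Y = "{''val'', ''mx''}"
  let ?I = "\<lambda>i s'. table e w ?v i W s' \<and> same ?X ?Y s s'"
  let ?Z = "\<lambda>s'. (\<forall>c<W. nats s' ''ok'' c = 0) \<and> same ?X ?Y s s'"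
  let ?T = "\<lambda>s'. table e w ?v 0 W s' \<and> same ?X ?Y s s'"
  have r1: "runs (For ''j'' (V ''W'') (NSet ''ok'' (V ''j'') (NConst 0))) s (for_time W 4) ?Z"
    by (rule runs_For[where I = "\<lambda>j s'. (\<forall>c<j. nats s' ''ok'' c = 0) \<and> same ?X ?Y s s'"])
      (use nW in \<open>auto simp: runs_NSet less_Suc_eq same_def\<close>)
  have r2: "runs (Seq (NSet ''ok'' (NConst 0) (NConst 1)) (Seq (RSet ''val'' (NConst 0) (RNat (NConst 0)))
       (NSet ''off'' (NConst 0) (NConst 0)))) s1 20 ?T" if "?Z s1" for s1
    using that by (auto simp: runs_simps table_def cell_def)
  have r3: "runs (For ''i'' (V ''n'') row_com) s2 (for_time n (20 + (for_time W 130 + 7))) (?I n)"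
    if T: "?T s2" for s2
  proof (rule runs_For[where I = ?I])
    show "?I 0 (nupd ''i'' 0 0 s2)" using T by (simp add: table_def cell_def)
  next
    fix i s3 assume iN: "i < n" and I: "?I i s3" and i: "nats s3 ''i'' 0 = i"
    have st: "nats s3 x = nats s x" if "x \<notin> ?X" for x using I that by (simp add: same_def)
    have rt: "reals s3 x = reals s x" if "x \<notin> ?Y" for x using I that by (simp add: same_def)
    have "runs row_com s3 (20 + (for_time W 130 + 7)) (\<lambda>s'. nats s' ''off'' 0 = Suc i * W \<and>
      (\<forall>c<W. cell e w ?v W s' (Suc i) c \<and> flag e w ?v W s' i c) \<and>
      (\<forall>l<Suc i * W. nats s' ''tk'' l = nats s3 ''tk'' l) \<and>
      same {''ok'', ''tk'', ''j'', ''off''} {''val'', ''mx''} s3 s')"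
      by (rule runs_row[OF _ _ _ _ i]) (use I ab nW el[OF iN] w[OF iN] st rt in \<open>auto simp: table_def\<close>)
    then show "runs row_com s3 (20 + (for_time W 130 + 7)) (\<lambda>s'. ?I (Suc i) (nupd ''i'' 0 (Suc i) s'))"
    proof (rule runs_weaken[OF _ _ order_refl])
      fix s4 assume h: "nats s4 ''off'' 0 = Suc i * W \<and>
        (\<forall>c<W. cell e w ?v W s4 (Suc i) c \<and> flag e w ?v W s4 i c) \<and>
        (\<forall>l<Suc i * W. nats s4 ''tk'' l = nats s3 ''tk'' l) \<and>
        same {''ok'', ''tk'', ''j'', ''off''} {''val'', ''mx''} s3 s4"
      have s: "same ?X ?Y s s4"
        by (rule same_mono[OF same_trans[of ?X ?Y s s3 "{''ok'', ''tk'', ''j'', ''off''}" ?Y]])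
          (use h I in auto)
      have "flag e w ?v W s4 i' c" if "i' < Suc i" "c < W" for i' c
      proof (cases "i' = i")
        case False
        then have "Suc i' * W \<le> i * W" using that by (intro mult_le_mono1) simp
        then have "Suc i' * W + c < Suc i * W" using that by simp
        then have "nats s4 ''tk'' (Suc i' * W + c) = nats s3 ''tk'' (Suc i' * W + c)" using h by blast
        then show ?thesis using I that False unfolding table_def flag_def by simp
      qed (use h that in simp)
      then show "?I (Suc i) (nupd ''i'' 0 (Suc i) s4)"
        using h s by (simp add: table_def cell_def flag_def)
    qed
  next
    fix i s3 assume "?I i s3"
    then have "nats s3 ''n'' = nats s ''n''" by (simp add: same_def)
    then show "nval (V ''n'') s3 = n" using nW by simp
  qed simp_all
  note w = runs_weaken[OF _ _ order_refl]
  show ?thesis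
    unfolding table_com_def table_time_def
    apply (rule runs_Seq[OF w[OF r1] order_refl])
    apply (rule runs_Seq[OF w[OF r2] order_refl], assumption)
    apply (rule r3, assumption)
    done
qed

section \<open>Rebuilding the chosen set from the decisions\<close>

definition trace_com :: com where
  "trace_com = Seq (NSet ''i'' (NConst 0) (NSub (NSub (V ''n'') (V ''t'')) (NConst 1)))
     (Seq (Cond (NLess (NConst 0) (NGet ''tk'' (NAdd (V ''o'') (V ''cur''))))
       (Seq (NSet ''cs'' (V ''i'') (NConst 1))
         (NSet ''cur'' (NConst 0) (NSub (V ''cur'') (NGet ''w'' (V ''i''))))) Skip)
     (NSet ''o'' (NConst 0) (NSub (V ''o'') (V ''W''))))"

definition back_com :: com where
  "back_com = Seq (For ''i'' (V ''n'') (NSet ''cs'' (V ''i'') (NGet ''tt'' (V ''i''))))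
     (Seq (Seq (NSet ''cur'' (NConst 0) (V ''j'')) (NSet ''o'' (NConst 0) (V ''off'')))
     (For ''t'' (V ''n'') trace_com))"

text \<open>The walk starts at the last row, so round \<open>t\<close> of the upward counting loop
  treats job \<open>n - t - 1\<close>. The entry in row \<open>n - t\<close> and the current column
  always holds the part of \<open>S\<close> not yet written, hence each bit is read where the
  specification decided.\<close>

lemma runs_back:
  assumes nW: "nats s ''n'' 0 = n" "nats s ''W'' 0 = W" and tab: "table e w v n W s"
    and w: "\<And>i. i < n \<Longrightarrow> nats s ''w'' i = w i"
    and j: "nats s ''j'' 0 = c" "c < W" and d: "dp e w v n c = Some (x, S)"
  shows "runs back_com s (for_time n 6 + (10 + for_time n 60)) (\<lambda>s'.
    (\<forall>i<n. nats s' ''cs'' i \<noteq> 0 \<longleftrightarrow> nats s ''tt'' i \<noteq> 0 \<or> i \<in> S) \<and>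
    same {''i'', ''cs'', ''cur'', ''o'', ''t''} {} s s')"
proof -
  let ?X = "{''i'', ''cs'', ''cur'', ''o'', ''t''}"
  let ?A = "\<lambda>s'. (\<forall>i<n. nats s' ''cs'' i = nats s ''tt'' i) \<and> same ?X {} s s'"
  let ?B = "\<lambda>s'. (\<forall>i<n. nats s' ''cs'' i = nats s ''tt'' i) \<and> nats s' ''cur'' 0 = c \<and>
    nats s' ''o'' 0 = n * W \<and> same ?X {} s s'"
  let ?I = "\<lambda>t s'. t \<le> n \<and> (\<forall>i<n. nats s' ''cs'' i \<noteq> 0 \<longleftrightarrow> nats s ''tt'' i \<noteq> 0 \<or> i \<in> S \<and> n - t \<le> i) \<and>
    nats s' ''o'' 0 = (n - t) * W \<and> nats s' ''cur'' 0 < W \<and>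
    (\<exists>y. dp e w v (n - t) (nats s' ''cur'' 0) = Some (y, {i\<in>S. i < n - t})) \<and> same ?X {} s s'"
  have Sn: "S \<subseteq> {..<n}" using dp_sound[OF d] by auto
  have r1: "runs (For ''i'' (V ''n'') (NSet ''cs'' (V ''i'') (NGet ''tt'' (V ''i'')))) s (for_time n 6) ?A"
    by (rule runs_For[where I = "\<lambda>i s'. (\<forall>l<i. nats s' ''cs'' l = nats s ''tt'' l) \<and> same ?X {} s s'"])
      (use nW in \<open>auto simp: runs_NSet less_Suc_eq same_def\<close>)
  have r2: "runs (Seq (NSet ''cur'' (NConst 0) (V ''j'')) (NSet ''o'' (NConst 0) (V ''off''))) s1 10 ?B"
    if A: "?A s1" for s1
  proof -
    have "nats s1 ''j'' = nats s ''j''" "nats s1 ''off'' = nats s ''off''"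
      using A by (simp_all add: same_def)
    then show ?thesis using A j tab by (simp add: runs_simps table_def)
  qed
  have r3: "runs (For ''t'' (V ''n'') trace_com) s2 (for_time n 60) (?I n)" if B: "?B s2" for s2
  proof (rule runs_For[where I = ?I])
    have "{i \<in> S. i < n} = S" using Sn by auto
    then show "?I 0 (nupd ''t'' 0 0 s2)" using B d j Sn by auto
  next
    fix t s3 assume tN: "t < n" and I: "?I t s3" and t: "nats s3 ''t'' 0 = t"
    define m where "m = n - Suc t"
    have m: "n - t = Suc m" "m < n" "n - Suc t = m" using tN by (auto simp: m_def)
    obtain y where y: "dp e w v (Suc m) (nats s3 ''cur'' 0) = Some (y, {i\<in>S. i < Suc m})"
      using I m by auto
    have st: "nats s3 x = nats s x" if "x \<notin> ?X" for x using I that by (simp add: same_def)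
    have f: "nats s3 ''tk'' (Suc m * W + nats s3 ''cur'' 0) \<noteq> 0 \<longleftrightarrow> taken e w v m (nats s3 ''cur'' 0)"
      using tab I m st unfolding table_def flag_def by simp
    have v: "nats s3 ''n'' 0 = n" "nats s3 ''W'' 0 = W" "nats s3 ''w'' m = w m" "nats s3 ''o'' 0 = Suc m * W"
      using st nW w[OF m(2)] I m by auto
    show "runs trace_com s3 60 (\<lambda>s'. ?I (Suc t) (nupd ''t'' 0 (Suc t) s'))"
    proof (cases "taken e w v m (nats s3 ''cur'' 0)")
      case True
      then obtain z Q where Q: "dp e w v m (nats s3 ''cur'' 0 - w m) = Some (z, Q)"
        "{i\<in>S. i < Suc m} = insert m Q" using y by auto
      have Qm: "Q \<subseteq> {..<m}" using dp_sound[OF Q(1)] by auto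
      have mS: "m \<in> S" using Q(2) by blast
      have Qeq: "{i\<in>S. i < m} = Q" using Q(2) Qm by (auto simp: less_Suc_eq)
      have "runs trace_com s3 60 (\<lambda>s'. s' = nupd ''o'' 0 (m * W)
        (nupd ''cur'' 0 (nats s3 ''cur'' 0 - w m) (nupd ''cs'' m 1 (nupd ''i'' 0 m s3))))"
        using True f v t m tN unfolding trace_com_def by (simp add: runs_simps)
      then show ?thesis
        by (rule runs_weaken) (use I m tN Q(1) Qeq mS in \<open>auto simp: Suc_le_eq not_less le_less_Suc_eq\<close>)
    next
      case False
      have y': "dp e w v m (nats s3 ''cur'' 0) = Some (y, {i\<in>S. i < Suc m})" using y False by simp
      then have "{i\<in>S. i < Suc m} \<subseteq> {..<m}" using dp_sound[OF y'] by auto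
      then have mS: "m \<notin> S" by auto
      have Qeq: "{i\<in>S. i < Suc m} = {i\<in>S. i < m}" using mS by (auto simp: less_Suc_eq)
      have "runs trace_com s3 60 (\<lambda>s'. s' = nupd ''o'' 0 (m * W) (nupd ''i'' 0 m s3))"
        using False f v t m tN unfolding trace_com_def by (simp add: runs_simps)
      then show ?thesis
      proof (rule runs_weaken)
        fix s' assume s': "s' = nupd ''o'' 0 (m * W) (nupd ''i'' 0 m s3)"
        have "(i \<in> S \<and> Suc m \<le> i) \<longleftrightarrow> (i \<in> S \<and> m \<le> i)" for i
          using mS by (metis Suc_le_eq le_neq_implies_less less_imp_le)
        then show "?I (Suc t) (nupd ''t'' 0 (Suc t) s')"
          using I m tN y' unfolding s' Qeq by simp
      qed simp
    qed
  next
    fix t s3 assume "?I t s3"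
    then have "nats s3 ''n'' = nats s ''n''" by (simp add: same_def)
    then show "nval (V ''n'') s3 = n" using nW by simp
  qed (auto simp: trace_com_def)
  note w = runs_weaken[OF _ _ order_refl]
  show ?thesis
    unfolding back_com_def
    apply (rule runs_Seq[OF w[OF r1] order_refl])
    apply (rule runs_Seq[OF w[OF r2] order_refl], assumption)
    apply (rule w[OF r3], assumption)
    apply simp
    done
qed

section \<open>Testing a candidate exactly\<close>

definition bor :: "bexp \<Rightarrow> bexp \<Rightarrow> bexp" where
  "bor c d = BNot (BAnd (BNot c) (BNot d))"

definition bef_test :: "vname \<Rightarrow> vname \<Rightarrow> bexp" where
  "bef_test x y = bor
     (BAnd (early x) (bor (BNot (early y)) (bor (RLess (RGet ''a'' (V x)) (RGet ''a'' (V y)))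
       (BAnd (BNot (RLess (RGet ''a'' (V y)) (RGet ''a'' (V x)))) (NLess (V x) (V y))))))
     (BAnd (BNot (early x)) (BAnd (BNot (early y)) (bor (RLess (RGet ''b'' (V y)) (RGet ''b'' (V x)))
       (BAnd (BNot (RLess (RGet ''b'' (V x)) (RGet ''b'' (V y)))) (NLess (V y) (V x))))))"

lemma bval_bef_test:
  "bval (bef_test x y) s \<longleftrightarrow> bef (reals s ''a'') (reals s ''b'') (nats s x 0) (nats s y 0)"
  unfolding bef_test_def early_def bor_def bef_def by (simp add: not_less) linarith

lemma bcost_bef_test: "bcost (bef_test x y) \<le> 120"
  by (simp add: bef_test_def early_def bor_def)

definition scan_com :: com where
  "scan_com = Cond (NLess (NConst 0) (NGet ''cs'' (V ''i'')))
     (Cond (bef_test ''i'' ''l'')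
       (RSet ''sx'' (NConst 0) (RAdd (R ''sx'') (RGet ''a'' (V ''i''))))
       (Cond (bef_test ''l'' ''i'')
         (RSet ''sy'' (NConst 0) (RSub (R ''sy'') (RGet ''b'' (V ''i'')))) Skip)) Skip"

lemma before_sum_insert:
  assumes "finite S" "i \<notin> S"
  shows "before_sum a b (insert i S) l = (if bef a b i l then a i else 0) + before_sum a b S l"
proof -
  have "{x \<in> insert i S. bef a b x l} =
    (if bef a b i l then insert i {x\<in>S. bef a b x l} else {x\<in>S. bef a b x l})" by auto
  then show ?thesis using assms by (simp add: before_sum_def)
qed

lemma after_sum_insert:
  assumes "finite S" "i \<notin> S"
  shows "after_sum a b (insert i S) l = (if bef a b l i then b i else 0) + after_sum a b S l"
proof -
  have "{x \<in> insert i S. bef a b l x} =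
    (if bef a b l i then insert i {x\<in>S. bef a b l x} else {x\<in>S. bef a b l x})" by auto
  then show ?thesis using assms by (simp add: after_sum_def)
qed

lemma runs_scan:
  assumes ab: "reals s ''a'' = a" "reals s ''b'' = b" and n: "nats s ''n'' 0 = n"
    and l: "nats s ''l'' 0 = l" and C: "C = {i. i < n \<and> nats s ''cs'' i \<noteq> 0}"
    and s0: "reals s ''sx'' 0 = 0" "reals s ''sy'' 0 = 1 - b l"
  shows "runs (For ''i'' (V ''n'') scan_com) s (for_time n 300) (\<lambda>s'.
    reals s' ''sx'' 0 = before_sum a b C l \<and> reals s' ''sy'' 0 = 1 - b l - after_sum a b C l \<and>
    same {''i''} {''sx'', ''sy''} s s')"
proof -
  let ?I = "\<lambda>i s'. reals s' ''sx'' 0 = before_sum a b (C \<inter> {..<i}) l \<and>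
    reals s' ''sy'' 0 = 1 - b l - after_sum a b (C \<inter> {..<i}) l \<and> same {''i''} {''sx'', ''sy''} s s'"
  have Cn: "C \<inter> {..<n} = C" using C by auto
  have "runs (For ''i'' (V ''n'') scan_com) s (for_time n 300) (?I n)"
  proof (rule runs_For[where I = ?I])
    show "?I 0 (nupd ''i'' 0 0 s)" using s0 by (simp add: before_sum_def after_sum_def)
  next
    fix i s1 assume iN: "i < n" and I: "?I i s1" and i: "nats s1 ''i'' 0 = i"
    have f: "reals s1 ''a'' = a" "reals s1 ''b'' = b" "nats s1 ''l'' 0 = l" "nats s1 ''cs'' = nats s ''cs''"
      using I ab l by (simp_all add: same_def)
    have b1: "bval (bef_test ''i'' ''l'') s1 \<longleftrightarrow> bef a b i l" "bval (bef_test ''l'' ''i'') s1 \<longleftrightarrow> bef a b l i"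
      using f i by (simp_all add: bval_bef_test)
    have c: "bcost (bef_test ''i'' ''l'') \<le> 120" "bcost (bef_test ''l'' ''i'') \<le> 120"
      by (rule bcost_bef_test)+
    show "runs scan_com s1 300 (\<lambda>s'. ?I (Suc i) (nupd ''i'' 0 (Suc i) s'))"
    proof (cases "i \<in> C")
      case False
      then have "C \<inter> {..<Suc i} = C \<inter> {..<i}" by (auto simp: less_Suc_eq)
      moreover have "nats s1 ''cs'' i = 0" using False iN C f by auto
      ultimately show ?thesis using I i unfolding scan_com_def by (simp add: runs_simps)
    next
      case True
      then have Ci: "C \<inter> {..<Suc i} = insert i (C \<inter> {..<i})" by (auto simp: less_Suc_eq)
      have "nats s1 ''cs'' i \<noteq> 0" using True C f by auto
      then show ?thesis
        using I i b1 f c bef_asym[of a b i l] unfolding scan_com_def Ci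
        by (auto simp: runs_simps before_sum_insert after_sum_insert)
    qed
  next
    fix i s1 assume "?I i s1"
    then have "nats s1 ''n'' = nats s ''n''" by (simp add: same_def)
    then show "nval (V ''n'') s1 = n" using n by simp
  qed (auto simp: scan_com_def)
  then show ?thesis unfolding Cn .
qed

text \<open>The start times are needed for the output; comparing them is already the load test, so
  no load is ever computed on its own.\<close>

definition check1_com :: com where
  "check1_com = Cond (NLess (NConst 0) (NGet ''cs'' (V ''l'')))
     (Seq (Seq (RSet ''sx'' (NConst 0) (RNat (NConst 0)))
       (RSet ''sy'' (NConst 0) (RSub (RNat (NConst 1)) (RGet ''b'' (V ''l'')))))
     (Seq (For ''i'' (V ''n'') scan_com)
     (Seq (RSet ''X'' (V ''l'') (R ''sx'')) (Seq (RSet ''Y'' (V ''l'') (R ''sy''))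
     (Seq (RSet ''pr'' (NConst 0) (RAdd (R ''pr'') (RGet ''p'' (V ''l''))))
       (Cond (RLess (R ''sy'') (RAdd (R ''sx'') (RGet ''a'' (V ''l''))))
         (NSet ''good'' (NConst 0) (NConst 0)) Skip)))))) Skip"

definition check_com :: com where
  "check_com = Seq (Seq (NSet ''good'' (NConst 0) (NConst 1)) (RSet ''pr'' (NConst 0) (RNat (NConst 0))))
     (For ''l'' (V ''n'') check1_com)"

lemma nmod_scan [simp]: "nmod scan_com = {}"
  by (auto simp: scan_com_def)

lemma rmod_scan [simp]: "rmod scan_com = {''sx'', ''sy''}"
  by (auto simp: scan_com_def)

lemma runs_check:
  assumes inp: "inp n a b p s" and C: "C = {i. i < n \<and> nats s ''cs'' i \<noteq> 0}"
  shows "runs check_com s (10 + for_time n (10 + (20 + (for_time n 300 + 60)))) (\<lambda>s'.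
    (nats s' ''good'' 0 \<noteq> 0 \<longleftrightarrow> (\<forall>l\<in>C. load a b C l \<le> 1)) \<and> reals s' ''pr'' 0 = sum p C \<and>
    (\<forall>l\<in>C. reals s' ''X'' l = before_sum a b C l \<and> reals s' ''Y'' l = 1 - b l - after_sum a b C l) \<and>
    same {''good'', ''l'', ''i''} {''pr'', ''sx'', ''sy'', ''X'', ''Y''} s s')"
proof -
  let ?X = "{''good'', ''l'', ''i''}" and ?Y = "{''pr'', ''sx'', ''sy'', ''X'', ''Y''}"
  let ?I = "\<lambda>m s'. (nats s' ''good'' 0 \<noteq> 0 \<longleftrightarrow> (\<forall>l\<in>C. l < m \<longrightarrow> load a b C l \<le> 1)) \<and>
    reals s' ''pr'' 0 = sum p (C \<inter> {..<m}) \<and>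
    (\<forall>l\<in>C. l < m \<longrightarrow> reals s' ''X'' l = before_sum a b C l \<and>
      reals s' ''Y'' l = 1 - b l - after_sum a b C l) \<and> same ?X ?Y s s'"
  have Cn: "C \<inter> {..<n} = C" "\<And>l. l \<in> C \<Longrightarrow> l < n" and finC: "finite C" using C by auto
  have r1: "runs (Seq (NSet ''good'' (NConst 0) (NConst 1)) (RSet ''pr'' (NConst 0) (RNat (NConst 0))))
      s 10 (?I 0)"
    by (simp add: runs_simps)
  have r2: "runs (For ''l'' (V ''n'') check1_com) s1 (for_time n (10 + (20 + (for_time n 300 + 60)))) (?I n)"
    if I0: "?I 0 s1" for s1
  proof (rule runs_For[where I = ?I])
    show "?I 0 (nupd ''l'' 0 0 s1)" using I0 by simp
  next
    fix l s2 assume lN: "l < n" and I: "?I l s2" and l: "nats s2 ''l'' 0 = l"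
    have f: "reals s2 ''a'' = a" "reals s2 ''b'' = b" "reals s2 ''p'' = p" "nats s2 ''n'' 0 = n"
      "nats s2 ''cs'' = nats s ''cs''"
      using I inp by (simp_all add: same_def inp_def)
    show "runs check1_com s2 (10 + (20 + (for_time n 300 + 60))) (\<lambda>s'. ?I (Suc l) (nupd ''l'' 0 (Suc l) s'))"
    proof (cases "l \<in> C")
      case False
      then have "C \<inter> {..<Suc l} = C \<inter> {..<l}" "\<And>x. x \<in> C \<Longrightarrow> x < Suc l \<longleftrightarrow> x < l"
        by (auto simp: less_Suc_eq)
      moreover have "nats s2 ''cs'' l = 0" using False lN C f by auto
      ultimately show ?thesis using I l unfolding check1_com_def by (simp add: runs_simps)
    next
      case True
      then have Cl: "C \<inter> {..<Suc l} = insert l (C \<inter> {..<l})" by (auto simp: less_Suc_eq)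
      have cs: "nats s2 ''cs'' l \<noteq> 0" using True C f by auto
      let ?s3 = "rupd ''sy'' 0 (1 - b l) (rupd ''sx'' 0 0 s2)"
      let ?J = "\<lambda>s'. reals s' ''sx'' 0 = before_sum a b C l \<and>
        reals s' ''sy'' 0 = 1 - b l - after_sum a b C l \<and> same {''i''} {''sx'', ''sy''} ?s3 s'"
      have q1: "runs (Seq (RSet ''sx'' (NConst 0) (RNat (NConst 0)))
       (RSet ''sy'' (NConst 0) (RSub (RNat (NConst 1)) (RGet ''b'' (V ''l''))))) s2 20 (\<lambda>s'. s' = ?s3)"
        using f l by (simp add: runs_simps)
      have q2: "runs (For ''i'' (V ''n'') scan_com) ?s3 (for_time n 300) ?J"
        by (rule runs_scan) (use f l C in auto)
      have q3: "runs (Seq (RSet ''X'' (V ''l'') (R ''sx'')) (Seq (RSet ''Y'' (V ''l'') (R ''sy''))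
     (Seq (RSet ''pr'' (NConst 0) (RAdd (R ''pr'') (RGet ''p'' (V ''l''))))
       (Cond (RLess (R ''sy'') (RAdd (R ''sx'') (RGet ''a'' (V ''l''))))
         (NSet ''good'' (NConst 0) (NConst 0)) Skip)))) s4 60
         (\<lambda>s'. ?I (Suc l) (nupd ''l'' 0 (Suc l) s'))" if J: "?J s4" for s4
      proof -
        have g: "reals s4 v = reals s2 v" if "v \<noteq> ''sx''" "v \<noteq> ''sy''" for v
          using J that by (simp add: same_def)
        have g': "nats s4 v = nats s2 v" if "v \<noteq> ''i''" for v
          using J that by (simp add: same_def)
        have sm: "same ?X ?Y s s4"
        proof (rule same_mono[OF same_trans[of ?X ?Y s ?s3 "{''i''}" "{''sx'', ''sy''}"]])
          show "same ?X ?Y s ?s3" using I by simp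
        qed (use J in auto)
        have ld: "load a b C l \<le> 1 \<longleftrightarrow>
          \<not> 1 - b l - after_sum a b C l < before_sum a b C l + a l"
          using load_eq[OF finC True, of a b] by linarith
        have lt: "x < Suc l \<longleftrightarrow> x < l \<or> x = l" for x by auto
        have pr: "sum p (C \<inter> {..<Suc l}) = p l + sum p (C \<inter> {..<l})" unfolding Cl using finC by simp
        show ?thesis
        proof (cases "load a b C l \<le> 1")
          case True
          then have nb: "\<not> 1 - b l - after_sum a b C l < before_sum a b C l + a l" using ld by blast
          show ?thesis
            using J I l g g' f sm nb True unfolding pr lt by (simp add: runs_simps)
        next
          case False
          then have nb: "1 - b l - after_sum a b C l < before_sum a b C l + a l" using ld by blast
          show ?thesis
            using J I l g g' f sm nb False \<open>l \<in> C\<close> unfolding pr lt by (simp add: runs_simps) blast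
        qed
      qed
      note w = runs_weaken[OF _ _ order_refl]
      have "runs (Seq (Seq (RSet ''sx'' (NConst 0) (RNat (NConst 0)))
       (RSet ''sy'' (NConst 0) (RSub (RNat (NConst 1)) (RGet ''b'' (V ''l'')))))
     (Seq (For ''i'' (V ''n'') scan_com)
     (Seq (RSet ''X'' (V ''l'') (R ''sx'')) (Seq (RSet ''Y'' (V ''l'') (R ''sy''))
     (Seq (RSet ''pr'' (NConst 0) (RAdd (R ''pr'') (RGet ''p'' (V ''l''))))
       (Cond (RLess (R ''sy'') (RAdd (R ''sx'') (RGet ''a'' (V ''l''))))
         (NSet ''good'' (NConst 0) (NConst 0)) Skip)))))) s2 (20 + (for_time n 300 + 60))
         (\<lambda>s'. ?I (Suc l) (nupd ''l'' 0 (Suc l) s'))"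
        apply (rule runs_Seq[OF w[OF q1] order_refl])
        apply (simp only:)
        apply (rule runs_Seq[OF w[OF q2] order_refl])
        apply (rule q3, assumption)
        done
      then show ?thesis
        unfolding check1_com_def runs_Cond using cs l by (auto elim!: runs_weaken)
    qed
  next
    fix i s2 assume "?I i s2"
    then have "nats s2 ''n'' = nats s ''n''" by (simp add: same_def)
    then show "nval (V ''n'') s2 = n" using inp by (simp add: inp_def)
  qed (auto simp: check1_com_def)
  note w = runs_weaken[OF _ _ order_refl]
  show ?thesis
    unfolding check_com_def
    apply (rule runs_Seq[OF w[OF r1] order_refl])
    apply (rule w[OF r2], assumption)
    using Cn by simp
qed

section \<open>Keeping the best feasible candidate\<close>

definition valid :: "nat \<Rightarrow> (nat \<Rightarrow> real) \<Rightarrow> (nat \<Rightarrow> real) \<Rightarrow> (nat \<Rightarrow> real) \<Rightarrow> state \<Rightarrow> bool" where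
  "valid n a b p s \<longleftrightarrow> (let C = {i. i < n \<and> nats s ''sel'' i \<noteq> 0} in
     reals s ''best'' 0 = sum p C \<and>
     (\<forall>l\<in>C. load a b C l \<le> 1 \<and> reals s ''x'' l = before_sum a b C l \<and>
        reals s ''y'' l = 1 - b l - after_sum a b C l))"

definition copy_com :: com where
  "copy_com = Seq (NSet ''sel'' (V ''i'') (NGet ''cs'' (V ''i'')))
     (Seq (RSet ''x'' (V ''i'') (RGet ''X'' (V ''i''))) (RSet ''y'' (V ''i'') (RGet ''Y'' (V ''i''))))"

definition update_com :: com where
  "update_com = Cond (BAnd (NLess (NConst 0) (V ''good'')) (RLess (R ''best'') (R ''pr'')))
     (Seq (For ''i'' (V ''n'') copy_com) (RSet ''best'' (NConst 0) (R ''pr''))) Skip"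

text \<open>The two inequalities on the stored profit drive the search: it is never lowered, and it
  reaches the profit of every candidate that passes the test.\<close>

lemma runs_update:
  assumes n: "nats s ''n'' 0 = n" and val: "valid n a b p s"
    and C: "C = {i. i < n \<and> nats s ''cs'' i \<noteq> 0}"
    and good: "nats s ''good'' 0 \<noteq> 0 \<longleftrightarrow> (\<forall>l\<in>C. load a b C l \<le> 1)" and pr: "reals s ''pr'' 0 = sum p C"
    and XY: "\<And>l. l \<in> C \<Longrightarrow> reals s ''X'' l = before_sum a b C l \<and>
      reals s ''Y'' l = 1 - b l - after_sum a b C l"
  shows "runs update_com s (20 + (for_time n 20 + 5)) (\<lambda>s'. valid n a b p s' \<and>
    reals s ''best'' 0 \<le> reals s' ''best'' 0 \<and>
    ((\<forall>l\<in>C. load a b C l \<le> 1) \<longrightarrow> sum p C \<le> reals s' ''best'' 0) \<and>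
    same {''sel'', ''i''} {''x'', ''y'', ''best''} s s')"
proof (cases "(\<forall>l\<in>C. load a b C l \<le> 1) \<and> reals s ''best'' 0 < sum p C")
  case False
  then show ?thesis using val good pr unfolding update_com_def by (auto simp: runs_simps)
next
  case True
  let ?I = "\<lambda>i s'. (\<forall>l<i. nats s' ''sel'' l = nats s ''cs'' l \<and> reals s' ''x'' l = reals s ''X'' l \<and>
    reals s' ''y'' l = reals s ''Y'' l) \<and> same {''sel'', ''i''} {''x'', ''y''} s s'"
  have r1: "runs (For ''i'' (V ''n'') copy_com) s (for_time n 20) (?I n)"
    by (rule runs_For[where I = ?I])
      (use n in \<open>auto simp: copy_com_def runs_simps less_Suc_eq same_def\<close>)
  have r2: "runs (RSet ''best'' (NConst 0) (R ''pr'')) s1 5 (\<lambda>s'. valid n a b p s' \<and>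
      reals s ''best'' 0 \<le> reals s' ''best'' 0 \<and>
      ((\<forall>l\<in>C. load a b C l \<le> 1) \<longrightarrow> sum p C \<le> reals s' ''best'' 0) \<and>
      same {''sel'', ''i''} {''x'', ''y'', ''best''} s s')" if I: "?I n s1" for s1
  proof -
    have f: "reals s1 ''pr'' = reals s ''pr''" using I by (simp add: same_def)
    have Ceq: "{i. i < n \<and> nats s1 ''sel'' i \<noteq> 0} = C" using I C by auto
    have sm: "same {''sel'', ''i''} {''x'', ''y'', ''best''} s s1" using I by (auto intro: same_mono)
    have "reals s1 ''x'' l = before_sum a b C l \<and> reals s1 ''y'' l = 1 - b l - after_sum a b C l"
      if "l \<in> C" for l using XY[OF that] I that C by auto
    then show ?thesis using True f pr sm
      unfolding runs_RSet valid_def Let_def nats_rupd Ceq by simp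
  qed
  have "runs (Seq (For ''i'' (V ''n'') copy_com) (RSet ''best'' (NConst 0) (R ''pr''))) s
    (for_time n 20 + 5) (\<lambda>s'. valid n a b p s' \<and>
      reals s ''best'' 0 \<le> reals s' ''best'' 0 \<and>
      ((\<forall>l\<in>C. load a b C l \<le> 1) \<longrightarrow> sum p C \<le> reals s' ''best'' 0) \<and>
      same {''sel'', ''i''} {''x'', ''y'', ''best''} s s')"
    by (rule runs_Seq[OF runs_weaken[OF r1 r2 order_refl] order_refl])
  then show ?thesis
    unfolding update_com_def runs_Cond using True good pr by (auto elim!: runs_weaken)
qed

definition cand_com :: com where
  "cand_com = Cond (NLess (NConst 0) (NGet ''ok'' (NAdd (V ''off'') (V ''j''))))
     (Seq back_com (Seq check_com update_com)) Skip"

definition cand_time :: "nat \<Rightarrow> nat" where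
  "cand_time n = 20 + ((for_time n 6 + (10 + for_time n 60)) +
     ((10 + for_time n (10 + (20 + (for_time n 300 + 60)))) + (20 + (for_time n 20 + 5))))"

text \<open>\<open>valid\<close> is preserved for every column of every guess, since it rests on the
  tested loads alone; the clause about \<open>dp\<close> is the one through which a good guess pays
  off.\<close>

lemma runs_cand:
  fixes a b p :: "nat \<Rightarrow> real"
  assumes inp: "inp n a b p s" and W: "nats s ''W'' 0 = W" and tab: "table e w v n W s"
    and w: "\<And>i. i < n \<Longrightarrow> nats s ''w'' i = w i" and val: "valid n a b p s"
    and K: "K \<subseteq> {..<n}" and tt: "\<And>i. i < n \<Longrightarrow> nats s ''tt'' i \<noteq> 0 \<longleftrightarrow> i \<in> K"
    and j: "nats s ''j'' 0 = c" "c < W"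
  shows "runs cand_com s (cand_time n) (\<lambda>s'. valid n a b p s' \<and>
    reals s ''best'' 0 \<le> reals s' ''best'' 0 \<and>
    (\<forall>x S. dp e w v n c = Some (x, S) \<and> (\<forall>l\<in>K \<union> S. load a b (K \<union> S) l \<le> 1) \<longrightarrow>
      sum p (K \<union> S) \<le> reals s' ''best'' 0) \<and>
    same {''i'', ''cs'', ''cur'', ''o'', ''t'', ''good'', ''l'', ''sel''}
      {''pr'', ''sx'', ''sy'', ''X'', ''Y'', ''x'', ''y'', ''best''} s s')"
proof -
  let ?X = "{''i'', ''cs'', ''cur'', ''o'', ''t'', ''good'', ''l'', ''sel''}"
  let ?Y = "{''pr'', ''sx'', ''sy'', ''X'', ''Y'', ''x'', ''y'', ''best''}"
  have ok: "nats s ''ok'' (nats s ''off'' 0 + nats s ''j'' 0) \<noteq> 0 \<longleftrightarrow> dp e w v n c \<noteq> None"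
    using tab j unfolding table_def cell_def by simp
  show ?thesis
  proof (cases "dp e w v n c")
    case None
    then show ?thesis using ok val unfolding cand_com_def cand_time_def by (simp add: runs_simps)
  next
    case (Some xS)
    obtain x S where d: "dp e w v n c = Some (x, S)" using Some by (cases xS) auto
    have Sn: "S \<subseteq> {..<n}" using dp_sound[OF d] by auto
    let ?C = "K \<union> S"
    let ?A = "\<lambda>s'. (\<forall>i<n. nats s' ''cs'' i \<noteq> 0 \<longleftrightarrow> nats s ''tt'' i \<noteq> 0 \<or> i \<in> S) \<and>
      same {''i'', ''cs'', ''cur'', ''o'', ''t''} {} s s'"
    have n: "nats s ''n'' 0 = n" using inp by (simp add: inp_def)
    have r1: "runs back_com s (for_time n 6 + (10 + for_time n 60)) ?A"
      by (rule runs_back[OF n W tab w j d])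
    let ?B = "\<lambda>s'. (nats s' ''good'' 0 \<noteq> 0 \<longleftrightarrow> (\<forall>l\<in>?C. load a b ?C l \<le> 1)) \<and> reals s' ''pr'' 0 = sum p ?C \<and>
      (\<forall>l\<in>?C. reals s' ''X'' l = before_sum a b ?C l \<and> reals s' ''Y'' l = 1 - b l - after_sum a b ?C l) \<and>
      ?C = {i. i < n \<and> nats s' ''cs'' i \<noteq> 0} \<and>
      same (?X - {''sel''}) (?Y - {''x'', ''y'', ''best''}) s s'"
    have r2: "runs check_com s1 (10 + for_time n (10 + (20 + (for_time n 300 + 60)))) ?B"
      if A: "?A s1" for s1
    proof -
      have C: "?C = {i. i < n \<and> nats s1 ''cs'' i \<noteq> 0}" using A tt K Sn by auto
      have i1: "inp n a b p s1" using A inp by (simp add: inp_def same_def)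
      show ?thesis
      proof (rule runs_weaken[OF runs_check[OF i1 C] _ order_refl])
        fix s2 assume h: "(nats s2 ''good'' 0 \<noteq> 0 \<longleftrightarrow> (\<forall>l\<in>?C. load a b ?C l \<le> 1)) \<and>
          reals s2 ''pr'' 0 = sum p ?C \<and>
          (\<forall>l\<in>?C. reals s2 ''X'' l = before_sum a b ?C l \<and> reals s2 ''Y'' l = 1 - b l - after_sum a b ?C l) \<and>
          same {''good'', ''l'', ''i''} {''pr'', ''sx'', ''sy'', ''X'', ''Y''} s1 s2"
        have "nats s2 ''cs'' = nats s1 ''cs''" using h by (simp add: same_def)
        then have C2: "?C = {i. i < n \<and> nats s2 ''cs'' i \<noteq> 0}" using C by simp
        have "same (?X - {''sel''}) (?Y - {''x'', ''y'', ''best''}) s s2"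
          by (rule same_mono[OF same_trans[of "{''i'', ''cs'', ''cur'', ''o'', ''t''}" "{}" s s1
                "{''good'', ''l'', ''i''}" "{''pr'', ''sx'', ''sy'', ''X'', ''Y''}"]])
            (use h A in auto)
        then show "?B s2" using h C2 by blast
      qed
    qed
    let ?Q = "\<lambda>s'. valid n a b p s' \<and> reals s ''best'' 0 \<le> reals s' ''best'' 0 \<and>
      ((\<forall>l\<in>?C. load a b ?C l \<le> 1) \<longrightarrow> sum p ?C \<le> reals s' ''best'' 0) \<and> same ?X ?Y s s'"
    have r3: "runs update_com s2 (20 + (for_time n 20 + 5)) ?Q" if B: "?B s2" for s2
    proof -
      have sm: "same (?X - {''sel''}) (?Y - {''x'', ''y'', ''best''}) s s2" using B by blast
      have f: "nats s2 ''n'' = nats s ''n''" "nats s2 ''sel'' = nats s ''sel''" "reals s2 ''x'' = reals s ''x''"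
        "reals s2 ''y'' = reals s ''y''" "reals s2 ''best'' = reals s ''best''"
        using sm by (simp_all add: same_def)
      have v2: "valid n a b p s2" using val f by (simp add: valid_def)
      have n2: "nats s2 ''n'' 0 = n" using f n by simp
      show ?thesis
      proof (rule runs_weaken[OF runs_update[OF n2 v2, of ?C] _ order_refl])
        fix s3 assume h: "valid n a b p s3 \<and> reals s2 ''best'' 0 \<le> reals s3 ''best'' 0 \<and>
          ((\<forall>l\<in>?C. load a b ?C l \<le> 1) \<longrightarrow> sum p ?C \<le> reals s3 ''best'' 0) \<and>
          same {''sel'', ''i''} {''x'', ''y'', ''best''} s2 s3"
        have "same ?X ?Y s s3"
          by (rule same_mono[OF same_trans[OF sm, of "{''sel'', ''i''}" "{''x'', ''y'', ''best''}" s3]])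
            (use h in auto)
        then show "?Q s3" using h f by simp
      qed (use B in blast)+
    qed
    note w = runs_weaken[OF _ _ order_refl]
    have "runs (Seq back_com (Seq check_com update_com)) s ((for_time n 6 + (10 + for_time n 60)) +
     ((10 + for_time n (10 + (20 + (for_time n 300 + 60)))) + (20 + (for_time n 20 + 5)))) ?Q"
      apply (rule runs_Seq[OF w[OF r1] order_refl])
      apply (rule runs_Seq[OF w[OF r2] order_refl], assumption)
      apply (rule r3, assumption)
      done
    then have "runs cand_com s (cand_time n) ?Q"
      unfolding cand_com_def cand_time_def runs_Cond using ok d by (auto elim!: runs_weaken)
    then show ?thesis by (rule runs_weaken) (use d in auto)
  qed
qed

section \<open>The whole algorithm and its guarantee\<close>

definition body_com :: "nat \<Rightarrow> com" where
  "body_com k = Seq (mark_com k) (Seq (weights_com k) (Seq table_com (For ''j'' (V ''W'') cand_com)))"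

text \<open>The number of key sums with four digits below \<open>base k n\<close>, and therefore the
  width \<open>W\<close> of a table row.\<close>

definition keys :: "nat \<Rightarrow> nat \<Rightarrow> nat" where
  "keys k n = base k n * base k n * base k n * base k n"

definition body_time :: "nat \<Rightarrow> nat \<Rightarrow> nat" where
  "body_time k n = (for_time n 4 + for_time (2 * k) 5) + (for_time n (weight_time k n) +
     (table_time n (keys k n) + for_time (keys k n) (cand_time n)))"

text \<open>The conclusion of \<open>ex_good_guess\<close> for a single guess and a target profit
  \<open>r\<close>. It plays the role of \<open>G\<close> in the enumeration, with a stored profit
  of at least \<open>r\<close> as \<open>B\<close>.\<close>

definition reaches ::
  "(nat \<Rightarrow> real) \<Rightarrow> (nat \<Rightarrow> real) \<Rightarrow> (nat \<Rightarrow> real) \<Rightarrow> nat \<Rightarrow> nat \<Rightarrow> real \<Rightarrow> (nat \<Rightarrow> nat) \<Rightarrow> bool" where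
  "reaches a b p k n r h \<longleftrightarrow> (\<exists>c x S. c < keys k n \<and>
     dp (eligible a b p k n h) (key a b p k n h) (hi a b) n c = Some (x, S) \<and>
     (\<forall>l\<in>kept k n h \<union> S. load a b (kept k n h \<union> S) l \<le> 1) \<and> r \<le> sum p (kept k n h \<union> S))"

text \<open>On a single flowshop every job is assigned to flowshop 0, the initial content of
  \<open>F\<close>, which the program never writes.\<close>

definition state_ok :: "nat \<Rightarrow> nat \<Rightarrow> (nat \<Rightarrow> real) \<Rightarrow> (nat \<Rightarrow> real) \<Rightarrow> (nat \<Rightarrow> real) \<Rightarrow> state \<Rightarrow> bool" where
  "state_ok k n a b p s \<longleftrightarrow> inp n a b p s \<and> consts_set k n s \<and> valid n a b p s \<and>
     nats s ''F'' = (\<lambda>_. 0)"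

lemma nmod_back [simp]: "nmod back_com = {''i'', ''cs'', ''cur'', ''o'', ''t''}"
  by (auto simp: back_com_def trace_com_def)

lemma nmod_check [simp]: "nmod check_com = {''good'', ''l'', ''i''}"
  by (auto simp: check_com_def check1_com_def)

lemma nmod_update [simp]: "nmod update_com = {''sel'', ''i''}"
  by (auto simp: update_com_def copy_com_def)

text \<open>Marks, keys and tables belong to one guess and are absent from \<open>state_ok\<close>:
  each run of the body rebuilds them over whatever the previous run has left.\<close>

lemma runs_body:
  assumes ok: "state_ok k n a b p s"
  shows "runs (body_com k) s (body_time k n) (\<lambda>s'. state_ok k n a b p s' \<and>
    nats s' ''g'' = nats s ''g'' \<and> (r \<le> reals s ''best'' 0 \<longrightarrow> r \<le> reals s' ''best'' 0) \<and>
    (reaches a b p k n r (nats s ''g'') \<longrightarrow> r \<le> reals s' ''best'' 0))"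
proof -
  let ?h = "nats s ''g''" and ?W = "keys k n"
  let ?el = "eligible a b p k n ?h" and ?key = "key a b p k n ?h" and ?K = "kept k n ?h"
  let ?X = "{''tt'', ''i'', ''l'', ''el'', ''w'', ''wt'', ''s1'', ''s2'', ''c'', ''ok'', ''tk'', ''j'', ''off''}"
  let ?Y = "{''u'', ''al'', ''val'', ''mx''}"
  let ?X' = "{''j'', ''i'', ''cs'', ''cur'', ''o'', ''t'', ''good'', ''l'', ''sel''}"
  let ?Y' = "{''pr'', ''sx'', ''sy'', ''X'', ''Y'', ''x'', ''y'', ''best''}"
  note d = ok[unfolded state_ok_def]
  have n: "nats s ''n'' 0 = n" using d by (simp add: inp_def)
  have st: "nats s' v = nats s v" if "same ?X ?Y s s'" "v \<notin> ?X" for s' v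
    using that by (simp add: same_def)
  have rt: "reals s' v = reals s v" if "same ?X ?Y s s'" "v \<notin> ?Y" for s' v
    using that by (simp add: same_def)
  have okX: "inp n a b p s' \<and> consts_set k n s' \<and> valid n a b p s' \<and> nats s' ''g'' = ?h \<and>
      nats s' ''F'' = (\<lambda>_. 0) \<and> nats s' ''n'' 0 = n \<and> nats s' ''W'' 0 = ?W"
    if "same ?X ?Y s s'" for s'
    using d n st[OF that] rt[OF that] by (simp add: inp_def consts_set_def valid_def keys_def)
  let ?A = "\<lambda>s'. (\<forall>i<n. nats s' ''tt'' i \<noteq> 0 \<longleftrightarrow> i \<in> ?K) \<and> same ?X ?Y s s'"
  have r1: "runs (mark_com k) s (for_time n 4 + for_time (2 * k) 5) ?A"
    by (rule runs_weaken[OF runs_mark[OF n] _ order_refl]) (auto elim: same_mono)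
  let ?B = "\<lambda>s'. (\<forall>i<n. (nats s' ''el'' i \<noteq> 0 \<longleftrightarrow> ?el i) \<and> nats s' ''w'' i = ?key i) \<and> ?A s'"
  have r2: "runs (weights_com k) s1 (for_time n (weight_time k n)) ?B" if A: "?A s1" for s1
  proof -
    have o: "inp n a b p s1" "consts_set k n s1" "nats s1 ''g'' = ?h" using okX A by blast+
    show ?thesis
    proof (rule runs_weaken[OF runs_weights[OF o(1,2)] _ order_refl])
      show "nats s1 ''tt'' i \<noteq> 0 \<longleftrightarrow> i \<in> kept k n (nats s1 ''g'')" if "i < n" for i
        using A that o(3) by simp
      fix s2 assume h: "(\<forall>i<n. (nats s2 ''el'' i \<noteq> 0 \<longleftrightarrow> eligible a b p k n (nats s1 ''g'') i) \<and>
        nats s2 ''w'' i = key a b p k n (nats s1 ''g'') i) \<and>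
        same {''i'', ''el'', ''w'', ''wt'', ''s1'', ''s2'', ''c''} {''u'', ''al''} s1 s2"
      have "same ?X ?Y s s2"
        by (rule same_mono[OF same_trans[of ?X ?Y s s1
              "{''i'', ''el'', ''w'', ''wt'', ''s1'', ''s2'', ''c''}" "{''u'', ''al''}"]])
          (use h A in auto)
      moreover have "nats s2 ''tt'' = nats s1 ''tt''" using h by (simp add: same_def)
      ultimately show "?B s2" using h A o(3) by simp
    qed
  qed
  let ?C = "\<lambda>s'. table ?el ?key (hi a b) n ?W s' \<and> ?B s'"
  have W0: "0 < ?W" by (simp add: keys_def base_def)
  have r3: "runs table_com s2 (table_time n ?W) ?C" if B: "?B s2" for s2
  proof -
    have o: "inp n a b p s2" "nats s2 ''n'' 0 = n" "nats s2 ''W'' 0 = ?W" using okX B by blast+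
    show ?thesis
    proof (rule runs_weaken[OF runs_table[of s2 a b n ?W ?el ?key] _ order_refl])
      fix s3 assume h: "table ?el ?key (hi a b) n ?W s3 \<and>
        same {''ok'', ''tk'', ''j'', ''off'', ''i''} {''val'', ''mx''} s2 s3"
      have "same ?X ?Y s s3"
        by (rule same_mono[OF same_trans[of ?X ?Y s s2
              "{''ok'', ''tk'', ''j'', ''off'', ''i''}" "{''val'', ''mx''}"]])
          (use h B in auto)
      moreover have "nats s3 ''tt'' = nats s2 ''tt''" "nats s3 ''el'' = nats s2 ''el''"
        "nats s3 ''w'' = nats s2 ''w''" using h by (simp_all add: same_def)
      ultimately show "?C s3" using h B by simp
    qed (use o B W0 in \<open>auto simp: inp_def\<close>)
  qed
  have r4: "runs (For ''j'' (V ''W'') cand_com) s3 (for_time ?W (cand_time n)) (\<lambda>s'. state_ok k n a b p s' \<and>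
    nats s' ''g'' = ?h \<and> (r \<le> reals s ''best'' 0 \<longrightarrow> r \<le> reals s' ''best'' 0) \<and>
    (reaches a b p k n r ?h \<longrightarrow> r \<le> reals s' ''best'' 0))" if C: "?C s3" for s3
  proof -
    have o: "inp n a b p s3" "consts_set k n s3" "valid n a b p s3" "nats s3 ''g'' = ?h"
      "nats s3 ''F'' = (\<lambda>_. 0)" "nats s3 ''n'' 0 = n" "nats s3 ''W'' 0 = ?W"
      using okX C by blast+
    have b3: "reals s3 ''best'' = reals s ''best''" using C by (simp add: same_def)
    let ?P = "\<lambda>c s'. \<forall>x S. dp ?el ?key (hi a b) n c = Some (x, S) \<and>
      (\<forall>l\<in>?K \<union> S. load a b (?K \<union> S) l \<le> 1) \<longrightarrow> sum p (?K \<union> S) \<le> reals s' ''best'' 0"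
    let ?I = "\<lambda>j s'. valid n a b p s' \<and> reals s3 ''best'' 0 \<le> reals s' ''best'' 0 \<and>
      (\<forall>c<j. ?P c s') \<and> same ?X' ?Y' s3 s'"
    show ?thesis
    proof (rule runs_For[where I = ?I])
      show "?I 0 (nupd ''j'' 0 0 s3)" using o by (simp add: valid_def)
    next
      fix j s4 assume jW: "j < ?W" and I: "?I j s4" and j: "nats s4 ''j'' 0 = j"
      have st4: "nats s4 v = nats s3 v" if "v \<notin> ?X'" for v using I that by (simp add: same_def)
      have rt4: "reals s4 v = reals s3 v" if "v \<notin> ?Y'" for v using I that by (simp add: same_def)
      have t4: "table ?el ?key (hi a b) n ?W s4"
        using C st4 rt4 by (simp add: table_def cell_def flag_def)
      have i4: "inp n a b p s4" using o st4 rt4 by (simp add: inp_def)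
      have K: "?K \<subseteq> {..<n}" by (auto simp: kept_def)
      have "runs cand_com s4 (cand_time n) (\<lambda>s'. valid n a b p s' \<and>
        reals s4 ''best'' 0 \<le> reals s' ''best'' 0 \<and> ?P j s' \<and>
        same {''i'', ''cs'', ''cur'', ''o'', ''t'', ''good'', ''l'', ''sel''} ?Y' s4 s')"
        by (rule runs_cand[OF i4 _ t4 _ _ K _ j jW]) (use C I o st4 in auto)
      then show "runs cand_com s4 (cand_time n) (\<lambda>s'. ?I (Suc j) (nupd ''j'' 0 (Suc j) s'))"
      proof (rule runs_weaken[OF _ _ order_refl])
        fix s5 assume h: "valid n a b p s5 \<and>
          reals s4 ''best'' 0 \<le> reals s5 ''best'' 0 \<and> ?P j s5 \<and>
          same {''i'', ''cs'', ''cur'', ''o'', ''t'', ''good'', ''l'', ''sel''} ?Y' s4 s5"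
        have sm: "same ?X' ?Y' s3 s5"
          by (rule same_mono[OF same_trans[of ?X' ?Y' s3 s4
                "{''i'', ''cs'', ''cur'', ''o'', ''t'', ''good'', ''l'', ''sel''}" ?Y']])
            (use h I in auto)
        have P: "?P c s5" if "c < Suc j" for c
        proof (cases "c = j")
          case False
          then have "c < j" using that by simp
          then have "?P c s4" using I by blast
          then show ?thesis using h by (meson order_trans)
        qed (use h in simp)
        have v: "valid n a b p (nupd ''j'' 0 (Suc j) s5)" using h by (simp add: valid_def)
        have "reals s3 ''best'' 0 \<le> reals s5 ''best'' 0" using h I by linarith
        then show "?I (Suc j) (nupd ''j'' 0 (Suc j) s5)"
          using sm P v by simp
      qed
    next
      fix j s4 assume "?I j s4"
      then have "nats s4 ''W'' = nats s3 ''W''" by (simp add: same_def)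
      then show "nval (V ''W'') s4 = ?W" using o by simp
    next
      fix s4 assume I: "?I ?W s4"
      have st4: "nats s4 v = nats s3 v" if "v \<notin> ?X'" for v using I that by (simp add: same_def)
      have rt4: "reals s4 v = reals s3 v" if "v \<notin> ?Y'" for v using I that by (simp add: same_def)
      have "state_ok k n a b p s4"
        using I o st4 rt4 by (simp add: state_ok_def inp_def consts_set_def)
      moreover have "nats s4 ''g'' = ?h" using st4 o by simp
      moreover have "r \<le> reals s4 ''best'' 0" if rc: "reaches a b p k n r ?h"
      proof -
        obtain c x S where "c < ?W" "dp ?el ?key (hi a b) n c = Some (x, S)"
          "\<forall>l\<in>?K \<union> S. load a b (?K \<union> S) l \<le> 1" "r \<le> sum p (?K \<union> S)"
          using rc unfolding reaches_def by blast
        then show ?thesis using I by (meson order_trans)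
      qed
      ultimately show "state_ok k n a b p s4 \<and> nats s4 ''g'' = ?h \<and>
        (r \<le> reals s ''best'' 0 \<longrightarrow> r \<le> reals s4 ''best'' 0) \<and>
        (reaches a b p k n r ?h \<longrightarrow> r \<le> reals s4 ''best'' 0)"
        using I b3 by auto
    qed (auto simp: cand_com_def)
  qed
  note w = runs_weaken[OF _ _ order_refl]
  show ?thesis
    unfolding body_com_def body_time_def
    apply (rule runs_Seq[OF w[OF r1] order_refl])
    apply (rule runs_Seq[OF w[OF r2] order_refl], assumption)
    apply (rule runs_Seq[OF w[OF r3] order_refl], assumption)
    apply (rule r4, assumption)
    done
qed

definition ptas_com :: "nat \<Rightarrow> com" where
  "ptas_com k = Seq (setup_com k) (nest (2 * k + 3) (body_com k))"

definition ptas_time :: "nat \<Rightarrow> nat \<Rightarrow> nat" where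
  "ptas_time k n = setup_time k n + nest_time (2 * k + 3) n (body_time k n)"

lemma runs_ptas:
  assumes inp: "inp n a b p s" and zero: "\<And>v i. v \<noteq> ''n'' \<Longrightarrow> nats s v i = 0" "reals s ''best'' 0 = 0"
    and h: "\<And>l. l < 2 * k + 3 \<Longrightarrow> h l \<le> n" "\<And>l. 2 * k + 3 \<le> l \<Longrightarrow> h l = 0" "reaches a b p k n r h"
  shows "runs (ptas_com k) s (ptas_time k n) (\<lambda>s'. state_ok k n a b p s' \<and> r \<le> reals s' ''best'' 0)"
proof -
  let ?L = "2 * k + 3"
  have n: "nats s ''n'' 0 = n" using inp by (simp add: inp_def)
  have r1: "runs (setup_com k) s (setup_time k n) (\<lambda>s'. state_ok k n a b p s' \<and> nats s' ''g'' = (\<lambda>_. 0))"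
  proof (rule runs_weaken[OF runs_setup[OF n] _ order_refl])
    fix s' assume h: "consts_set k n s' \<and>
      same {''kk'', ''nk'', ''M'', ''M2'', ''M3'', ''W'', ''i''} {} s s'"
    \<comment> \<open>The zero store already represents a valid solution, the empty selection with
      profit 0.\<close>
    have z: "nats s ''sel'' = (\<lambda>_. 0)" "nats s ''F'' = (\<lambda>_. 0)" "nats s ''g'' = (\<lambda>_. 0)"
      using zero by auto
    have "inp n a b p s'" using h inp by (simp add: inp_def same_def)
    moreover have "nats s' ''sel'' = (\<lambda>_. 0)" "nats s' ''F'' = (\<lambda>_. 0)" "nats s' ''g'' = (\<lambda>_. 0)"
      "reals s' ''best'' 0 = 0" using h z zero by (simp_all add: same_def)
    ultimately show "state_ok k n a b p s' \<and> nats s' ''g'' = (\<lambda>_. 0)"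
      using h by (simp add: state_ok_def valid_def)
  qed
  have r2: "runs (nest ?L (body_com k)) s1 (nest_time ?L n (body_time k n))
    (\<lambda>s'. state_ok k n a b p s' \<and> r \<le> reals s' ''best'' 0)"
    if s1: "state_ok k n a b p s1 \<and> nats s1 ''g'' = (\<lambda>_. 0)" for s1
  proof -
    have "runs (nest ?L (body_com k)) s1 (nest_time ?L n (body_time k n)) (\<lambda>s'. state_ok k n a b p s' \<and>
      (\<forall>l\<ge>?L. nats s' ''g'' l = nats s1 ''g'' l) \<and> (r \<le> reals s1 ''best'' 0 \<longrightarrow> r \<le> reals s' ''best'' 0) \<and>
      (\<forall>h. (\<forall>l<?L. h l \<le> n) \<and> (\<forall>l\<ge>?L. h l = nats s1 ''g'' l) \<and> reaches a b p k n r h \<longrightarrow>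
        r \<le> reals s' ''best'' 0))"
    proof (rule runs_nest[where J = "state_ok k n a b p" and G = "reaches a b p k n r"])
      show "state_ok k n a b p (nupd ''g'' l m s)" if "state_ok k n a b p s" for s l m
        using that by (simp add: state_ok_def inp_def consts_set_def valid_def)
    qed (use s1 runs_body in \<open>auto simp: state_ok_def inp_def\<close>)
    then show ?thesis
      by (rule runs_weaken[OF _ _ order_refl]) (use h s1 in auto)
  qed
  show ?thesis
    unfolding ptas_com_def ptas_time_def
    by (rule runs_Seq[OF runs_weaken[OF r1 r2 order_refl] order_refl])
qed

lemma ptas_correct:
  assumes k: "2 \<le> k"
  shows "approx_algorithm 1 (1 - 2 / real k) (ptas_com k) (ptas_time k)"
  unfolding approx_algorithm_def
proof (intro allI impI)
  fix js assume js: "fs_instance js"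
  define n where "n = length js"
  \<comment> \<open>Extending the data by 0 turns index \<open>n\<close> into a job without work and
    profit.\<close>
  define a where "a i = (if i < n then time1 (js ! i) else 0)" for i
  define b where "b i = (if i < n then time2 (js ! i) else 0)" for i
  define p where "p i = (if i < n then profit (js ! i) else 0)" for i
  have nonneg: "0 \<le> a i" "0 \<le> b i" for i
    using js unfolding fs_instance_def a_def b_def n_def by auto
  have tp: "total_profit js S = sum p S" if "S \<subseteq> {..<n}" for S
    unfolding total_profit_def using that by (intro sum.cong) (auto simp: p_def)
  let ?feas = "\<lambda>S. \<exists>F x y. fs_schedule 1 js S F x y \<and> makespan js S y \<le> 1"
  let ?P = "{total_profit js S | S. ?feas S}"
  have "?P \<subseteq> total_profit js ` Pow {..<n}"
    unfolding fs_schedule_def n_def by blast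
  then have finP: "finite ?P" by (rule finite_subset) simp
  have "?feas {}"
    by (intro exI[of _ "\<lambda>_. 0"]) (simp add: fs_schedule_def makespan_def)
  then have "?P \<noteq> {}" by blast
  then have "OPT 1 js \<in> ?P" unfolding OPT_def using Max_in[OF finP] by blast
  then obtain S0 F x y where S0: "OPT 1 js = total_profit js S0" "fs_schedule 1 js S0 F x y"
    "makespan js S0 y \<le> 1" by blast
  \<comment> \<open>Profits may be negative. Removing such jobs from an optimal selection keeps its
    schedule feasible and does not lower the profit.\<close>
  define S where "S = {i\<in>S0. 0 \<le> p i}"
  have S0n: "S0 \<subseteq> {..<n}" using S0(2) by (simp add: fs_schedule_def n_def)
  then have Sn: "S \<subseteq> {..<n}" and finS0: "finite S0" by (auto simp: S_def intro: finite_subset)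
  have finS: "finite S" using Sn by (rule finite_subset) simp
  have a': "time1 (js ! i) = a i" "time2 (js ! i) = b i" "i < n" if "i \<in> S0" for i
    using S0n that by (auto simp: a_def b_def)
  have opt: "OPT 1 js \<le> sum p S"
  proof -
    have "sum p S0 \<le> sum p S + sum p (S0 - S)"
      using sum.subset_diff[of S S0 p] finS0 by (simp add: S_def)
    moreover have "sum p (S0 - S) \<le> 0" by (rule sum_nonpos) (auto simp: S_def)
    ultimately show ?thesis using S0(1) tp[OF S0n] by simp
  qed
  have SS: "i \<in> S0" if "i \<in> S" for i using that by (simp add: S_def)
  have sched: "F i < 1 \<and> 0 \<le> x i \<and> x i + a i \<le> y i" if "i \<in> S" for i
    using S0(2) SS[OF that] a'[OF SS[OF that]] unfolding fs_schedule_def by auto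
  have disj: "(x i + a i \<le> x j \<or> x j + a j \<le> x i) \<and> (y i + b i \<le> y j \<or> y j + b j \<le> y i)"
    if "i \<in> S" "j \<in> S" "i \<noteq> j" for i j
  proof -
    have "F i = F j" using sched[OF that(1)] sched[OF that(2)] by simp
    then show ?thesis
      using S0(2) that SS a' unfolding fs_schedule_def by metis
  qed
  have ends: "y i + b i \<le> 1" if "i \<in> S" for i
    using S0(3) SS[OF that] a'[OF SS[OF that]] finS0 unfolding makespan_def by auto
  have s: "0 \<le> x i" "x i + a i \<le> y i" if "i \<in> S" for i using sched[OF that] by auto
  have da: "x i + a i \<le> x j \<or> x j + a j \<le> x i" if "i \<in> S" "j \<in> S" "i \<noteq> j" for i j
    using disj[OF that] by simp
  have db: "y i + b i \<le> y j \<or> y j + b j \<le> y i" if "i \<in> S" "j \<in> S" "i \<noteq> j" for i j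
    using disj[OF that] by simp
  note low = load_le_of_schedule[of S a b x y, OF finS nonneg s(1) s(2) ends da db]
  have sums: "sum a S \<le> 1" "sum b S \<le> 1" and loads: "\<And>j. j \<in> S \<Longrightarrow> load a b S j \<le> 1"
    by (rule low; assumption)+
  have pS: "0 \<le> p i" if "i \<in> S" for i using that by (simp add: S_def)
  let ?r = "(1 - 2 / real k) * sum p S"
  obtain h c z R' where h: "\<And>l. l < 2 * k + 3 \<Longrightarrow> h l \<le> n" "\<And>l. 2 * k + 3 \<le> l \<Longrightarrow> h l = 0"
    "c < base k n * base k n * base k n * base k n"
    "dp (eligible a b p k n h) (key a b p k n h) (hi a b) n c = Some (z, R')"
    "\<And>j. j \<in> kept k n h \<union> R' \<Longrightarrow> load a b (kept k n h \<union> R') j \<le> 1"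
    "?r \<le> sum p (kept k n h \<union> R')"
  proof (rule ex_good_guess[of a b n p k S])
    show "1 \<le> k" using k by simp
    show "a n = 0" "b n = 0" "p n = 0" by (simp_all add: a_def b_def p_def)
  qed (use nonneg Sn pS sums loads in blast)+
  have "reaches a b p k n ?r h" unfolding reaches_def keys_def using h(3-6) by blast
  moreover have "inp n a b p (input js)"
    by (auto simp: inp_def input_def n_def a_def b_def p_def fun_eq_iff)
  ultimately have "runs (ptas_com k) (input js) (ptas_time k n)
    (\<lambda>s'. state_ok k n a b p s' \<and> ?r \<le> reals s' ''best'' 0)"
    using h(1,2) by (intro runs_ptas[where h = h]) (auto simp: input_def)
  then obtain t s where ex: "exec (ptas_com k) (input js) t s" "t \<le> ptas_time k n"
    and s: "state_ok k n a b p s" "?r \<le> reals s ''best'' 0" unfolding runs_def by blast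
  let ?C = "selected js s"
  have C: "?C = {i. i < n \<and> nats s ''sel'' i \<noteq> 0}" by (simp add: selected_def n_def)
  have Cn: "?C \<subseteq> {..<n}" by (auto simp: C)
  have val: "reals s ''best'' 0 = sum p ?C" "\<And>l. l \<in> ?C \<Longrightarrow> load a b ?C l \<le> 1 \<and>
      reals s ''x'' l = before_sum a b ?C l \<and> reals s ''y'' l = 1 - b l - after_sum a b ?C l"
    using s(1) unfolding state_ok_def valid_def Let_def C[symmetric] by blast+
  have F0: "nats s ''F'' = (\<lambda>_. 0)" using s(1) by (simp add: state_ok_def)
  have "fs_schedule 1 js ?C (nats s ''F'') (reals s ''x'') (reals s ''y'')"
    "makespan js ?C (reals s ''y'') \<le> 1"
    using schedule_of_load[of js a b ?C "nats s ''F''" "reals s ''x''" "reals s ''y''"]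
      Cn nonneg val(2) F0 by (auto simp: a_def b_def n_def)
  moreover have "(1 - 2 / real k) * OPT 1 js \<le> total_profit js ?C"
  proof -
    \<comment> \<open>The assumption \<open>2 \<le> k\<close> makes the factor nonnegative.\<close>
    have "(1 - 2 / real k) * OPT 1 js \<le> ?r"
      using opt k by (intro mult_left_mono) auto
    then show ?thesis using s(2) val(1) tp[OF Cn] by simp
  qed
  ultimately show "\<exists>t s. exec (ptas_com k) (input js) t s \<and> t \<le> ptas_time k (length js) \<and>
    fs_schedule 1 js (selected js s) (nats s ''F'') (reals s ''x'') (reals s ''y'') \<and>
    makespan js (selected js s) (reals s ''y'') \<le> 1 \<and>
    (1 - 2 / real k) * OPT 1 js \<le> total_profit js (selected js s)"
    using ex unfolding n_def by blast
qed

section \<open>Polynomial bounds on the running time\<close>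

definition poly_bounded :: "nat \<Rightarrow> (nat \<Rightarrow> nat) \<Rightarrow> bool" where
  "poly_bounded d f \<longleftrightarrow> (\<exists>C. \<forall>n. f n \<le> C * (n + 1) ^ d)"

text \<open>With base \<open>n + 1\<close> instead of \<open>n\<close> constants are covered at
  \<open>n = 0\<close>, and a bound of some degree is one of every higher degree.\<close>

lemma poly_bounded_const: "poly_bounded d (\<lambda>n. c)"
  unfolding poly_bounded_def by (intro exI[of _ c]) simp

lemma poly_bounded_id: "1 \<le> d \<Longrightarrow> poly_bounded d (\<lambda>n. n)"
proof -
  assume d: "1 \<le> d"
  have "n \<le> 1 * (n + 1) ^ d" for n :: nat
    using power_increasing[OF d, of "n + 1"] by simp
  then show ?thesis unfolding poly_bounded_def by blast
qed

lemma poly_bounded_add: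
  assumes "poly_bounded d f" "poly_bounded d g"
  shows "poly_bounded d (\<lambda>n. f n + g n)"
proof -
  obtain C D where "\<forall>n. f n \<le> C * (n + 1) ^ d" "\<forall>n. g n \<le> D * (n + 1) ^ d"
    using assms unfolding poly_bounded_def by blast
  then have "\<forall>n. f n + g n \<le> (C + D) * (n + 1) ^ d"
    by (simp add: add_mono distrib_right)
  then show ?thesis unfolding poly_bounded_def by blast
qed

lemma poly_bounded_mult:
  assumes "poly_bounded d f" "poly_bounded e g" "d + e \<le> m"
  shows "poly_bounded m (\<lambda>n. f n * g n)"
proof -
  obtain C D where CD: "\<forall>n. f n \<le> C * (n + 1) ^ d" "\<forall>n. g n \<le> D * (n + 1) ^ e"
    using assms unfolding poly_bounded_def by blast
  have "f n * g n \<le> (C * D) * (n + 1) ^ m" for n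
  proof -
    have "f n * g n \<le> (C * (n + 1) ^ d) * (D * (n + 1) ^ e)"
      using CD by (intro mult_le_mono) auto
    also have "\<dots> = (C * D) * (n + 1) ^ (d + e)" by (simp add: power_add)
    also have "\<dots> \<le> (C * D) * (n + 1) ^ m"
      using assms(3) by (intro mult_le_mono2 power_increasing) auto
    finally show ?thesis .
  qed
  then show ?thesis unfolding poly_bounded_def by blast
qed

lemma poly_bounded_for_time:
  assumes "poly_bounded d f" "poly_bounded e g" "d + e \<le> m"
  shows "poly_bounded m (\<lambda>n. for_time (f n) (g n))"
  unfolding for_time_def
  by (intro poly_bounded_add poly_bounded_mult[OF assms(1) _ assms(3)] poly_bounded_const assms(2))

lemma poly_bounded_nest_time:
  assumes "poly_bounded d f"
  shows "poly_bounded (L + d) (\<lambda>n. nest_time L n (f n))"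
proof (induction L)
  case 0
  then show ?case using assms by simp
next
  case (Suc L)
  have "poly_bounded 1 (\<lambda>n. n + 1)"
    by (intro poly_bounded_add poly_bounded_id poly_bounded_const) simp
  then have "poly_bounded (Suc L + d) (\<lambda>n. (n + 1) * (nest_time L n (f n) + 15))"
    by (rule poly_bounded_mult[OF _ poly_bounded_add[OF Suc poly_bounded_const]]) simp
  then show ?case
    unfolding nest_time.simps by (intro poly_bounded_add poly_bounded_const)
qed

text \<open>There are \<open>2 * k + 3\<close> loops over a body of degree 10. In the body the
  \<open>keys\<close> candidates, of degree 8 since \<open>base\<close> has degree 2, are each
  tested in quadratic time.\<close>

lemma poly_bounded_ptas_time: "poly_bounded (2 * k + 13) (ptas_time k)"
proof -
  note intros = poly_bounded_add poly_bounded_const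
  have id: "poly_bounded 1 (\<lambda>n. n)" by (rule poly_bounded_id) simp
  have base: "poly_bounded 2 (base k)"
  proof -
    have "poly_bounded 2 (\<lambda>n. k * n * n)"
      by (rule poly_bounded_mult[OF poly_bounded_mult[OF poly_bounded_const[of 0] id order_refl] id]) simp
    then have "poly_bounded 2 (\<lambda>n. 1 + k * n * n)" by (intro intros)
    then show ?thesis unfolding base_def[abs_def] .
  qed
  have keys: "poly_bounded 8 (keys k)"
    unfolding keys_def[abs_def]
    by (rule poly_bounded_mult[OF poly_bounded_mult[OF poly_bounded_mult[OF base base order_refl] base order_refl] base]) simp
  have nk: "poly_bounded 1 (\<lambda>n. n * k)"
    by (rule poly_bounded_mult[OF id poly_bounded_const[of 0]]) simp
  have fn: "poly_bounded m (\<lambda>n. for_time n c)" if "1 \<le> m" for m c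
    by (rule poly_bounded_for_time[OF id poly_bounded_const[of 0]]) (use that in simp)
  have fk: "poly_bounded m (\<lambda>n. for_time (keys k n) c)" if "8 \<le> m" for m c
    by (rule poly_bounded_for_time[OF keys poly_bounded_const[of 0]]) (use that in simp)
  have fb: "poly_bounded m (\<lambda>n. for_time (base k n) c)" if "2 \<le> m" for m c
    by (rule poly_bounded_for_time[OF base poly_bounded_const[of 0]]) (use that in simp)
  have fnk: "poly_bounded m (\<lambda>n. for_time (n * k) c)" if "1 \<le> m" for m c
    by (rule poly_bounded_for_time[OF nk poly_bounded_const[of 0]]) (use that in simp)
  have weight: "poly_bounded 1 (weight_time k)"
    unfolding weight_time_def[abs_def] by (intro intros fn fnk) auto
  have cand: "poly_bounded 2 cand_time"
  proof -
    have "poly_bounded 1 (\<lambda>n. 10 + (20 + (for_time n 300 + 60)))"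
      by (intro intros fn) auto
    then have "poly_bounded 2 (\<lambda>n. for_time n (10 + (20 + (for_time n 300 + 60))))"
      by (intro poly_bounded_for_time[OF id]) auto
    then show ?thesis unfolding cand_time_def[abs_def] by (intro intros fn) auto
  qed
  have table: "poly_bounded 10 (\<lambda>n. table_time n (keys k n))"
  proof -
    have "poly_bounded 8 (\<lambda>n. 20 + (for_time (keys k n) 130 + 7))"
      by (intro intros fk) auto
    then have "poly_bounded 10 (\<lambda>n. for_time n (20 + (for_time (keys k n) 130 + 7)))"
      by (intro poly_bounded_for_time[OF id]) auto
    then show ?thesis unfolding table_time_def by (intro intros fk) auto
  qed
  have body: "poly_bounded 10 (body_time k)"
    unfolding body_time_def[abs_def]
  proof (intro intros fn)
    show "poly_bounded 10 (\<lambda>n. for_time n (weight_time k n))"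
      by (rule poly_bounded_for_time[OF id weight]) simp
    show "poly_bounded 10 (\<lambda>n. for_time (keys k n) (cand_time n))"
      by (rule poly_bounded_for_time[OF keys cand]) simp
  qed (use table in auto)
  have "poly_bounded (2 * k + 13) (\<lambda>n. nest_time (2 * k + 3) n (body_time k n))"
    using poly_bounded_nest_time[OF body, of "2 * k + 3"] by (simp add: add.commute)
  moreover have "poly_bounded (2 * k + 13) (setup_time k)"
    unfolding setup_time_def[abs_def] by (intro intros fn fb) auto
  ultimately show ?thesis unfolding ptas_time_def[abs_def] by (intro intros)
qed

text \<open>With parameter \<open>2 * \<kappa>\<close> the degree is
  \<open>4 * \<kappa> + 13\<close>, at most \<open>17 * \<kappa>\<close> because
  \<open>\<kappa>\<close> is at least 1.\<close>

lemma ptas_time_bigo: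
  assumes "1 \<le> \<kappa>"
  shows "(\<lambda>n. real (ptas_time (2 * \<kappa>) n)) \<in> O(\<lambda>n. real n ^ (17 * \<kappa>))"
proof -
  let ?d = "2 * (2 * \<kappa>) + 13"
  obtain C where C: "\<And>n. ptas_time (2 * \<kappa>) n \<le> C * (n + 1) ^ ?d"
    using poly_bounded_ptas_time[of "2 * \<kappa>"] unfolding poly_bounded_def by blast
  have "real (ptas_time (2 * \<kappa>) n) \<le> real (C * 2 ^ ?d) * real n ^ (17 * \<kappa>)" if "1 \<le> n" for n
  proof -
    have "C * (n + 1) ^ ?d \<le> C * (2 * n) ^ ?d"
      using that by (intro mult_le_mono2 power_mono) auto
    also have "\<dots> = C * 2 ^ ?d * n ^ ?d" by (simp add: power_mult_distrib)
    also have "\<dots> \<le> C * 2 ^ ?d * n ^ (17 * \<kappa>)"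
      using that assms by (intro mult_le_mono2 power_increasing) auto
    finally have "ptas_time (2 * \<kappa>) n \<le> C * 2 ^ ?d * n ^ (17 * \<kappa>)"
      using C[of n] by (rule order_trans[rotated])
    then have "real (ptas_time (2 * \<kappa>) n) \<le> real (C * 2 ^ ?d * n ^ (17 * \<kappa>))"
      by (simp only: of_nat_le_iff)
    then show ?thesis by simp
  qed
  then show ?thesis
    by (intro bigoI[of _ "real (C * 2 ^ ?d)"] eventually_at_top_linorderI[of 1]) auto
qed

theorem theorem2:
  shows "(\<exists>d::nat. \<forall>\<epsilon>::real. 0 < \<epsilon> \<and> \<epsilon> < 1 \<and> (1 + \<epsilon>) / \<epsilon> \<in> \<int> \<longrightarrow>
            (\<exists>A T. (\<lambda>n. real (T n)) \<in> O(\<lambda>n. (real n powr (1 / \<epsilon>)) ^ d) \<and>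
                   approx_algorithm 1 (1 - \<epsilon>) A T))
         \<and> admits_PTAS 1"
proof
  show "\<exists>d::nat. \<forall>\<epsilon>::real. 0 < \<epsilon> \<and> \<epsilon> < 1 \<and> (1 + \<epsilon>) / \<epsilon> \<in> \<int> \<longrightarrow>
            (\<exists>A T. (\<lambda>n. real (T n)) \<in> O(\<lambda>n. (real n powr (1 / \<epsilon>)) ^ d) \<and>
                   approx_algorithm 1 (1 - \<epsilon>) A T)"
  proof (intro exI[of _ 17] allI impI)
    fix \<epsilon> :: real assume e: "0 < \<epsilon> \<and> \<epsilon> < 1 \<and> (1 + \<epsilon>) / \<epsilon> \<in> \<int>"
    then obtain z where z: "(1 + \<epsilon>) / \<epsilon> = of_int z" by (auto elim: Ints_cases)
    define \<kappa> where "\<kappa> = nat (z - 1)"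
    \<comment> \<open>The integrality assumption amounts to that of 1/\<epsilon>, since the two
      quotients differ by 1. With parameter \<open>2 * \<kappa>\<close> the ratio is then exactly 1
      - \<epsilon>.\<close>
    have inv: "1 / \<epsilon> = of_int (z - 1)" using z e by (simp add: field_simps)
    have "0 < 1 / \<epsilon>" using e by simp
    then have zp: "0 < z - 1" unfolding inv by simp
    then have k: "1 / \<epsilon> = real \<kappa>" "1 \<le> \<kappa>" using inv unfolding \<kappa>_def by auto
    then have eps: "\<epsilon> = 1 / real \<kappa>" using e by (simp add: field_simps)
    have "(\<lambda>n. real (ptas_time (2 * \<kappa>) n)) \<in> O(\<lambda>n. (real n powr (1 / \<epsilon>)) ^ 17)"
    proof -
      \<comment> \<open>As \<open>\<kappa>\<close> is positive, this includes \<open>n = 0\<close>,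
        where both sides vanish.\<close>
      have "(real n powr (1 / \<epsilon>)) ^ 17 = real n ^ (17 * \<kappa>)" for n
        using k(2) powr_realpow'[of "real n" \<kappa>] unfolding k(1)
        by (simp add: power_mult[symmetric] mult.commute)
      then show ?thesis using ptas_time_bigo[OF k(2)] by simp
    qed
    moreover have "approx_algorithm 1 (1 - \<epsilon>) (ptas_com (2 * \<kappa>)) (ptas_time (2 * \<kappa>))"
      using ptas_correct[of "2 * \<kappa>"] k(2) by (simp add: eps)
    ultimately show "\<exists>A T. (\<lambda>n. real (T n)) \<in> O(\<lambda>n. (real n powr (1 / \<epsilon>)) ^ 17) \<and>
                   approx_algorithm 1 (1 - \<epsilon>) A T" by blast
  qed
  show "admits_PTAS 1"
    unfolding admits_PTAS_def
  \<comment> \<open>Rounding 1/\<epsilon> up handles every positive \<epsilon>, also those above 1,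
    and leaves an exponent that depends on 1/\<epsilon> alone.\<close>
  proof (rule exI[of _ "\<lambda>\<epsilon>. ptas_com (2 * nat \<lceil>1 / \<epsilon>\<rceil>)"],
      rule exI[of _ "\<lambda>z. 17 * real (nat \<lceil>z\<rceil>)"], intro allI impI)
    fix \<epsilon> :: real assume e: "0 < \<epsilon>"
    let ?k = "nat \<lceil>1 / \<epsilon>\<rceil>"
    have k: "1 \<le> ?k" "1 / \<epsilon> \<le> real ?k" using e by (auto simp: Suc_le_eq)
    have "real n powr (17 * real m) = real n ^ (17 * m)" if "1 \<le> m" for n m
      using that powr_realpow'[of "real n" "17 * m"] by simp
    from this[OF k(1)] have T: "(\<lambda>n. real (ptas_time (2 * ?k) n)) \<in> O(\<lambda>n. real n powr (17 * real ?k))"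
      using ptas_time_bigo[OF k(1)] by simp
    \<comment> \<open>The empty selection is feasible. Nonnegativity of the optimum allows the ratio
      to be weakened to 1 - \<epsilon>, which may be negative.\<close>
    have opt0: "0 \<le> OPT 1 js" for js
    proof -
      let ?P = "{total_profit js S | S. \<exists>F x y. fs_schedule 1 js S F x y \<and> makespan js S y \<le> 1}"
      have "?P \<subseteq> total_profit js ` Pow {..<length js}" unfolding fs_schedule_def by blast
      then have "finite ?P" by (rule finite_subset) simp
      moreover have "\<exists>F x y. fs_schedule 1 js {} F x y \<and> makespan js {} y \<le> 1"
        by (intro exI[of _ "\<lambda>_. 0"]) (simp add: fs_schedule_def makespan_def)
      then have "total_profit js {} \<in> ?P" by blast
      ultimately have "total_profit js {} \<le> OPT 1 js" unfolding OPT_def by (rule Max_ge)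
      then show ?thesis by (simp add: total_profit_def)
    qed
    have "1 - \<epsilon> \<le> 1 - 2 / real (2 * ?k)"
    proof -
      have "1 / m \<le> \<epsilon>" if "1 / \<epsilon> \<le> m" for m
      proof -
        have "0 < m" using that e by (meson divide_pos_pos less_le_trans zero_less_one)
        then show ?thesis using that e by (simp add: field_simps)
      qed
      from this[OF k(2)] show ?thesis by simp
    qed
    then have "(1 - \<epsilon>) * OPT 1 js \<le> (1 - 2 / real (2 * ?k)) * OPT 1 js" for js
      using opt0 by (intro mult_right_mono)
    moreover have "approx_algorithm 1 (1 - 2 / real (2 * ?k)) (ptas_com (2 * ?k)) (ptas_time (2 * ?k))"
      by (rule ptas_correct) (use k(1) in simp)
    ultimately have "approx_algorithm 1 (1 - \<epsilon>) (ptas_com (2 * ?k)) (ptas_time (2 * ?k))"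
      unfolding approx_algorithm_def by (meson order_trans)
    with T show "\<exists>T. (\<lambda>n. real (T n)) \<in> O(\<lambda>n. real n powr (17 * real ?k)) \<and>
      approx_algorithm 1 (1 - \<epsilon>) (ptas_com (2 * ?k)) T" by blast
  qed
qed

end
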